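(* Let $\Omega\subset\mathbb{R}^d$, $d\in\{2,3\}$, be an open, bounded, connected Lipschitz domain, let $K$ be a bounded, uniformly positive definite symmetric coefficient matrix on $\Omega$, and let $0\le\alpha\le1$. Let the spaces $V,Q_b,Q$, the norms $\|\cdot\|_V,\|\cdot\|_b,\|\cdot\|_c$, the energy norm $|||\cdot|||$ and the forms $a,b,c$ be as defined in the context. Then the following hold, where $x\gtrsim y$ means $x\ge C y$ with a constant $C>0$ independent of the model parameters $K$ and $\alpha$: (i) $a(v,v)\gtrsim\|v\|_V^2$ for all $v\in V$ with $b(v,q)=0$ for all $q\in Q_b$; (ii) $\displaystyle\sup_{v\in V}\frac{b(v,p)}{\|v\|_V}\gtrsim\|p\|_b$ for all $p\in Q_b$; (iii) $\displaystyle\sup_{(v,q)\in V\times Q}\frac{a(u,v)+b(u,q)}{|||(v,q)|||}\gtrsim\|u\|_V$ for all $u\in V$. In turn, the mixed generalized Poisson problem, find $(u,p)\in V\times Q$ such that $$a(u,v)-b(v,p)=F(v)\quad\forall v\in V,\qquad b(u,q)+\alpha\,c(p,q)=G(q)\quad\forall q\in Q,$$ is stable in the energy norm $|||\cdot|||$: it has a unique solution for all $F$ and $G$ in the duals of $V$ and $Q$, and $|||(u,p)|||$ is bounded by a constant, independent of $K$ and $\alpha$, times the norm of the data $(F,G)$ dual to $|||\cdot|||$.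
   Context: The problem is the mixed form of $-\nabla\cdot(K\nabla p)+\alpha p=f$ in $\Omega$, $p=0$ on $\partial\Omega$, with flux $u=-K\nabla p$ (so $F=0$ and $G(q)=\int_\Omega fq$ in that case). Write $\|\cdot\|_{0,\Omega}$ for the $L^2(\Omega)$ norm. The spaces are $$V=K^{-1/2}\mathbf L^2(\Omega)\cap\mathbf H(\mathrm{div},\Omega),\qquad Q_b=K^{1/2}H^1(\Omega)+L^2(\Omega),\qquad Q=L^2(\Omega)\cap Q_b=L^2(\Omega),$$ where $\mathbf H(\mathrm{div},\Omega)=\{v\in L^2(\Omega)^d:\nabla\cdot v\in L^2(\Omega)\}$, and the intersection and summation spaces are defined by the parameter-dependent norms $$\|v\|_V^2=\|K^{-1/2}v\|_{0,\Omega}^2+\|\nabla\cdot v\|_{0,\Omega}^2,\qquad \|p\|_b^2=\inf_{r\in K^{1/2}H^1(\Omega)}\left(\|p-r\|_{0,\Omega}^2+\|K^{1/2}\nabla r\|_{0,\Omega}^2\right).$$ Moreover, $$\|p\|_c^2=c(p,p)=\|p\|_{0,\Omega}^2,\qquad |||(v,q)|||^2=\|v\|_V^2+\|q\|_b^2+\alpha\|q\|_c^2.$$ Bilinear forms: $a(u,v)=\int_\Omega K^{-1}u\cdot v$, $b(v,q)=\int_\Omega(\nabla\cdot v)\,q$, $c(p,q)=\int_\Omega p\,q$. *)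

theory Defs
  imports "HOL-Analysis.Analysis"
begin

section \<open>Lipschitz domains\<close>

text \<open>
  Near each boundary point, and up to a rigid motion, the domain is the strict epigraph of a
  Lipschitz function: \<open>e\<close> is the direction of the last coordinate axis and \<open>y - (y \<bullet> e) e\<close> holds
  the remaining coordinates of \<open>y\<close>.
\<close>

definition Lipschitz_domain :: "(real ^ 'n) set \<Rightarrow> bool" where
  "Lipschitz_domain \<Omega> \<longleftrightarrow>
     \<Omega> \<noteq> {} \<and> open \<Omega> \<and> connected \<Omega> \<and> bounded \<Omega> \<and>
     (\<forall>x \<in> frontier \<Omega>. \<exists>r>0. \<exists>e L g. norm e = 1 \<and> L-lipschitz_on {z. z \<bullet> e = 0} g \<and>
        \<Omega> \<inter> ball x r = {y \<in> ball x r. g (y - (y \<bullet> e) *\<^sub>R e) < y \<bullet> e})"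


section \<open>Square integrable functions and weak derivatives\<close>

text \<open>
  Elements of function spaces are represented by functions on the whole of \<open>real ^ 'n\<close>; only their
  values almost everywhere on \<open>\<Omega>\<close> matter.
\<close>

definition L2 :: "(real ^ 'n) set \<Rightarrow> (real ^ 'n \<Rightarrow> 'b::euclidean_space) set" where
  "L2 \<Omega> = {f \<in> borel_measurable (lebesgue_on \<Omega>). integrable (lebesgue_on \<Omega>) (\<lambda>x. (norm (f x))\<^sup>2)}"

definition L2_norm :: "(real ^ 'n) set \<Rightarrow> (real ^ 'n \<Rightarrow> 'b::euclidean_space) \<Rightarrow> real" where
  "L2_norm \<Omega> f = sqrt (LINT x|lebesgue_on \<Omega>. (norm (f x))\<^sup>2)"

definition grad :: "(real ^ 'n \<Rightarrow> real) \<Rightarrow> real ^ 'n \<Rightarrow> real ^ 'n" where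
  "grad \<phi> x = (\<chi> i. frechet_derivative \<phi> (at x) (axis i 1))"

primrec C_k :: "nat \<Rightarrow> (real ^ 'n \<Rightarrow> real) \<Rightarrow> bool" where
  "C_k 0 \<phi> \<longleftrightarrow> continuous_on UNIV \<phi>"
| "C_k (Suc k) \<phi> \<longleftrightarrow> (\<forall>x. \<phi> differentiable at x) \<and> (\<forall>i. C_k k (\<lambda>x. grad \<phi> x $ i))"

definition test_functions :: "(real ^ 'n) set \<Rightarrow> (real ^ 'n \<Rightarrow> real) set" where
  "test_functions \<Omega> = {\<phi>. (\<forall>k. C_k k \<phi>) \<and> compact (closure {x. \<phi> x \<noteq> 0}) \<and> closure {x. \<phi> x \<noteq> 0} \<subseteq> \<Omega>}"

definition is_weak_div :: "(real ^ 'n) set \<Rightarrow> (real ^ 'n \<Rightarrow> real ^ 'n) \<Rightarrow> (real ^ 'n \<Rightarrow> real) \<Rightarrow> bool" where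
  "is_weak_div \<Omega> v w \<longleftrightarrow> (\<forall>\<phi> \<in> test_functions \<Omega>.
     (LINT x|lebesgue_on \<Omega>. v x \<bullet> grad \<phi> x) = - (LINT x|lebesgue_on \<Omega>. w x * \<phi> x))"

definition is_weak_grad :: "(real ^ 'n) set \<Rightarrow> (real ^ 'n \<Rightarrow> real) \<Rightarrow> (real ^ 'n \<Rightarrow> real ^ 'n) \<Rightarrow> bool" where
  "is_weak_grad \<Omega> r g \<longleftrightarrow> (\<forall>\<phi> \<in> test_functions \<Omega>.
     (LINT x|lebesgue_on \<Omega>. r x *\<^sub>R grad \<phi> x) = - (LINT x|lebesgue_on \<Omega>. \<phi> x *\<^sub>R g x))"

definition Hdiv :: "(real ^ 'n) set \<Rightarrow> (real ^ 'n \<Rightarrow> real ^ 'n) set" where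
  "Hdiv \<Omega> = {v \<in> L2 \<Omega>. \<exists>w \<in> L2 \<Omega>. is_weak_div \<Omega> v w}"

definition H1 :: "(real ^ 'n) set \<Rightarrow> (real ^ 'n \<Rightarrow> real) set" where
  "H1 \<Omega> = {r \<in> L2 \<Omega>. \<exists>g \<in> L2 \<Omega>. is_weak_grad \<Omega> r g}"

text \<open>
  Weak derivatives are unique up to null sets, so the following select a representative; they are
  meaningful on \<open>Hdiv \<Omega>\<close> and \<open>H1 \<Omega>\<close>, respectively.
\<close>

definition weak_div :: "(real ^ 'n) set \<Rightarrow> (real ^ 'n \<Rightarrow> real ^ 'n) \<Rightarrow> real ^ 'n \<Rightarrow> real" where
  "weak_div \<Omega> v = (SOME w. w \<in> L2 \<Omega> \<and> is_weak_div \<Omega> v w)"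

definition weak_grad :: "(real ^ 'n) set \<Rightarrow> (real ^ 'n \<Rightarrow> real) \<Rightarrow> real ^ 'n \<Rightarrow> real ^ 'n" where
  "weak_grad \<Omega> r = (SOME g. g \<in> L2 \<Omega> \<and> is_weak_grad \<Omega> r g)"


section \<open>The coefficient matrix\<close>

definition admissible_coefficient :: "(real ^ 'n) set \<Rightarrow> (real ^ 'n \<Rightarrow> real ^ 'n ^ 'n) \<Rightarrow> bool" where
  "admissible_coefficient \<Omega> K \<longleftrightarrow>
     K \<in> borel_measurable (lebesgue_on \<Omega>) \<and>
     (AE x in lebesgue_on \<Omega>. transpose (K x) = K x) \<and>
     (\<exists>M. AE x in lebesgue_on \<Omega>. norm (K x) \<le> M) \<and>
     (\<exists>\<kappa>>0. AE x in lebesgue_on \<Omega>. \<forall>\<xi>. \<kappa> * (norm \<xi>)\<^sup>2 \<le> \<xi> \<bullet> (K x *v \<xi>))"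

text \<open>The symmetric positive semidefinite square root.\<close>

definition matrix_sqrt :: "real ^ 'n ^ 'n \<Rightarrow> real ^ 'n ^ 'n" where
  "matrix_sqrt A = (THE S. transpose S = S \<and> (\<forall>\<xi>. 0 \<le> \<xi> \<bullet> (S *v \<xi>)) \<and> S ** S = A)"


section \<open>Spaces, norms and forms\<close>

text \<open>
  A weight in front of a space weights the norm of that space. Thus \<open>K\<^sup>-\<^sup>1\<^sup>/\<^sup>2L\<^sup>2\<close> consists of the \<open>v\<close>
  with \<open>K\<^sup>-\<^sup>1\<^sup>/\<^sup>2 v\<close> in \<open>L\<^sup>2\<close>, and \<open>K\<^sup>1\<^sup>/\<^sup>2H\<^sup>1\<close> of the \<open>r\<close> in \<open>H\<^sup>1\<close> with \<open>K\<^sup>1\<^sup>/\<^sup>2 \<nabla>r\<close> in \<open>L\<^sup>2\<close>. No boundary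
  condition is imposed in \<open>H\<^sup>1\<close>, so constants have \<open>b_norm\<close> zero.
\<close>

definition V :: "(real ^ 'n) set \<Rightarrow> (real ^ 'n \<Rightarrow> real ^ 'n ^ 'n) \<Rightarrow> (real ^ 'n \<Rightarrow> real ^ 'n) set" where
  "V \<Omega> K = {v. (\<lambda>x. matrix_inv (matrix_sqrt (K x)) *v v x) \<in> L2 \<Omega>} \<inter> Hdiv \<Omega>"

definition weighted_H1 :: "(real ^ 'n) set \<Rightarrow> (real ^ 'n \<Rightarrow> real ^ 'n ^ 'n) \<Rightarrow> (real ^ 'n \<Rightarrow> real) set" where
  "weighted_H1 \<Omega> K = {r \<in> H1 \<Omega>. (\<lambda>x. matrix_sqrt (K x) *v weak_grad \<Omega> r x) \<in> L2 \<Omega>}"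

definition Q\<^sub>b :: "(real ^ 'n) set \<Rightarrow> (real ^ 'n \<Rightarrow> real ^ 'n ^ 'n) \<Rightarrow> (real ^ 'n \<Rightarrow> real) set" where
  "Q\<^sub>b \<Omega> K = {\<lambda>x. r x + s x | r s. r \<in> weighted_H1 \<Omega> K \<and> s \<in> L2 \<Omega>}"

definition Q :: "(real ^ 'n) set \<Rightarrow> (real ^ 'n \<Rightarrow> real ^ 'n ^ 'n) \<Rightarrow> (real ^ 'n \<Rightarrow> real) set" where
  "Q \<Omega> K = L2 \<Omega> \<inter> Q\<^sub>b \<Omega> K"

definition a_form :: "(real ^ 'n) set \<Rightarrow> (real ^ 'n \<Rightarrow> real ^ 'n ^ 'n) \<Rightarrow>
    (real ^ 'n \<Rightarrow> real ^ 'n) \<Rightarrow> (real ^ 'n \<Rightarrow> real ^ 'n) \<Rightarrow> real" where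
  "a_form \<Omega> K u v = (LINT x|lebesgue_on \<Omega>. (matrix_inv (K x) *v u x) \<bullet> v x)"

definition b_form :: "(real ^ 'n) set \<Rightarrow> (real ^ 'n \<Rightarrow> real ^ 'n) \<Rightarrow> (real ^ 'n \<Rightarrow> real) \<Rightarrow> real" where
  "b_form \<Omega> v q = (LINT x|lebesgue_on \<Omega>. weak_div \<Omega> v x * q x)"

definition c_form :: "(real ^ 'n) set \<Rightarrow> (real ^ 'n \<Rightarrow> real) \<Rightarrow> (real ^ 'n \<Rightarrow> real) \<Rightarrow> real" where
  "c_form \<Omega> p q = (LINT x|lebesgue_on \<Omega>. p x * q x)"

definition V_norm :: "(real ^ 'n) set \<Rightarrow> (real ^ 'n \<Rightarrow> real ^ 'n ^ 'n) \<Rightarrow> (real ^ 'n \<Rightarrow> real ^ 'n) \<Rightarrow> real" where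
  "V_norm \<Omega> K v = sqrt ((L2_norm \<Omega> (\<lambda>x. matrix_inv (matrix_sqrt (K x)) *v v x))\<^sup>2
                       + (L2_norm \<Omega> (weak_div \<Omega> v))\<^sup>2)"

definition b_norm :: "(real ^ 'n) set \<Rightarrow> (real ^ 'n \<Rightarrow> real ^ 'n ^ 'n) \<Rightarrow> (real ^ 'n \<Rightarrow> real) \<Rightarrow> real" where
  "b_norm \<Omega> K p = sqrt (INF r \<in> weighted_H1 \<Omega> K.
      (L2_norm \<Omega> (\<lambda>x. p x - r x))\<^sup>2 + (L2_norm \<Omega> (\<lambda>x. matrix_sqrt (K x) *v weak_grad \<Omega> r x))\<^sup>2)"

definition c_norm :: "(real ^ 'n) set \<Rightarrow> (real ^ 'n \<Rightarrow> real) \<Rightarrow> real" where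
  "c_norm \<Omega> p = sqrt (c_form \<Omega> p p)"

definition energy_norm :: "(real ^ 'n) set \<Rightarrow> (real ^ 'n \<Rightarrow> real ^ 'n ^ 'n) \<Rightarrow> real \<Rightarrow>
    (real ^ 'n \<Rightarrow> real ^ 'n) \<Rightarrow> (real ^ 'n \<Rightarrow> real) \<Rightarrow> real" where
  "energy_norm \<Omega> K \<alpha> v q = sqrt ((V_norm \<Omega> K v)\<^sup>2 + (b_norm \<Omega> K q)\<^sup>2 + \<alpha> * (c_norm \<Omega> q)\<^sup>2)"


section \<open>Duals and the mixed problem\<close>

definition dual_space :: "('a \<Rightarrow> 'b::real_vector) set \<Rightarrow> (('a \<Rightarrow> 'b) \<Rightarrow> real) \<Rightarrow> (('a \<Rightarrow> 'b) \<Rightarrow> real) set" where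
  "dual_space X N = {F.
     (\<forall>v\<in>X. \<forall>w\<in>X. F (\<lambda>x. v x + w x) = F v + F w) \<and>
     (\<forall>c. \<forall>v\<in>X. F (\<lambda>x. c *\<^sub>R v x) = c * F v) \<and>
     (\<exists>M. \<forall>v\<in>X. \<bar>F v\<bar> \<le> M * N v)}"

text \<open>
  Extended real valued: for \<open>\<alpha> = 0\<close> the energy norm does not control constants in \<open>Q\<close>, and the
  supremum is infinite when \<open>G\<close> does not vanish on them.
\<close>

definition data_norm :: "(real ^ 'n) set \<Rightarrow> (real ^ 'n \<Rightarrow> real ^ 'n ^ 'n) \<Rightarrow> real \<Rightarrow>
    ((real ^ 'n \<Rightarrow> real ^ 'n) \<Rightarrow> real) \<Rightarrow> ((real ^ 'n \<Rightarrow> real) \<Rightarrow> real) \<Rightarrow> ereal" where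
  "data_norm \<Omega> K \<alpha> F G =
     (SUP (v, q) \<in> {(v, q). v \<in> V \<Omega> K \<and> q \<in> Q \<Omega> K \<and> energy_norm \<Omega> K \<alpha> v q \<noteq> 0}.
        ereal ((F v + G q) / energy_norm \<Omega> K \<alpha> v q))"

definition mixed_solution :: "(real ^ 'n) set \<Rightarrow> (real ^ 'n \<Rightarrow> real ^ 'n ^ 'n) \<Rightarrow> real \<Rightarrow>
    ((real ^ 'n \<Rightarrow> real ^ 'n) \<Rightarrow> real) \<Rightarrow> ((real ^ 'n \<Rightarrow> real) \<Rightarrow> real) \<Rightarrow>
    (real ^ 'n \<Rightarrow> real ^ 'n) \<Rightarrow> (real ^ 'n \<Rightarrow> real) \<Rightarrow> bool" where
  "mixed_solution \<Omega> K \<alpha> F G u p \<longleftrightarrow>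
     u \<in> V \<Omega> K \<and> p \<in> Q \<Omega> K \<and>
     (\<forall>v \<in> V \<Omega> K. a_form \<Omega> K u v - b_form \<Omega> v p = F v) \<and>
     (\<forall>q \<in> Q \<Omega> K. b_form \<Omega> u q + \<alpha> * c_form \<Omega> p q = G q)"

end

theory Submission
  imports Defs
begin

text \<open>
  Let \<open>v\<^sub>p\<close> be the Riesz representative in \<open>V\<close> of \<open>v \<mapsto> b(v, p)\<close>. Testing its equation with smooth fields
  shows that \<open>r = p - div v\<^sub>p\<close> has the weak gradient \<open>- K\<^sup>-\<^sup>1 v\<^sub>p\<close>, so \<open>r\<close> competes in the infimum that defines
  \<open>\<parallel>p\<parallel>\<^sub>b\<close> and \<open>\<parallel>p\<parallel>\<^sub>b \<le> \<parallel>v\<^sub>p\<parallel>\<^sub>V = b(v\<^sub>p, p) / \<parallel>v\<^sub>p\<parallel>\<^sub>V\<close>: the inf-sup constant is one, whatever \<open>K\<close>. The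
  other two conditions follow from \<open>Q\<^sub>b = L\<^sup>2\<close> and the choices \<open>q = div v\<close> and \<open>(v, q) = (u, div u)\<close>. The same
  test functions give the stability estimate. Existence reduces to a coercive symmetric problem for
  \<open>p\<close> alone. Its coercivity constant may depend on \<open>K\<close>; it comes from the surjectivity of the
  divergence, which the Friedrichs inequality for test functions provides.
\<close>

section \<open>Square roots of positive definite matrices\<close>

text \<open>Functions that agree almost everywhere are not identified, and \<open>weak_div\<close>,
  \<open>weak_grad\<close> and \<open>matrix_sqrt\<close> are choices made by \<open>SOME\<close> or
  \<open>THE\<close>. Linearity of the divergence therefore holds only almost everywhere,
  measurability of the square root has to be proved, and the Hilbert space arguments run on sets of
  functions with a form that may vanish on nonzero elements. The obstacle to uniformity is that
  every comparison of a weighted norm with an unweighted one costs a constant depending on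
  \<open>K\<close>. Such comparisons are confined to membership, completeness, existence and
  uniqueness; the robust estimates use only relations free of such constants, above all K^(1/2)
  K^(-1) = K^(-1/2). For \<alpha> = 0 the energy norm vanishes on pairs of zero and a constant,
  whereas G is only bounded in \<open>L2_norm\<close>. Energy estimates alone thus cannot produce a
  pressure, and the problem is solved in \<open>L2\<close> first. Inserting divergences of test
  fields into the second equation eliminates u without a division by \<alpha>, which keeps \<alpha>
  = 0 inside the general argument.\<close>

lemma bounded_bilinear_matrix_matrix_mult:
  "bounded_bilinear ((**) :: real ^ 'n ^ 'm \<Rightarrow> real ^ 'p ^ 'n \<Rightarrow> real ^ 'p ^ 'm)"
proof -
  have "bilinear ((**) :: real ^ 'n ^ 'm \<Rightarrow> real ^ 'p ^ 'n \<Rightarrow> real ^ 'p ^ 'm)"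
    unfolding bilinear_def
    by (auto intro!: linearI simp: vec_eq_iff matrix_matrix_mult_def algebra_simps sum.distrib
        sum_distrib_left)
  then show ?thesis
    by (simp add: bilinear_conv_bounded_bilinear)
qed

lemma bounded_bilinear_matrix_vector_mult:
  "bounded_bilinear ((*v) :: real ^ 'n ^ 'm \<Rightarrow> real ^ 'n \<Rightarrow> real ^ 'm)"
proof -
  have "bilinear ((*v) :: real ^ 'n ^ 'm \<Rightarrow> real ^ 'n \<Rightarrow> real ^ 'm)"
    unfolding bilinear_def
    by (auto intro!: linearI simp: vec_eq_iff matrix_vector_mult_def algebra_simps sum.distrib
        sum_distrib_left)
  then show ?thesis
    by (simp add: bilinear_conv_bounded_bilinear)
qed

lemmas matrix_mult_simps =
  bounded_bilinear.add_left[OF bounded_bilinear_matrix_matrix_mult]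
  bounded_bilinear.add_right[OF bounded_bilinear_matrix_matrix_mult]
  bounded_bilinear.diff_left[OF bounded_bilinear_matrix_matrix_mult]
  bounded_bilinear.diff_right[OF bounded_bilinear_matrix_matrix_mult]
  bounded_bilinear.scaleR_left[OF bounded_bilinear_matrix_matrix_mult]
  bounded_bilinear.scaleR_right[OF bounded_bilinear_matrix_matrix_mult]

lemmas matrix_vector_simps =
  bounded_bilinear.add_left[OF bounded_bilinear_matrix_vector_mult]
  bounded_bilinear.add_right[OF bounded_bilinear_matrix_vector_mult]
  bounded_bilinear.diff_left[OF bounded_bilinear_matrix_vector_mult]
  bounded_bilinear.diff_right[OF bounded_bilinear_matrix_vector_mult]
  bounded_bilinear.scaleR_left[OF bounded_bilinear_matrix_vector_mult]
  bounded_bilinear.scaleR_right[OF bounded_bilinear_matrix_vector_mult]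

lemma symmetric_matrix_inner:
  fixes A :: "real ^ 'n ^ 'n"
  assumes "transpose A = A"
  shows "(A *v x) \<bullet> y = x \<bullet> (A *v y)"
  by (metis assms dot_lmul_matrix transpose_matrix_vector)

lemma symmetric_matrixI:
  fixes A :: "real ^ 'n ^ 'n"
  assumes "\<And>x y. (A *v x) \<bullet> y = x \<bullet> (A *v y)"
  shows "transpose A = A"
proof -
  have "x v* A = A *v x" for x
  proof (rule vector_eq_rdot[THEN iffD1], rule allI)
    fix y show "(x v* A) \<bullet> y = (A *v x) \<bullet> y"
      by (simp add: dot_lmul_matrix assms)
  qed
  then show ?thesis
    by (simp add: matrix_eq)
qed

text \<open>The matrix norm of the type is the Frobenius norm; Cauchy-Schwarz applies to each
  row.\<close>

lemma norm_matrix_vector_le_norm: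
  fixes A :: "real ^ 'n ^ 'm"
  shows "norm (A *v x) \<le> norm A * norm x"
proof -
  have "norm (A *v x) \<le> L2_set (\<lambda>i. norm (A $ i) * norm x) UNIV"
    unfolding norm_vec_def[of "A *v x"]
    by (rule L2_set_mono) (auto simp: matrix_vector_mul_component Cauchy_Schwarz_ineq2)
  also have "\<dots> = norm A * norm x"
    by (simp add: L2_set_left_distrib norm_vec_def)
  finally show ?thesis .
qed

text \<open>Convergence is measured in the Frobenius norm, while the contraction bounds of
  \<open>sqrt_iter_limit\<close> live in the operator norm; any dimensional constant suffices to
  pass between them.\<close>

lemma norm_le_onorm_matrix:
  fixes A :: "real ^ 'n ^ 'm"
  shows "norm A \<le> real CARD('m) * (real CARD('n) * onorm ((*v) A))"
proof -
  have row: "norm (A $ i) \<le> real CARD('n) * onorm ((*v) A)" for i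
  proof -
    have "norm (A $ i) \<le> (\<Sum>j\<in>UNIV. \<bar>A $ i $ j\<bar>)"
      by (rule norm_le_l1_cart)
    also have "\<dots> \<le> (\<Sum>j\<in>(UNIV :: 'n set). onorm ((*v) A))"
      by (intro sum_mono matrix_component_le_onorm)
    finally show ?thesis by simp
  qed
  have "norm A \<le> (\<Sum>i\<in>UNIV. norm (A $ i))"
    unfolding norm_vec_def by (rule L2_set_le_sum) auto
  also have "\<dots> \<le> (\<Sum>i\<in>(UNIV :: 'm set). real CARD('n) * onorm ((*v) A))"
    by (intro sum_mono row)
  finally show ?thesis by simp
qed

lemma onorm_matrix_mult_le:
  fixes A :: "real ^ 'n ^ 'm" and B :: "real ^ 'p ^ 'n"
  shows "onorm ((*v) (A ** B)) \<le> onorm ((*v) A) * onorm ((*v) B)"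
  using onorm_compose[of "(*v) A" "(*v) B"]
  by (simp add: o_def matrix_vector_mul_assoc matrix_vector_mul_bounded_linear)

lemma onorm_matrix_add_le:
  fixes A B :: "real ^ 'n ^ 'm"
  shows "onorm ((*v) (A + B)) \<le> onorm ((*v) A) + onorm ((*v) B)"
proof -
  have "(*v) (A + B) = (\<lambda>x. A *v x + B *v x)"
    by (simp add: fun_eq_iff matrix_vector_simps)
  then show ?thesis
    using onorm_triangle[of "(*v) A" "(*v) B"] by (simp add: matrix_vector_mul_bounded_linear)
qed

lemma onorm_matrix_scaleR:
  fixes A :: "real ^ 'n ^ 'm"
  shows "onorm ((*v) (c *\<^sub>R A)) = \<bar>c\<bar> * onorm ((*v) A)"
proof -
  have "(*v) (c *\<^sub>R A) = (\<lambda>x. c *\<^sub>R (A *v x))"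
    by (simp add: fun_eq_iff matrix_vector_simps)
  then show ?thesis
    using onorm_scaleR[of "(*v) A" c] by (simp add: matrix_vector_mul_bounded_linear)
qed

lemma tendsto_matrix_vector_mult:
  fixes A :: "'a \<Rightarrow> real ^ 'n ^ 'm"
  assumes "(A \<longlongrightarrow> L) F"
  shows "((\<lambda>k. A k *v x) \<longlongrightarrow> L *v x) F"
  by (intro bounded_bilinear.tendsto[OF bounded_bilinear_matrix_vector_mult] assms tendsto_const)

text \<open>A fixed point \<open>Y\<close> of this iteration satisfies \<open>(1 - Y)\<^sup>2 = 1 - B\<close>.\<close>

primrec sqrt_iter :: "real ^ 'n ^ 'n \<Rightarrow> nat \<Rightarrow> real ^ 'n ^ 'n" where
  "sqrt_iter B 0 = 0"
| "sqrt_iter B (Suc k) = (1/2) *\<^sub>R (B + sqrt_iter B k ** sqrt_iter B k)"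

text \<open>Each iterate is a polynomial in the entries of \<open>B\<close>. This is what later
  carries measurability from \<open>K\<close> to its square root.\<close>

lemma continuous_on_sqrt_iter: "continuous_on UNIV (\<lambda>B. sqrt_iter B k)"
  by (induction k)
    (auto intro!: continuous_intros bounded_bilinear.continuous_on[OF bounded_bilinear_matrix_matrix_mult])

text \<open>The map from Y to (B + Y^2)/2 sends the operator ball of radius \<beta> < 1 into itself
  and contracts there with factor \<beta>, so the increments decay geometrically. Symmetry, the
  fixed point equation and the bound pass to the limit.\<close>

lemma sqrt_iter_limit:
  fixes B :: "real ^ 'n ^ 'n"
  assumes sym: "transpose B = B" and b: "\<And>\<xi>. norm (B *v \<xi>) \<le> \<beta> * norm \<xi>" and "\<beta> < 1"
  obtains Y where "sqrt_iter B \<longlonglongrightarrow> Y" "transpose Y = Y" "2 *\<^sub>R Y = B + Y ** Y"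
    "\<And>\<xi>. norm (Y *v \<xi>) \<le> \<beta> * norm \<xi>"
proof -
  let ?N = "\<lambda>A :: real ^ 'n ^ 'n. onorm ((*v) A)" and ?Y = "sqrt_iter B"
  have NB: "?N B \<le> \<beta>"
    by (rule onorm_le) (rule b)
  have N0: "0 \<le> ?N A" for A
    by (intro onorm_pos_le matrix_vector_mul_bounded_linear)
  have b0: "0 \<le> \<beta>"
    using N0[of B] NB by linarith
  have NY: "?N (?Y k) \<le> \<beta>" for k
  proof (induction k)
    case 0
    show ?case using b0 by (simp add: onorm_zero)
  next
    case (Suc k)
    have "?N (?Y (Suc k)) \<le> (1/2) * (?N B + ?N (?Y k ** ?Y k))"
      using onorm_matrix_add_le[of B "?Y k ** ?Y k"] by (simp add: onorm_matrix_scaleR)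
    also have "?N (?Y k ** ?Y k) \<le> ?N (?Y k) * ?N (?Y k)"
      by (rule onorm_matrix_mult_le)
    also have "\<dots> \<le> \<beta> * 1"
      using Suc N0 b0 \<open>\<beta> < 1\<close> by (intro mult_mono) auto
    finally show ?case using NB by simp
  qed
  have ND: "?N (?Y (Suc k) - ?Y k) \<le> \<beta> ^ k * \<beta>" for k
  proof (induction k)
    case 0
    show ?case using NB b0 by (simp add: onorm_matrix_scaleR)
  next
    case (Suc k)
    let ?D = "?Y (Suc k) - ?Y k"
    \<comment> \<open>With Y' the later iterate, splitting the difference of squares as Y' D + D Y
      works without assuming that the iterates commute.\<close>
    have "?Y (Suc (Suc k)) - ?Y (Suc k)
        = (1/2) *\<^sub>R (?Y (Suc k) ** ?D + ?D ** ?Y k)"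
      unfolding sqrt_iter.simps(2)[of _ "Suc k"] sqrt_iter.simps(2)[of _ "k", THEN arg_cong[where f="\<lambda>z. _ - z"]]
      by (simp only: matrix_mult_simps) (simp add: algebra_simps)
    then have "?N (?Y (Suc (Suc k)) - ?Y (Suc k)) = (1/2) * ?N (?Y (Suc k) ** ?D + ?D ** ?Y k)"
      by (simp only: onorm_matrix_scaleR)
    also have "\<dots> \<le> (1/2) * (?N (?Y (Suc k)) * ?N ?D + ?N ?D * ?N (?Y k))"
      by (intro mult_left_mono order_trans[OF onorm_matrix_add_le] add_mono onorm_matrix_mult_le) simp
    also have "\<dots> \<le> (1/2) * (\<beta> * ?N ?D + ?N ?D * \<beta>)"
      by (intro mult_left_mono add_mono mult_right_mono NY N0) simp
    also have "\<dots> = \<beta> * ?N ?D" by simp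
    also have "\<dots> \<le> \<beta> * (\<beta> ^ k * \<beta>)"
      using Suc b0 by (rule mult_left_mono)
    finally show ?case by (simp add: mult_ac)
  qed
  let ?c = "real CARD('n)"
  have "summable (\<lambda>k. ?Y (Suc k) - ?Y k)"
  proof (rule summable_comparison_test')
    show "summable (\<lambda>k. (?c * ?c * \<beta>) * \<beta> ^ k)"
      using b0 \<open>\<beta> < 1\<close> by (intro summable_mult summable_geometric) auto
    fix k
    have "norm (?Y (Suc k) - ?Y k) \<le> ?c * (?c * ?N (?Y (Suc k) - ?Y k))"
      by (rule norm_le_onorm_matrix)
    also have "\<dots> \<le> ?c * (?c * (\<beta> ^ k * \<beta>))"
      by (intro mult_left_mono ND) auto
    finally show "norm (?Y (Suc k) - ?Y k) \<le> ?c * ?c * \<beta> * \<beta> ^ k"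
      by (simp add: mult_ac)
  qed
  then have "(\<lambda>n. \<Sum>k<n. ?Y (Suc k) - ?Y k) \<longlonglongrightarrow> (\<Sum>k. ?Y (Suc k) - ?Y k)"
    by (rule summable_LIMSEQ)
  then obtain Y where Y: "?Y \<longlonglongrightarrow> Y"
    unfolding sum_lessThan_telescope by simp
  have sk: "(?Y k *v x) \<bullet> y = x \<bullet> (?Y k *v y)" for k x y
  proof (induction k arbitrary: x y)
    case (Suc k)
    then show ?case
      using symmetric_matrix_inner[OF sym]
      by (simp add: matrix_vector_simps inner_add_left inner_add_right flip: matrix_vector_mul_assoc)
  qed simp
  show thesis
  proof
    show "?Y \<longlonglongrightarrow> Y" by fact
    show "transpose Y = Y"
    proof (rule symmetric_matrixI)
      fix x y
      have "(\<lambda>k. (?Y k *v x) \<bullet> y) \<longlonglongrightarrow> (Y *v x) \<bullet> y" "(\<lambda>k. x \<bullet> (?Y k *v y)) \<longlonglongrightarrow> x \<bullet> (Y *v y)"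
        by (intro tendsto_intros tendsto_matrix_vector_mult Y)+
      then show "(Y *v x) \<bullet> y = x \<bullet> (Y *v y)"
        unfolding sk using LIMSEQ_unique by blast
    qed
    show "2 *\<^sub>R Y = B + Y ** Y"
    proof -
      have "(\<lambda>k. 2 *\<^sub>R ?Y (Suc k)) \<longlonglongrightarrow> 2 *\<^sub>R Y"
        by (intro tendsto_intros LIMSEQ_Suc Y)
      moreover have "(\<lambda>k. B + ?Y k ** ?Y k) \<longlonglongrightarrow> B + Y ** Y"
        by (intro tendsto_intros bounded_bilinear.tendsto[OF bounded_bilinear_matrix_matrix_mult] Y)
      ultimately show ?thesis
        using LIMSEQ_unique by (auto simp: scaleR_2)
    qed
    show "norm (Y *v \<xi>) \<le> \<beta> * norm \<xi>" for \<xi>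
    proof (rule tendsto_upperbound)
      show "(\<lambda>k. norm (?Y k *v \<xi>)) \<longlonglongrightarrow> norm (Y *v \<xi>)"
        by (intro tendsto_intros tendsto_matrix_vector_mult Y)
      have "norm (?Y k *v \<xi>) \<le> \<beta> * norm \<xi>" for k
        using onorm[OF matrix_vector_mul_bounded_linear, of "?Y k" \<xi>] mult_right_mono[OF NY[of k], of "norm \<xi>"]
        by simp
      then show "\<forall>\<^sub>F k in sequentially. norm (?Y k *v \<xi>) \<le> \<beta> * norm \<xi>" by simp
    qed auto
  qed
qed

lemma invertible_if_coercive:
  fixes A :: "real ^ 'n ^ 'n"
  assumes "\<kappa> > 0" and "\<And>\<xi>. \<kappa> * (norm \<xi>)\<^sup>2 \<le> \<xi> \<bullet> (A *v \<xi>)"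
  shows "invertible A"
proof -
  have "x = 0" if "A *v x = 0" for x
    using assms(2)[of x] that \<open>\<kappa> > 0\<close> by (simp add: mult_le_0_iff)
  then show ?thesis
    by (simp add: invertible_left_inverse matrix_left_invertible_ker)
qed

text \<open>Uniqueness of square roots: for \<open>D = S - T\<close> one has \<open>S D + D T = 0\<close>, and multiplying by \<open>D\<close>
  and taking the trace leaves a sum of nonnegative terms.\<close>

lemma trace_congruence:
  fixes A D :: "real ^ 'n ^ 'n"
  assumes "transpose D = D"
  shows "trace (D ** A ** D) = (\<Sum>i\<in>UNIV. (D *v axis i 1) \<bullet> (A *v (D *v axis i 1)))"
proof -
  have "(D ** A ** D) $ i $ i = axis i 1 \<bullet> ((D ** A ** D) *v axis i 1)" for i
    by (simp add: inner_axis' matrix_vector_mul_component inner_axis)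
  then show ?thesis
    by (simp add: trace_def symmetric_matrix_inner[OF assms] flip: matrix_vector_mul_assoc)
qed

lemma psd_sqrt_unique:
  fixes S T :: "real ^ 'n ^ 'n"
  assumes S: "transpose S = S" and T: "transpose T = T" and eq: "S ** S = T ** T"
    and "c > 0" and Sp: "\<And>\<xi>. c * (norm \<xi>)\<^sup>2 \<le> \<xi> \<bullet> (S *v \<xi>)" and Tp: "\<And>\<xi>. 0 \<le> \<xi> \<bullet> (T *v \<xi>)"
  shows "T = S"
proof -
  define D where "D = S - T"
  have D: "transpose D = D"
    by (rule symmetric_matrixI)
      (simp add: D_def matrix_vector_simps inner_diff_left inner_diff_right
        symmetric_matrix_inner[OF S] symmetric_matrix_inner[OF T])
  have "S ** D + D ** T = 0"
    by (simp add: D_def matrix_mult_simps eq)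
  then have "trace (D ** (S ** D)) + trace (D ** (D ** T)) = 0"
    by (metis matrix_add_ldistrib trace_add times0_right trace_0 mat_0)
  moreover have "trace (D ** (D ** T)) = trace (D ** T ** D)"
    by (simp add: matrix_mul_assoc trace_mul_sym[of "D ** T" D])
  ultimately have "trace (D ** S ** D) + trace (D ** T ** D) = 0"
    by (simp add: matrix_mul_assoc)
  moreover have "0 \<le> trace (D ** T ** D)"
    unfolding trace_congruence[OF D] by (intro sum_nonneg Tp)
  ultimately have le: "trace (D ** S ** D) \<le> 0" by linarith
  \<comment> \<open>Only \<open>S\<close> is coercive, \<open>T\<close> is merely semidefinite as
    \<open>matrix_sqrt\<close> allows; the trace term of \<open>S\<close> alone annihilates every
    column of \<open>D\<close>.\<close>
  have "(\<Sum>i\<in>UNIV. c * (norm (D *v axis i 1))\<^sup>2) \<le> trace (D ** S ** D)"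
    unfolding trace_congruence[OF D] by (intro sum_mono Sp)
  with le have "(\<Sum>i\<in>UNIV. c * (norm (D *v axis i 1))\<^sup>2) = 0"
    using \<open>c > 0\<close> by (smt (verit) sum_nonneg zero_le_mult_iff zero_le_power2)
  then have "\<forall>i. D *v axis i 1 = 0"
    using \<open>c > 0\<close> by (subst (asm) sum_nonneg_eq_0_iff) auto
  then have "D = 0"
    by (simp add: vec_eq_iff matrix_vector_mul_component inner_axis)
  then show ?thesis by (simp add: D_def)
qed

lemma matrix_sqrt_eqI:
  fixes A S :: "real ^ 'n ^ 'n"
  assumes S: "transpose S = S" and A: "S ** S = A"
    and "c > 0" and Sp: "\<And>\<xi>. c * (norm \<xi>)\<^sup>2 \<le> \<xi> \<bullet> (S *v \<xi>)"
  shows "matrix_sqrt A = S"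
  unfolding matrix_sqrt_def
proof (rule the_equality)
  have "0 \<le> \<xi> \<bullet> (S *v \<xi>)" for \<xi>
    using Sp[of \<xi>] \<open>c > 0\<close> by (smt (verit) zero_le_mult_iff zero_le_power2)
  then show "transpose S = S \<and> (\<forall>\<xi>. 0 \<le> \<xi> \<bullet> (S *v \<xi>)) \<and> S ** S = A"
    using S A by blast
next
  fix T assume "transpose T = T \<and> (\<forall>\<xi>. 0 \<le> \<xi> \<bullet> (T *v \<xi>)) \<and> T ** T = A"
  then show "T = S"
    using psd_sqrt_unique[OF S _ _ \<open>c > 0\<close> Sp] A by metis
qed

text \<open>With \<open>\<tau> = \<kappa> / M\<^sup>2\<close> the matrix \<open>1 - \<tau> A\<close> is a contraction, so its iteration gives the square
  root of \<open>\<tau> A\<close>.\<close>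

lemma matrix_sqrt_limit:
  fixes A :: "real ^ 'n ^ 'n"
  assumes sym: "transpose A = A" and M: "norm A \<le> M" and "0 < \<kappa>" "\<kappa> \<le> M"
    and coer: "\<And>\<xi>. \<kappa> * (norm \<xi>)\<^sup>2 \<le> \<xi> \<bullet> (A *v \<xi>)"
  shows "(\<lambda>k. (M / sqrt \<kappa>) *\<^sub>R (mat 1 - sqrt_iter (mat 1 - (\<kappa> / M\<^sup>2) *\<^sub>R A) k)) \<longlonglongrightarrow> matrix_sqrt A"
    and "transpose (matrix_sqrt A) = matrix_sqrt A"
    and "matrix_sqrt A ** matrix_sqrt A = A"
    and "invertible (matrix_sqrt A)"
proof -
  define \<tau> where "\<tau> = \<kappa> / M\<^sup>2"
  define B where "B = mat 1 - \<tau> *\<^sub>R A"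
  \<comment> \<open>|B \<xi>|^2 \<le> (1 - 2 \<tau> \<kappa> + \<tau>^2 M^2) |\<xi>|^2, and \<tau> =
    \<kappa> / M^2 minimises this factor, with minimum \<beta>^2. The scale c undoes \<tau>, since
    c^2 \<tau> = 1.\<close>
  define \<beta> where "\<beta> = sqrt (1 - \<kappa>\<^sup>2 / M\<^sup>2)"
  define c where "c = M / sqrt \<kappa>"
  have "M > 0" using assms by linarith
  have c: "c > 0" "c\<^sup>2 * \<tau> = 1"
    using \<open>M > 0\<close> \<open>\<kappa> > 0\<close> by (auto simp: c_def \<tau>_def power_divide)
  have "\<kappa>\<^sup>2 / M\<^sup>2 \<le> 1"
    using \<open>M > 0\<close> assms by (simp add: power_mono)
  then have \<beta>: "\<beta>\<^sup>2 = 1 - \<kappa>\<^sup>2 / M\<^sup>2" "0 \<le> \<beta>"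
    by (auto simp: \<beta>_def)
  have "\<beta> < 1"
    unfolding \<beta>_def using \<open>M > 0\<close> \<open>\<kappa> > 0\<close> by simp
  have symB: "transpose B = B"
    by (rule symmetric_matrixI)
      (simp add: B_def matrix_vector_simps inner_diff_left inner_diff_right symmetric_matrix_inner[OF sym])
  have Bb: "norm (B *v \<xi>) \<le> \<beta> * norm \<xi>" for \<xi>
  proof -
    have "norm (A *v \<xi>) \<le> M * norm \<xi>"
      using norm_matrix_vector_le_norm[of A \<xi>] mult_right_mono[OF M, of "norm \<xi>"] by simp
    then have A2: "(norm (A *v \<xi>))\<^sup>2 \<le> M\<^sup>2 * (norm \<xi>)\<^sup>2"
      using power_mono[of "norm (A *v \<xi>)" "M * norm \<xi>" 2] by (simp add: power_mult_distrib)
    have "(norm (B *v \<xi>))\<^sup>2 = (norm \<xi>)\<^sup>2 - 2 * \<tau> * (\<xi> \<bullet> (A *v \<xi>)) + \<tau>\<^sup>2 * (norm (A *v \<xi>))\<^sup>2"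
      unfolding B_def
      by (simp add: matrix_vector_simps power2_norm_eq_inner inner_diff_left inner_diff_right inner_commute)
        (simp add: power2_eq_square)
    also have "\<dots> \<le> (norm \<xi>)\<^sup>2 - 2 * \<tau> * (\<kappa> * (norm \<xi>)\<^sup>2) + \<tau>\<^sup>2 * (M\<^sup>2 * (norm \<xi>)\<^sup>2)"
      using coer[of \<xi>] A2 \<open>M > 0\<close> \<open>\<kappa> > 0\<close>
      by (intro add_mono diff_mono mult_left_mono) (auto simp: \<tau>_def)
    also have "\<dots> = (\<beta> * norm \<xi>)\<^sup>2"
      unfolding power_mult_distrib \<beta> \<tau>_def using \<open>M > 0\<close>
      by (simp add: field_simps power2_eq_square)
    finally show ?thesis
      using \<beta> by (simp add: power2_le_iff_abs_le)
  qed
  obtain Y where Y: "sqrt_iter B \<longlonglongrightarrow> Y" "transpose Y = Y" "2 *\<^sub>R Y = B + Y ** Y"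
    "\<And>\<xi>. norm (Y *v \<xi>) \<le> \<beta> * norm \<xi>"
    using sqrt_iter_limit[OF symB Bb \<open>\<beta> < 1\<close>] by blast
  define S where "S = c *\<^sub>R (mat 1 - Y)"
  have symS: "transpose S = S"
    by (rule symmetric_matrixI)
      (simp add: S_def matrix_vector_simps inner_diff_left inner_diff_right symmetric_matrix_inner[OF Y(2)])
  have SS: "S ** S = A"
  proof -
    have "S ** S = c\<^sup>2 *\<^sub>R (mat 1 - 2 *\<^sub>R Y + Y ** Y)"
      by (simp add: S_def matrix_mult_simps power2_eq_square scaleR_2 algebra_simps)
    also have "\<dots> = (c\<^sup>2 * \<tau>) *\<^sub>R A"
      unfolding Y(3) by (simp add: B_def)
    finally show ?thesis by (simp add: c)
  qed
  have Sp: "(c * (1 - \<beta>)) * (norm \<xi>)\<^sup>2 \<le> \<xi> \<bullet> (S *v \<xi>)" for \<xi>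
  proof -
    have "\<xi> \<bullet> (Y *v \<xi>) \<le> norm \<xi> * norm (Y *v \<xi>)"
      by (rule norm_cauchy_schwarz)
    also have "\<dots> \<le> norm \<xi> * (\<beta> * norm \<xi>)"
      by (intro mult_left_mono Y) auto
    finally have "(1 - \<beta>) * (norm \<xi>)\<^sup>2 \<le> \<xi> \<bullet> \<xi> - \<xi> \<bullet> (Y *v \<xi>)"
      by (simp add: power2_norm_eq_inner[symmetric] power2_eq_square algebra_simps)
    then have "c * ((1 - \<beta>) * (norm \<xi>)\<^sup>2) \<le> c * (\<xi> \<bullet> \<xi> - \<xi> \<bullet> (Y *v \<xi>))"
      using c by (intro mult_left_mono) auto
    then show ?thesis
      by (simp add: S_def matrix_vector_simps inner_diff_right mult.assoc)
  qed
  have pos: "c * (1 - \<beta>) > 0" using c \<open>\<beta> < 1\<close> by simp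
  have eq: "matrix_sqrt A = S"
    by (rule matrix_sqrt_eqI[OF symS SS pos Sp])
  show "(\<lambda>k. (M / sqrt \<kappa>) *\<^sub>R (mat 1 - sqrt_iter (mat 1 - (\<kappa> / M\<^sup>2) *\<^sub>R A) k)) \<longlonglongrightarrow> matrix_sqrt A"
    unfolding eq unfolding S_def c_def[symmetric] \<tau>_def[symmetric] B_def[symmetric]
    by (intro tendsto_intros Y)
  show "transpose (matrix_sqrt A) = matrix_sqrt A" "matrix_sqrt A ** matrix_sqrt A = A"
    "invertible (matrix_sqrt A)"
    unfolding eq using symS SS invertible_if_coercive[OF pos Sp] by auto
qed

section \<open>Inverse matrices: algebra, bounds and measurability\<close>

lemma matrix_inv_inverse:
  fixes A :: "real ^ 'n ^ 'n"
  assumes "invertible A"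
  shows "A ** matrix_inv A = mat 1" "matrix_inv A ** A = mat 1"
  using someI_ex[OF assms[unfolded invertible_def]] by (auto simp: matrix_inv_def)

lemma matrix_inv_eqI:
  fixes A :: "real ^ 'n ^ 'n"
  assumes "A ** B = mat 1" "B ** A = mat 1"
  shows "matrix_inv A = B"
  by (metis assms invertible_def matrix_inv_inverse(1) matrix_mul_assoc matrix_mul_lid matrix_mul_rid)

lemma symmetric_matrix_inv:
  fixes A :: "real ^ 'n ^ 'n"
  assumes "invertible A" "transpose A = A"
  shows "transpose (matrix_inv A) = matrix_inv A"
  by (metis assms matrix_inv_eqI matrix_inv_inverse matrix_transpose_mul transpose_mat)

lemma matrix_inv_square:
  fixes S :: "real ^ 'n ^ 'n"
  assumes "invertible S"
  shows "matrix_inv (S ** S) = matrix_inv S ** matrix_inv S"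
  by (rule matrix_inv_eqI) (metis assms matrix_inv_inverse matrix_mul_assoc matrix_mul_lid)+

lemma norm_matrix_inv_vector_le:
  fixes A :: "real ^ 'n ^ 'n"
  assumes "0 < \<kappa>" and "\<And>\<xi>. \<kappa> * (norm \<xi>)\<^sup>2 \<le> \<xi> \<bullet> (A *v \<xi>)"
  shows "norm (matrix_inv A *v x) \<le> norm x / \<kappa>"
proof -
  let ?y = "matrix_inv A *v x"
  have "A *v ?y = x"
    by (simp add: matrix_vector_mul_assoc matrix_inv_inverse invertible_if_coercive[OF assms])
  then have "\<kappa> * (norm ?y)\<^sup>2 \<le> ?y \<bullet> x" using assms(2)[of ?y] by simp
  also have "\<dots> \<le> norm ?y * norm x" by (rule norm_cauchy_schwarz)
  finally have "norm ?y * (\<kappa> * norm ?y) \<le> norm ?y * norm x" by (simp add: power2_eq_square mult_ac)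
  then have "\<kappa> * norm ?y \<le> norm x"
    by (cases "norm ?y = 0") (use mult_le_cancel_left_pos[of "norm ?y"] in auto)
  then show ?thesis using assms(1) by (simp add: field_simps)
qed

text \<open>On invertible matrices Cramer's rule exhibits the entries as quotients of determinants;
  on singular ones the inverse is a single constant. Both pieces are Borel, and so is the set det =
  0.\<close>

lemma borel_measurable_matrix_inv:
  "(matrix_inv :: real ^ 'n ^ 'n \<Rightarrow> real ^ 'n ^ 'n) \<in> borel_measurable borel"
proof -
  define J where "J = matrix_inv (0 :: real ^ 'n ^ 'n)"
  define R where "R = (\<lambda>A :: real ^ 'n ^ 'n. (\<chi> k l.
     if det A = 0 then J $ k $ l
     else det (\<chi> i j. if j = k then axis l 1 $ i else A $ i $ j) / det A) :: real ^ 'n ^ 'n)"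
  have "matrix_inv A = R A" for A :: "real ^ 'n ^ 'n"
  proof (cases "det A = 0")
    case True
    \<comment> \<open>For a singular matrix the predicate under \<open>SOME\<close> is identically
      false, so all of them share the arbitrary value \<open>J\<close>.\<close>
    have "matrix_inv A' = (SOME B :: real ^ 'n ^ 'n. False)" if "\<not> invertible A'" for A' :: "real ^ 'n ^ 'n"
      using that unfolding matrix_inv_def invertible_def by (intro arg_cong[where f=Eps] ext) auto
    moreover have "\<not> invertible A" "\<not> invertible (0 :: real ^ 'n ^ 'n)"
      using True by (auto simp: invertible_det_nz det_0[unfolded mat_0])
    ultimately show ?thesis using True by (simp add: R_def J_def vec_eq_iff)
  next
    case False
    have "A *v (matrix_inv A *v axis l 1) = axis l 1" for l
      using False by (simp add: matrix_vector_mul_assoc matrix_inv_inverse invertible_det_nz)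
    then have inv: "matrix_inv A *v axis l 1
        = (\<chi> k. det (\<chi> i j. if j = k then axis l 1 $ i else A $ i $ j) / det A)" for l
      using cramer[OF False] by blast
    have "matrix_inv A $ k $ l = det (\<chi> i j. if j = k then axis l 1 $ i else A $ i $ j) / det A" for k l
    proof -
      have "matrix_inv A $ k $ l = (matrix_inv A *v axis l 1) $ k"
        by (simp add: matrix_vector_mul_component inner_axis)
      also have "\<dots> = det (\<chi> i j. if j = k then axis l 1 $ i else A $ i $ j) / det A"
        unfolding inv by simp
      finally show ?thesis .
    qed
    then show ?thesis using False by (simp add: R_def vec_eq_iff)
  qed
  moreover have "R \<in> borel_measurable borel"
  proof -
    have 1: "(\<lambda>A. A $ i $ j) \<in> borel_measurable borel" for i j :: 'n
      by (intro borel_measurable_continuous_onI continuous_intros)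
    have vec: "(\<lambda>A. \<chi> k. f A k) \<in> borel_measurable borel" if "\<And>k. (\<lambda>A. f A k) \<in> borel_measurable borel"
      for f :: "real ^ 'n ^ 'n \<Rightarrow> 'n \<Rightarrow> 'b::euclidean_space"
    proof -
      have "(\<lambda>A. \<chi> k. f A k) = (\<lambda>A. \<Sum>k\<in>UNIV. axis k (f A k))"
        by (auto simp: vec_eq_iff axis_def sum.delta cong: if_cong)
      moreover have "(\<lambda>A. axis k (f A k)) \<in> borel_measurable borel" for k
        by (intro borel_measurable_continuous_on[of "axis k"] that linear_continuous_on)
          (auto simp: linear_conv_bounded_linear[symmetric] vec_eq_iff axis_def intro!: linearI)
      ultimately show ?thesis by simp
    qed
    have det: "(\<lambda>A. det (\<chi> i j. f A i j)) \<in> borel_measurable borel"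
      if "\<And>i j. (\<lambda>A. f A i j) \<in> borel_measurable borel" for f :: "real ^ 'n ^ 'n \<Rightarrow> 'n \<Rightarrow> 'n \<Rightarrow> real"
      unfolding det_def
      by (simp only: vec_lambda_beta)
        (intro borel_measurable_sum borel_measurable_times borel_measurable_prod borel_measurable_const that)
    have [measurable]: "det \<in> borel_measurable (borel :: (real ^ 'n ^ 'n) measure)"
      unfolding det_def
      by (intro borel_measurable_sum borel_measurable_times borel_measurable_prod borel_measurable_const 1)
    have [measurable]: "(\<lambda>A :: real ^ 'n ^ 'n. det (\<chi> i j. if j = k then axis l 1 $ i else A $ i $ j)) \<in> borel_measurable borel"
      for k l
    proof (rule det)
      show "(\<lambda>A :: real ^ 'n ^ 'n. if j = k then axis l 1 $ i else A $ i $ j) \<in> borel_measurable borel" for i j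
        using 1 by (cases "j = k") auto
    qed
    show ?thesis
      unfolding R_def by (intro vec) measurable
  qed
  ultimately show ?thesis by presburger
qed

text \<open>Facts at a single point x, with A = K x, for use under an almost everywhere quantifier.
  The bounds are those expected from a spectrum in [\<kappa>, m], obtained from quadratic forms; the
  identity A^(1/2) A^(-1) = A^(-1/2) is the one behind the inf-sup estimate.\<close>

lemma matrix_sqrt_properties:
  fixes A :: "real ^ 'n ^ 'n"
  assumes sym: "transpose A = A" and m: "norm A \<le> m" and \<kappa>: "0 < \<kappa>" "\<kappa> \<le> m"
    and coer: "\<And>\<xi>. \<kappa> * (norm \<xi>)\<^sup>2 \<le> \<xi> \<bullet> (A *v \<xi>)"
  shows "norm (matrix_sqrt A *v \<xi>) \<le> sqrt m * norm \<xi>"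
    and "(matrix_inv A *v \<xi>) \<bullet> \<eta> = (matrix_inv (matrix_sqrt A) *v \<xi>) \<bullet> (matrix_inv (matrix_sqrt A) *v \<eta>)"
    and "norm (matrix_inv (matrix_sqrt A) *v \<xi>) \<le> (1 / sqrt \<kappa>) * norm \<xi>"
    and "norm \<xi> \<le> sqrt m * norm (matrix_inv (matrix_sqrt A) *v \<xi>)"
    and "matrix_sqrt A *v (matrix_inv A *v \<xi>) = matrix_inv (matrix_sqrt A) *v \<xi>"
    and "norm (matrix_inv A *v \<xi>) \<le> (1 / \<kappa>) * norm \<xi>"
proof -
  define S where "S = matrix_sqrt A"
  note S = matrix_sqrt_limit(2-4)[OF sym m \<kappa> coer, folded S_def]
  have inv: "matrix_inv A = matrix_inv S ** matrix_inv S"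
    using matrix_inv_square[OF S(3)] S(2) by simp
  show a: "norm (matrix_sqrt A *v \<xi>) \<le> sqrt m * norm \<xi>" for \<xi>
  proof (rule power2_le_imp_le)
    have "(norm (S *v \<xi>))\<^sup>2 = \<xi> \<bullet> (A *v \<xi>)"
      by (simp add: power2_norm_eq_inner symmetric_matrix_inner[OF S(1)] matrix_vector_mul_assoc S(2))
    also have "\<dots> \<le> norm \<xi> * norm (A *v \<xi>)"
      by (rule norm_cauchy_schwarz)
    also have "\<dots> \<le> norm \<xi> * (m * norm \<xi>)"
      using norm_matrix_vector_le_norm[of A \<xi>] mult_right_mono[OF m, of "norm \<xi>"]
      by (intro mult_left_mono) auto
    also have "\<dots> = (sqrt m * norm \<xi>)\<^sup>2"
      using \<kappa> by (simp add: power_mult_distrib power2_eq_square)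
    finally show "(norm (matrix_sqrt A *v \<xi>))\<^sup>2 \<le> (sqrt m * norm \<xi>)\<^sup>2"
      by (simp add: S_def)
  qed (use \<kappa> in simp)
  show b: "(matrix_inv A *v \<xi>) \<bullet> \<eta> = (matrix_inv (matrix_sqrt A) *v \<xi>) \<bullet> (matrix_inv (matrix_sqrt A) *v \<eta>)" for \<xi> \<eta>
    unfolding inv S_def[symmetric]
    by (simp add: symmetric_matrix_inner[OF symmetric_matrix_inv[OF S(3,1)]] flip: matrix_vector_mul_assoc)
  show d: "norm (matrix_inv A *v \<xi>) \<le> (1 / \<kappa>) * norm \<xi>" for \<xi>
    using norm_matrix_inv_vector_le[OF \<kappa>(1) coer] by simp
  show "norm (matrix_inv (matrix_sqrt A) *v \<xi>) \<le> (1 / sqrt \<kappa>) * norm \<xi>"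
  proof (rule power2_le_imp_le)
    have "(norm (matrix_inv (matrix_sqrt A) *v \<xi>))\<^sup>2 = (matrix_inv A *v \<xi>) \<bullet> \<xi>"
      by (simp add: b power2_norm_eq_inner)
    also have "\<dots> \<le> norm (matrix_inv A *v \<xi>) * norm \<xi>"
      by (rule norm_cauchy_schwarz)
    also have "\<dots> \<le> ((1 / \<kappa>) * norm \<xi>) * norm \<xi>"
      by (intro mult_right_mono d) simp
    also have "\<dots> = ((1 / sqrt \<kappa>) * norm \<xi>)\<^sup>2"
      using \<kappa> by (simp add: power_mult_distrib power_divide power2_eq_square)
    finally show "(norm (matrix_inv (matrix_sqrt A) *v \<xi>))\<^sup>2 \<le> ((1 / sqrt \<kappa>) * norm \<xi>)\<^sup>2" .
  qed (use \<kappa> in simp)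
  show "norm \<xi> \<le> sqrt m * norm (matrix_inv (matrix_sqrt A) *v \<xi>)"
    using a[of "matrix_inv S *v \<xi>"] by (simp add: S_def[symmetric] matrix_vector_mul_assoc matrix_inv_inverse S)
  show "matrix_sqrt A *v (matrix_inv A *v \<xi>) = matrix_inv (matrix_sqrt A) *v \<xi>"
    unfolding inv S_def[symmetric]
    by (simp add: matrix_vector_mul_assoc matrix_mul_assoc matrix_inv_inverse S)
qed

section \<open>Test functions\<close>

lemma has_derivative_grad:
  fixes \<phi> :: "real ^ 'n \<Rightarrow> real"
  assumes "\<phi> differentiable at x"
  shows "(\<phi> has_derivative (\<lambda>h. grad \<phi> x \<bullet> h)) (at x)"
proof -
  let ?D = "frechet_derivative \<phi> (at x)"
  have D: "(\<phi> has_derivative ?D) (at x)"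
    using assms frechet_derivative_works by blast
  then have "linear ?D" by (rule has_derivative_linear)
  have "?D h = grad \<phi> x \<bullet> h" for h
  proof -
    have "?D h = ?D (\<Sum>i\<in>UNIV. h $ i *\<^sub>R axis i 1)"
      using basis_expansion[of h] by (simp add: scalar_mult_eq_scaleR)
    also have "\<dots> = grad \<phi> x \<bullet> h"
      by (simp add: linear_sum[OF \<open>linear ?D\<close>] linear_scale[OF \<open>linear ?D\<close>] inner_vec_def grad_def mult.commute)
    finally show ?thesis .
  qed
  then have "?D = (\<lambda>h. grad \<phi> x \<bullet> h)" by (rule ext)
  with D show ?thesis by metis
qed

lemma grad_eqI:
  fixes \<phi> :: "real ^ 'n \<Rightarrow> real"
  assumes "(\<phi> has_derivative (\<lambda>h. g \<bullet> h)) (at x)"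
  shows "grad \<phi> x = g"
  by (simp add: grad_def frechet_derivative_at[OF assms, symmetric] inner_axis vec_eq_iff)

lemma grad_const: "grad (\<lambda>x. c) = (\<lambda>x. 0)"
  by (intro ext grad_eqI) (auto intro!: derivative_eq_intros)

lemma has_derivative_coordinate: "((\<lambda>x :: real ^ 'n. x $ i) has_derivative (\<lambda>h. h $ i)) F"
  by (rule bounded_linear_imp_has_derivative[OF bounded_linear_vec_nth])

lemma grad_coordinate: "grad (\<lambda>x. x $ i) x = axis i 1"
  by (intro grad_eqI) (simp add: inner_axis' has_derivative_coordinate)

lemma grad_add:
  assumes "\<phi> differentiable at x" "\<psi> differentiable at x"
  shows "grad (\<lambda>x. \<phi> x + \<psi> x) x = grad \<phi> x + grad \<psi> x"
  by (intro grad_eqI) (auto intro!: derivative_eq_intros has_derivative_grad assms simp: inner_add_left)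

lemma grad_mult:
  assumes "\<phi> differentiable at x" "\<psi> differentiable at x"
  shows "grad (\<lambda>x. \<phi> x * \<psi> x) x = \<phi> x *\<^sub>R grad \<psi> x + \<psi> x *\<^sub>R grad \<phi> x"
  by (intro grad_eqI) (auto intro!: derivative_eq_intros has_derivative_grad assms simp: inner_add_left)

lemma C_k_Suc_imp: "C_k (Suc k) \<phi> \<Longrightarrow> C_k k \<phi>"
proof (induction k arbitrary: \<phi>)
  case 0
  then show ?case
    by (auto simp: continuous_on_eq_continuous_at differentiable_imp_continuous_within)
next
  case (Suc k)
  then show ?case by (metis C_k.simps(2))
qed

lemma C_k_const: "C_k k (\<lambda>x. c)"
  by (induction k arbitrary: c) (auto simp: grad_const)

lemma C_k_coordinate: "C_k k (\<lambda>x. x $ i)"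
  by (cases k)
    (auto simp: grad_coordinate C_k_const continuous_intros differentiable_def
      intro!: exI[of _ "\<lambda>x. x $ i"] has_derivative_coordinate)

lemma C_k_add: "C_k k \<phi> \<Longrightarrow> C_k k \<psi> \<Longrightarrow> C_k k (\<lambda>x. \<phi> x + \<psi> x)"
  by (induction k arbitrary: \<phi> \<psi>) (auto simp: grad_add intro!: continuous_intros)

lemma C_k_mult: "C_k k \<phi> \<Longrightarrow> C_k k \<psi> \<Longrightarrow> C_k k (\<lambda>x. \<phi> x * \<psi> x)"
proof (induction k arbitrary: \<phi> \<psi>)
  case (Suc k)
  then have "C_k k \<phi>" "C_k k \<psi>" by (auto intro: C_k_Suc_imp)
  with Suc show ?case by (auto simp: grad_mult intro!: C_k_add)
qed (auto intro!: continuous_intros)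

lemma C_k_prod: "(\<And>i. i \<in> I \<Longrightarrow> C_k k (\<phi> i)) \<Longrightarrow> C_k k (\<lambda>x. \<Prod>i\<in>I. \<phi> i x)"
  by (induction I rule: infinite_finite_induct) (auto intro!: C_k_const C_k_mult)

text \<open>The functions \<open>p(1/t) exp(-1/t)\<close>, extended by zero to \<open>t \<le> 0\<close>, are closed under
  differentiation.\<close>

definition flat :: "real poly \<Rightarrow> real \<Rightarrow> real" where
  "flat p t = (if t > 0 then poly p (1 / t) * exp (- (1 / t)) else 0)"

lemma tendsto_poly_div_exp: "((\<lambda>y. poly p y * exp (- y)) \<longlongrightarrow> (0 :: real)) at_top"
proof -
  have "((\<lambda>y. \<Sum>i\<le>degree p. coeff p i * (y ^ i / exp y)) \<longlongrightarrow> (\<Sum>i\<le>degree p. coeff p i * 0)) at_top"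
    by (intro tendsto_intros tendsto_power_div_exp_0)
  then show ?thesis
    by (simp add: poly_altdef exp_minus sum_distrib_right sum_divide_distrib field_simps)
qed

lemma tendsto_flat_0: "(flat p \<longlongrightarrow> 0) (at 0)"
proof -
  have "((\<lambda>t. poly p (1 / t) * exp (- (1 / t))) \<longlongrightarrow> 0) (at_right (0 :: real))"
    by (rule filterlim_compose[OF tendsto_poly_div_exp])
      (use filterlim_inverse_at_top_right in \<open>simp add: inverse_eq_divide\<close>)
  then have "(flat p \<longlongrightarrow> 0) (at_right 0)"
    by (rule Lim_transform_eventually) (auto simp: flat_def eventually_at_right_less intro: eventually_mono[OF eventually_at_right_less])
  moreover have "(flat p \<longlongrightarrow> 0) (at_left 0)"
    by (rule Lim_transform_eventually[OF tendsto_const])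
      (auto simp: flat_def eventually_at_filter)
  ultimately show ?thesis by (simp add: filterlim_split_at)
qed

text \<open>With s = 1/t one has d/dt = - s^2 d/ds, and (p e^(-s))' = (p' - p) e^(-s); hence the
  polynomial s^2 (p - p'). At the origin the difference quotient is itself \<open>flat\<close> with
  polynomial s p, which tends to zero.\<close>

lemma has_real_derivative_flat:
  "(flat p has_real_derivative flat ([:0, 0, 1:] * (p - pderiv p)) t) (at t)"
proof -
  consider "t > 0" | "t < 0" | "t = 0" by linarith
  then show ?thesis
  proof cases
    case 1
    have "((\<lambda>t. poly p (1 / t) * exp (- (1 / t))) has_real_derivative
        flat ([:0, 0, 1:] * (p - pderiv p)) t) (at t)"
      using 1
      by (auto intro!: derivative_eq_intros DERIV_chain'[OF _ poly_DERIV]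
          simp: flat_def field_simps power2_eq_square)
    then show ?thesis
      by (rule has_field_derivative_transform_within_open[where S = "{0<..}"]) (use 1 in \<open>auto simp: flat_def\<close>)
  next
    case 2
    have "((\<lambda>t. 0) has_real_derivative flat ([:0, 0, 1:] * (p - pderiv p)) t) (at t)"
      using 2 by (simp add: flat_def)
    then show ?thesis
      by (rule has_field_derivative_transform_within_open[where S = "{..<0}"]) (use 2 in \<open>auto simp: flat_def\<close>)
  next
    case 3
    have "flat (pCons 0 p) = (\<lambda>t. (flat p t - flat p 0) / (t - 0))"
      by (simp add: flat_def fun_eq_iff)
    then have "((\<lambda>t. (flat p t - flat p 0) / (t - 0)) \<longlongrightarrow> 0) (at 0)"
      using tendsto_flat_0[of "pCons 0 p"] by metis
    then show ?thesis
      using 3 by (simp add: has_field_derivative_iff flat_def)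
  qed
qed

text \<open>The induction must vary \<open>p\<close>, as differentiation stays in the family only up
  to a change of polynomial.\<close>

lemma C_k_flat: "C_k k (\<lambda>x. flat p (c * x $ i + d))"
proof (induction k arbitrary: p)
  case 0
  have "continuous_on UNIV (flat p)"
    using has_real_derivative_flat by (auto intro: DERIV_continuous_on DERIV_subset)
  then have "continuous_on UNIV (\<lambda>x. flat p (c * x $ i + d))"
    by (rule continuous_on_compose2) (auto intro!: continuous_intros)
  then show ?case by simp
next
  case (Suc k)
  let ?q = "[:0, 0, 1:] * (p - pderiv p)"
  have D: "((\<lambda>x. flat p (c * x $ i + d)) has_derivative
      (\<lambda>h. ((c * flat ?q (c * x $ i + d)) *\<^sub>R axis i 1) \<bullet> h)) (at x)" for x
  proof -
    have "((\<lambda>x. flat p (c * x $ i + d)) has_derivative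
      (\<lambda>h. flat ?q (c * x $ i + d) * (c * h $ i))) (at x)"
      by (rule has_derivative_compose[OF _ has_real_derivative_flat[unfolded has_field_derivative_def]])
        (auto intro!: derivative_eq_intros has_derivative_coordinate)
    then show ?thesis by (simp add: inner_axis' mult_ac)
  qed
  have "C_k k (\<lambda>x. (if j = i then c else 0) * flat ?q (c * x $ i + d))" for j
    by (intro C_k_mult C_k_const Suc)
  moreover have "grad (\<lambda>x. flat p (c * x $ i + d)) x $ j = (if j = i then c else 0) * flat ?q (c * x $ i + d)"
    for x j
    by (simp add: grad_eqI[OF D] axis_def)
  moreover have "(\<lambda>x. flat p (c * x $ i + d)) differentiable at x" for x
    using D unfolding differentiable_def by blast
  ultimately show ?case
    by simp
qed

text \<open>Product over the coordinates of exp(-1/s) cut-offs at both faces. Scaling the distances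
  by m + 1 pushes the values towards one inside the box while the support stays the same;
  \<open>Suc m\<close> keeps the scale positive.\<close>

definition bump :: "real ^ 'n \<Rightarrow> real ^ 'n \<Rightarrow> nat \<Rightarrow> real ^ 'n \<Rightarrow> real" where
  "bump a b m x = (\<Prod>i\<in>UNIV. flat 1 (real (Suc m) * x $ i - real (Suc m) * a $ i)
                         * flat 1 (real (Suc m) * b $ i - real (Suc m) * x $ i))"

lemma flat_1: "flat 1 t = (if t > 0 then exp (- (1 / t)) else 0)"
  by (simp add: flat_def)

lemma C_k_bump: "C_k k (bump a b m)"
proof -
  have "C_k k (\<lambda>x. flat 1 (real (Suc m) * x $ i + - (real (Suc m) * a $ i))
                 * flat 1 (- real (Suc m) * x $ i + real (Suc m) * b $ i))" for i
    by (intro C_k_mult C_k_flat)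
  then have "C_k k (\<lambda>x. \<Prod>i\<in>UNIV. flat 1 (real (Suc m) * x $ i + - (real (Suc m) * a $ i))
                 * flat 1 (- real (Suc m) * x $ i + real (Suc m) * b $ i))"
    by (intro C_k_prod)
  then show ?thesis
    unfolding bump_def[abs_def] by (simp add: algebra_simps)
qed

lemma bump_nonzero_iff: "bump a b m x \<noteq> 0 \<longleftrightarrow> x \<in> box a b"
proof -
  have "0 < real (Suc m) * s - real (Suc m) * t \<longleftrightarrow> t < s" for s t
    by (simp add: zero_less_mult_iff flip: right_diff_distrib)
  then show ?thesis
    by (auto simp: bump_def flat_1 mem_box_cart simp del: of_nat_Suc split: if_splits)
qed

lemma bump_bounds: "0 \<le> bump a b m x" "bump a b m x \<le> 1"
  unfolding bump_def by (auto intro!: prod_nonneg prod_le_1 mult_le_one simp: flat_1 simp del: of_nat_Suc)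

lemma bump_tendsto: "(\<lambda>m. bump a b m x) \<longlonglongrightarrow> indicator (box a b) x"
proof (cases "x \<in> box a b")
  case True
  have 1: "(\<lambda>m. flat 1 (real (Suc m) * s - real (Suc m) * t)) \<longlonglongrightarrow> 1" if "t < s" for s t
  proof -
    have "(\<lambda>m. exp (- (1 / (s - t)) * inverse (real (Suc m)))) \<longlonglongrightarrow> exp (- (1 / (s - t)) * 0)"
      by (intro tendsto_intros LIMSEQ_inverse_real_of_nat)
    moreover have "exp (- (1 / (s - t)) * inverse (real (Suc m))) = flat 1 (real (Suc m) * s - real (Suc m) * t)" for m
      using that by (simp add: flat_1 field_simps flip: right_diff_distrib del: of_nat_Suc)
    ultimately show ?thesis by simp
  qed
  have "(\<lambda>m. bump a b m x) \<longlonglongrightarrow> (\<Prod>i\<in>(UNIV :: 'a set). 1 * 1)"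
    unfolding bump_def using True by (intro tendsto_intros 1) (auto simp: mem_box_cart)
  then show ?thesis using True by simp
next
  case False
  then have "bump a b m x = 0" for m
    using bump_nonzero_iff by blast
  then show ?thesis using False by simp
qed

lemma bump_test_function:
  assumes "cbox a b \<subseteq> \<Omega>"
  shows "bump a b m \<in> test_functions \<Omega>"
proof -
  have "closure {x. bump a b m x \<noteq> 0} \<subseteq> cbox a b"
    by (auto simp: bump_nonzero_iff intro: closure_minimal box_subset_cbox[THEN subsetD] closed_cbox
        dest: closure_mono[THEN subsetD, OF box_subset_cbox])
  then show ?thesis
    using assms by (auto simp: test_functions_def C_k_bump compact_eq_bounded_closed intro: bounded_subset[OF bounded_cbox])
qed

lemma continuous_on_grad:
  assumes "C_k (Suc 0) \<phi>"
  shows "continuous_on UNIV (grad \<phi>)"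
proof -
  have "continuous_on UNIV (\<lambda>x. \<chi> i. grad \<phi> x $ i)"
    using assms by (intro continuous_on_vec_lambda) auto
  then show ?thesis by simp
qed

lemma grad_eq_0_outside:
  assumes "x \<notin> closure {x. \<phi> x \<noteq> 0}"
  shows "grad \<phi> x = 0"
proof (rule grad_eqI)
  have "((\<lambda>x. 0) has_derivative (\<lambda>h. 0 \<bullet> h)) (at x)" by simp
  then show "(\<phi> has_derivative (\<lambda>h. 0 \<bullet> h)) (at x)"
    by (rule has_derivative_transform_within_open[where s = "- closure {x. \<phi> x \<noteq> 0}"])
      (use assms closure_subset[of "{x. \<phi> x \<noteq> 0}"] in auto)
qed

lemma lborel_translation:
  fixes f :: "'a::euclidean_space \<Rightarrow> real"
  assumes "integrable lborel f"
  shows "integrable lborel (\<lambda>x. f (x + c))" "integral\<^sup>L lborel (\<lambda>x. f (x + c)) = integral\<^sup>L lborel f"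
proof -
  have [measurable]: "f \<in> borel_measurable borel" using assms by auto
  show "integrable lborel (\<lambda>x. f (x + c))"
    using assms integrable_distr_eq[of "(+) c" lborel borel f]
    by (simp add: lborel_distr_plus add.commute)
  show "integral\<^sup>L lborel (\<lambda>x. f (x + c)) = integral\<^sup>L lborel f"
    using integral_distr[of "(+) c" lborel borel f] by (simp add: lborel_distr_plus add.commute)
qed

text \<open>By translation invariance the difference quotients have integral zero.\<close>

lemma integral_grad_eq_0:
  fixes \<phi> :: "real ^ 'n \<Rightarrow> real"
  assumes \<phi>: "C_k (Suc 0) \<phi>" and bdd: "bounded {x. \<phi> x \<noteq> 0}"
  shows "(LINT x|lborel. grad \<phi> x $ i) = 0"
proof -
  let ?e = "axis i 1 :: real ^ 'n"
  define t where "t m = inverse (real (Suc m))" for m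
  have t: "0 < t m" "t m \<le> 1" for m
    by (auto simp: t_def field_simps)
  obtain R where R: "\<And>x. \<phi> x \<noteq> 0 \<Longrightarrow> norm x \<le> R"
    using bdd by (auto simp: bounded_iff)
  have cl: "closure {x. \<phi> x \<noteq> 0} \<subseteq> cball 0 R"
    by (rule closure_minimal) (auto dest: R)
  have cont: "continuous_on UNIV \<phi>"
    using C_k_Suc_imp[OF \<phi>] by simp
  have contg: "continuous_on UNIV (\<lambda>x. grad \<phi> x $ i)"
    using \<phi> by simp
  have "bounded ((\<lambda>x. grad \<phi> x $ i) ` cball 0 R)"
    by (intro compact_imp_bounded compact_continuous_image continuous_on_subset[OF contg]) auto
  then obtain B where B: "\<And>x. x \<in> cball 0 R \<Longrightarrow> \<bar>grad \<phi> x $ i\<bar> \<le> B" and "B > 0"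
    unfolding bounded_pos by (metis imageI real_norm_def)
  have Bd: "\<bar>grad \<phi> x $ i\<bar> \<le> B" for x
    using B[of x] grad_eq_0_outside[of x \<phi>] cl \<open>B > 0\<close> by (cases "x \<in> closure {x. \<phi> x \<noteq> 0}") auto
  have der: "((\<lambda>s. \<phi> (x + s *\<^sub>R ?e)) has_real_derivative grad \<phi> (x + s *\<^sub>R ?e) $ i) (at s)" for x s
  proof -
    have "((\<lambda>s. \<phi> (x + s *\<^sub>R ?e)) has_derivative (\<lambda>h. grad \<phi> (x + s *\<^sub>R ?e) \<bullet> (h *\<^sub>R ?e))) (at s)"
      using \<phi> by (intro has_derivative_compose[OF _ has_derivative_grad]) (auto intro!: derivative_eq_intros)
    then show ?thesis
      by (simp add: has_field_derivative_def inner_axis mult_commute_abs)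
  qed
  have int: "integrable lborel \<phi>"
  proof -
    have "integrable lborel (\<lambda>x. indicator (cball 0 R) x *\<^sub>R \<phi> x)"
      by (intro borel_integrable_compact continuous_on_subset[OF cont]) auto
    moreover have "(\<lambda>x. indicator (cball 0 R) x *\<^sub>R \<phi> x) = \<phi>"
      using R by (fastforce simp: indicator_def)
    ultimately show ?thesis by metis
  qed
  have lim: "(\<lambda>m. LINT x|lborel. (\<phi> (x + t m *\<^sub>R ?e) - \<phi> x) / t m) \<longlonglongrightarrow> (LINT x|lborel. grad \<phi> x $ i)"
  \<comment> \<open>The mean value theorem bounds the quotient by \<open>B\<close>. Since t m \<le>
    1, it vanishes beyond radius R + 1, where x and its translate both lie outside the
    support.\<close>
  proof (rule integral_dominated_convergence[where w = "\<lambda>x. B * indicator (cball 0 (R + 1)) x"])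
    show "(\<lambda>x. grad \<phi> x $ i) \<in> borel_measurable lborel"
      using contg by (simp add: borel_measurable_continuous_onI)
    show "(\<lambda>x. (\<phi> (x + t m *\<^sub>R ?e) - \<phi> x) / t m) \<in> borel_measurable lborel" for m
      using lborel_translation(1)[OF int, of "t m *\<^sub>R ?e"] int by auto
    show "integrable lborel (\<lambda>x. B * indicator (cball 0 (R + 1)) x :: real)"
      by (intro integrable_mult_right integrable_real_indicator) (use emeasure_bounded_finite[OF bounded_cball, of 0 "R + 1"] in auto)
    show "AE x in lborel. (\<lambda>m. (\<phi> (x + t m *\<^sub>R ?e) - \<phi> x) / t m) \<longlonglongrightarrow> grad \<phi> x $ i"
    proof (intro AE_I2)
      fix x
      have "((\<lambda>s. (\<phi> (x + s *\<^sub>R ?e) - \<phi> x) / s) \<longlongrightarrow> grad \<phi> x $ i) (at 0)"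
        using der[of x 0] by (simp add: has_field_derivative_iff)
      moreover have "filterlim t (at 0) sequentially"
        using LIMSEQ_inverse_real_of_nat t by (auto simp: filterlim_at t_def[abs_def] simp del: of_nat_Suc intro!: always_eventually)
      ultimately show "(\<lambda>m. (\<phi> (x + t m *\<^sub>R ?e) - \<phi> x) / t m) \<longlonglongrightarrow> grad \<phi> x $ i"
        by (rule filterlim_compose)
    qed
    show "AE x in lborel. norm ((\<phi> (x + t m *\<^sub>R ?e) - \<phi> x) / t m) \<le> B * indicator (cball 0 (R + 1)) x" for m
    proof (intro AE_I2)
      fix x
      show "norm ((\<phi> (x + t m *\<^sub>R ?e) - \<phi> x) / t m) \<le> B * indicator (cball 0 (R + 1)) x"
      proof (cases "norm x \<le> R + 1")
        case True
        have "\<exists>z>0. z < t m \<and> \<phi> (x + t m *\<^sub>R ?e) - \<phi> (x + 0 *\<^sub>R ?e) = (t m - 0) * (grad \<phi> (x + z *\<^sub>R ?e) $ i)"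
          by (rule MVT2[OF t(1)]) (rule der)
        then obtain z where "\<phi> (x + t m *\<^sub>R ?e) - \<phi> x = t m * (grad \<phi> (x + z *\<^sub>R ?e) $ i)"
          by auto
        then show ?thesis using Bd[of "x + z *\<^sub>R ?e"] t(1)[of m] True by (simp add: abs_mult)
      next
        case False
        have "norm x \<le> norm (x + t m *\<^sub>R ?e) + norm (t m *\<^sub>R ?e)"
          using norm_triangle_sub[of x "x + t m *\<^sub>R ?e"] by (simp add: norm_minus_commute)
        then have "R < norm (x + t m *\<^sub>R ?e)"
          using False t[of m] by (simp add: norm_axis_1)
        then have "\<phi> (x + t m *\<^sub>R ?e) = 0" "\<phi> x = 0"
          using R[of "x + t m *\<^sub>R ?e"] R[of x] False by (auto simp: not_less)
        then show ?thesis using \<open>B > 0\<close> by simp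
      qed
    qed
  qed
  have "(LINT x|lborel. (\<phi> (x + t m *\<^sub>R ?e) - \<phi> x) / t m) = 0" for m
    using lborel_translation[OF int, of "t m *\<^sub>R ?e"] int by simp
  then show ?thesis
    using lim by (simp only: LIMSEQ_const_iff)
qed

section \<open>Riesz representation and completeness of \<open>L\<^sup>2\<close>\<close>

text \<open>\<open>comb x c y\<close> plays the role of x + c y on a carrier that is only a set of
  functions. Definiteness of \<open>B\<close> is absent by design, because functions equal almost
  everywhere remain distinct.\<close>

locale semi_inner =
  fixes Z :: "'z set" and comb :: "'z \<Rightarrow> real \<Rightarrow> 'z \<Rightarrow> 'z" and B :: "'z \<Rightarrow> 'z \<Rightarrow> real"
  assumes comb: "\<lbrakk>x \<in> Z; y \<in> Z\<rbrakk> \<Longrightarrow> comb x c y \<in> Z"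
    and B_comb: "\<lbrakk>x \<in> Z; y \<in> Z; z \<in> Z\<rbrakk> \<Longrightarrow> B (comb x c y) z = B x z + c * B y z"
    and sym: "\<lbrakk>x \<in> Z; y \<in> Z\<rbrakk> \<Longrightarrow> B x y = B y x"
    and nonneg: "x \<in> Z \<Longrightarrow> 0 \<le> B x x"
begin

lemma B_comb_right: "\<lbrakk>x \<in> Z; y \<in> Z; z \<in> Z\<rbrakk> \<Longrightarrow> B z (comb x c y) = B z x + c * B z y"
  using B_comb[of x y z c] by (simp add: sym comb)

lemma B_comb_comb:
  assumes "x \<in> Z" "y \<in> Z"
  shows "B (comb x c y) (comb x c y) = B x x + 2 * c * B x y + c\<^sup>2 * B y y"
  using assms by (simp add: B_comb B_comb_right comb sym[of y x] power2_eq_square algebra_simps)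

lemma Cauchy_Schwarz:
  assumes "x \<in> Z" "y \<in> Z"
  shows "\<bar>B x y\<bar> \<le> sqrt (B x x) * sqrt (B y y)"
proof -
  have ge: "0 \<le> B x x + 2 * c * B x y + c\<^sup>2 * B y y" for c
    using nonneg[OF comb[OF assms]] B_comb_comb[OF assms] by simp
  have "(B x y)\<^sup>2 \<le> B x x * B y y"
  proof (cases "B y y = 0")
    case False
    with nonneg[OF assms(2)] have "B y y > 0" by simp
    have "0 \<le> B x x - (B x y)\<^sup>2 / B y y"
      using ge[of "- B x y / B y y"] False by (simp add: power2_eq_square field_simps)
    then show ?thesis using \<open>B y y > 0\<close> by (simp add: field_simps)
  next
    case True
    \<comment> \<open>If B y y = 0 the quadratic in c is affine, and a nonzero slope would allow the
      value -1.\<close>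
    have "B x y = 0"
    proof (rule ccontr)
      assume "B x y \<noteq> 0"
      then show False
        using ge[of "- (B x x + 1) / (2 * B x y)"] True nonneg[OF assms(1)]
        by (simp add: field_simps)
    qed
    then show ?thesis using True by simp
  qed
  then have "sqrt ((B x y)\<^sup>2) \<le> sqrt (B x x * B y y)" by (rule real_sqrt_le_mono)
  then show ?thesis by (simp add: real_sqrt_mult)
qed

lemma triangle:
  assumes "x \<in> Z" "y \<in> Z"
  shows "sqrt (B (comb x c y) (comb x c y)) \<le> sqrt (B x x) + \<bar>c\<bar> * sqrt (B y y)"
proof (rule real_le_lsqrt)
  have "c * B x y \<le> \<bar>c\<bar> * \<bar>B x y\<bar>"
    by (metis abs_ge_self abs_mult)
  also have "\<dots> \<le> \<bar>c\<bar> * (sqrt (B x x) * sqrt (B y y))"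
    by (intro mult_left_mono Cauchy_Schwarz assms) auto
  finally show "B (comb x c y) (comb x c y) \<le> (sqrt (B x x) + \<bar>c\<bar> * sqrt (B y y))\<^sup>2"
    using nonneg assms by (simp add: B_comb_comb power2_sum power_mult_distrib mult_ac)
qed (use nonneg assms in auto)

definition Cauchy_seq :: "(nat \<Rightarrow> 'z) \<Rightarrow> bool" where
  "Cauchy_seq z \<longleftrightarrow> (\<forall>n. z n \<in> Z) \<and>
    (\<forall>e>0. \<exists>N. \<forall>m\<ge>N. \<forall>n\<ge>N. sqrt (B (comb (z m) (-1) (z n)) (comb (z m) (-1) (z n))) < e)"

text \<open>The Riesz representation theorem without completeness: a minimising sequence of
  \<open>B z z - 2 F z\<close> is Cauchy and represents \<open>F\<close> in the limit.\<close>

lemma Riesz_sequence: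
  assumes "Z \<noteq> {}"
    and lin: "\<And>x y c. \<lbrakk>x \<in> Z; y \<in> Z\<rbrakk> \<Longrightarrow> F (comb x c y) = F x + c * F y"
    and bdd: "\<And>x. x \<in> Z \<Longrightarrow> \<bar>F x\<bar> \<le> M * sqrt (B x x)"
  shows "\<exists>z. Cauchy_seq z \<and> (\<forall>y\<in>Z. (\<lambda>n. B (z n) y) \<longlonglongrightarrow> F y)"
proof -
  define J where "J x = B x x - 2 * F x" for x
  define j where "j = (INF x\<in>Z. J x)"
  define \<epsilon> where "\<epsilon> n = inverse (real (Suc n))" for n
  have \<epsilon>: "\<epsilon> n > 0" "\<epsilon> \<longlonglongrightarrow> 0" for n
    using LIMSEQ_inverse_real_of_nat by (auto simp: \<epsilon>_def[abs_def] simp del: of_nat_Suc)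
  have "- M\<^sup>2 \<le> J x" if "x \<in> Z" for x
  proof -
    have "0 \<le> (sqrt (B x x) - M)\<^sup>2" by simp
    then show ?thesis
      using bdd[OF that, THEN abs_le_D1] nonneg[OF that] by (simp add: J_def power2_diff mult_ac)
  qed
  then have bb: "bdd_below (J ` Z)"
    unfolding bdd_below_def by blast
  have jle: "j \<le> J x" if "x \<in> Z" for x
    unfolding j_def by (rule cINF_lower[OF bb that])
  have "\<exists>x\<in>Z. J x < j + \<epsilon> n" for n
    using cINF_less_iff[OF \<open>Z \<noteq> {}\<close> bb, of "j + \<epsilon> n"] \<epsilon>(1)[of n] by (simp add: j_def)
  then obtain z where z: "\<And>n. z n \<in> Z" "\<And>n. J (z n) < j + \<epsilon> n"
    by metis
  let ?d = "\<lambda>m n. comb (z m) (-1) (z n)"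
  have dist: "B (?d m n) (?d m n) \<le> 2 * (\<epsilon> m + \<epsilon> n)" for m n
  proof -
    let ?y = "z m" and ?x = "z n"
    \<comment> \<open>The midpoint of the two elements; the parallelogram law turns the excess of
      \<open>J\<close> over its infimum into a bound on their distance.\<close>
    let ?w = "comb ?x (1/2) (comb ?y (-1) ?x)"
    have "j \<le> J ?w"
      by (intro jle comb z)
    moreover have "2 * (J ?x + J ?y - 2 * J ?w) = B (?d m n) (?d m n)"
      using z(1)[of m] z(1)[of n]
      by (simp add: J_def lin B_comb B_comb_right comb sym[of ?y ?x] power2_eq_square algebra_simps)
    ultimately show ?thesis
      using z(2)[of m] z(2)[of n] by argo
  qed
  show ?thesis
    unfolding Cauchy_seq_def
  proof (intro exI[of _ z] conjI allI impI ballI)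
    show "z n \<in> Z" for n by (rule z)
    show "\<exists>N. \<forall>m\<ge>N. \<forall>n\<ge>N. sqrt (B (?d m n) (?d m n)) < e" if "e > 0" for e
    proof -
      obtain N where N: "\<And>n. n \<ge> N \<Longrightarrow> \<epsilon> n < e\<^sup>2 / 4"
        using order_tendstoD(2)[OF \<epsilon>(2), of "e\<^sup>2 / 4"] \<open>e > 0\<close> by (auto simp: eventually_sequentially)
      have "sqrt (B (?d m n) (?d m n)) < e" if "m \<ge> N" "n \<ge> N" for m n
        using dist[of m n] N[OF that(1)] N[OF that(2)] \<open>e > 0\<close> by (intro real_less_lsqrt) auto
      then show ?thesis by blast
    qed
    show "(\<lambda>n. B (z n) y) \<longlonglongrightarrow> F y" if y: "y \<in> Z" for y
    proof -
      \<comment> \<open>The summand 1 keeps the divisor positive when B y y = 0; the variation with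
        parameter - r n / ?b then gives (r n)^2 \<le> \<epsilon> n ?b.\<close>
      let ?b = "B y y + 1"
      define r where "r n = B (z n) y - F y" for n
      have b: "?b > 0" using nonneg[OF y] by simp
      have Jt: "J (comb (z n) t y) = J (z n) + 2 * t * r n + t\<^sup>2 * B y y" for n t
        using z(1)[of n] y by (simp add: J_def r_def lin B_comb_comb algebra_simps)
      have "(r n)\<^sup>2 \<le> \<epsilon> n * ?b" for n
      proof -
        let ?t = "- r n / ?b"
        have "j \<le> J (comb (z n) ?t y)"
          by (intro jle comb z y)
        also have "\<dots> = J (z n) + 2 * ?t * r n + ?t\<^sup>2 * B y y"
          by (rule Jt)
        also have "\<dots> \<le> J (z n) + 2 * ?t * r n + ?t\<^sup>2 * ?b"
          by (intro add_left_mono mult_left_mono) auto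
        also have "\<dots> = J (z n) - (r n)\<^sup>2 / ?b"
          using b by (simp add: power2_eq_square divide_simps)
        finally show ?thesis
          using z(2)[of n] b by (simp add: pos_divide_le_eq[symmetric])
      qed
      then have "(\<lambda>n. (r n)\<^sup>2) \<longlonglongrightarrow> 0"
        by (intro Lim_null_comparison[of "\<lambda>n. (r n)\<^sup>2" "\<lambda>n. \<epsilon> n * ?b"] tendsto_mult_left_zero[OF \<epsilon>(2)]) auto
      then have "r \<longlonglongrightarrow> 0" by (simp add: power_tendsto_0_iff)
      then show ?thesis
        unfolding r_def by (simp add: LIM_zero_iff)
    qed
  qed
qed

text \<open>Completeness is required in the weak form that \<open>B (z n) y\<close> converges to
  \<open>B u y\<close> for each y; uniqueness of real limits then identifies u.\<close>

lemma Riesz_representation: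
  assumes "Z \<noteq> {}"
    and lin: "\<And>x y c. \<lbrakk>x \<in> Z; y \<in> Z\<rbrakk> \<Longrightarrow> F (comb x c y) = F x + c * F y"
    and bdd: "\<And>x. x \<in> Z \<Longrightarrow> \<bar>F x\<bar> \<le> M * sqrt (B x x)"
    and complete: "\<And>z. Cauchy_seq z \<Longrightarrow> \<exists>u\<in>Z. \<forall>y\<in>Z. (\<lambda>n. B (z n) y) \<longlonglongrightarrow> B u y"
  shows "\<exists>u\<in>Z. \<forall>y\<in>Z. B u y = F y"
proof -
  have "\<exists>z. Cauchy_seq z \<and> (\<forall>y\<in>Z. (\<lambda>n. B (z n) y) \<longlonglongrightarrow> F y)"
    by (rule Riesz_sequence[of F M]) (fact assms)+
  then obtain z where z: "Cauchy_seq z" "\<And>y. y \<in> Z \<Longrightarrow> (\<lambda>n. B (z n) y) \<longlonglongrightarrow> F y"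
    by blast
  from complete[OF z(1)] obtain u where "u \<in> Z" "\<And>y. y \<in> Z \<Longrightarrow> (\<lambda>n. B (z n) y) \<longlonglongrightarrow> B u y"
    by blast
  then show ?thesis
    using z(2) LIMSEQ_unique by blast
qed

end

section \<open>The space L2: inner product, Fatou's lemma and completeness\<close>

definition L2_inner :: "(real ^ 'n) set \<Rightarrow> (real ^ 'n \<Rightarrow> 'b::euclidean_space) \<Rightarrow> (real ^ 'n \<Rightarrow> 'b) \<Rightarrow> real" where
  "L2_inner \<Omega> f g = (LINT x|lebesgue_on \<Omega>. f x \<bullet> g x)"

lemma L2_norm_eq: "L2_norm \<Omega> f = sqrt (L2_inner \<Omega> f f)"
  by (simp add: L2_norm_def L2_inner_def power2_norm_eq_inner)

lemma L2_norm_nonneg: "0 \<le> L2_norm \<Omega> f"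
  by (simp add: L2_norm_def)

lemma L2_norm_sq: "(L2_norm \<Omega> f)\<^sup>2 = L2_inner \<Omega> f f"
  by (simp add: L2_norm_eq) (simp add: L2_inner_def)

lemma L2_measurable: "f \<in> L2 \<Omega> \<Longrightarrow> f \<in> borel_measurable (lebesgue_on \<Omega>)"
  by (simp add: L2_def)

text \<open>Source of membership and norm bounds for pointwise operations such as multiplication by
  K^(-1/2) or taking a component.\<close>

lemma L2_dominated:
  fixes g :: "real ^ 'n \<Rightarrow> 'b::euclidean_space" and f :: "real ^ 'n \<Rightarrow> 'c::euclidean_space"
  assumes f: "f \<in> L2 \<Omega>" and g: "g \<in> borel_measurable (lebesgue_on \<Omega>)"
    and le: "AE x in lebesgue_on \<Omega>. norm (g x) \<le> C * norm (f x)"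
  shows "g \<in> L2 \<Omega>" "L2_inner \<Omega> g g \<le> C\<^sup>2 * L2_inner \<Omega> f f"
proof -
  have int: "integrable (lebesgue_on \<Omega>) (\<lambda>x. C\<^sup>2 * (norm (f x))\<^sup>2)"
    using f by (simp add: L2_def)
  have ae: "AE x in lebesgue_on \<Omega>. (norm (g x))\<^sup>2 \<le> C\<^sup>2 * (norm (f x))\<^sup>2"
    using le by eventually_elim (metis norm_ge_zero power_mono power_mult_distrib)
  have intg: "integrable (lebesgue_on \<Omega>) (\<lambda>x. (norm (g x))\<^sup>2)"
    by (rule Bochner_Integration.integrable_bound[OF int]) (use g ae in auto)
  then show "g \<in> L2 \<Omega>" using g by (simp add: L2_def)
  show "L2_inner \<Omega> g g \<le> C\<^sup>2 * L2_inner \<Omega> f f"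
    using integral_mono_AE[OF intg int ae] by (simp add: L2_inner_def power2_norm_eq_inner)
qed

lemma integrable_L2_inner:
  assumes "f \<in> L2 \<Omega>" "g \<in> L2 \<Omega>"
  shows "integrable (lebesgue_on \<Omega>) (\<lambda>x. f x \<bullet> g x)"
proof (rule Bochner_Integration.integrable_bound)
  show "integrable (lebesgue_on \<Omega>) (\<lambda>x. (norm (f x))\<^sup>2 + (norm (g x))\<^sup>2)"
    using assms by (auto simp: L2_def)
  show "(\<lambda>x. f x \<bullet> g x) \<in> borel_measurable (lebesgue_on \<Omega>)"
    using assms by (auto intro!: borel_measurable_inner dest: L2_measurable)
  have "\<bar>f x \<bullet> g x\<bar> \<le> (norm (f x))\<^sup>2 + (norm (g x))\<^sup>2" for x
  proof -
    have "\<bar>f x \<bullet> g x\<bar> \<le> norm (f x) * norm (g x)" by (rule Cauchy_Schwarz_ineq2)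
    also have "\<dots> \<le> (norm (f x))\<^sup>2 + (norm (g x))\<^sup>2"
      using sum_squares_bound[of "norm (f x)" "norm (g x)"]
        mult_nonneg_nonneg[OF norm_ge_zero norm_ge_zero, of "f x" "g x"] by linarith
    finally show ?thesis .
  qed
  then show "AE x in lebesgue_on \<Omega>. norm (f x \<bullet> g x) \<le> norm ((norm (f x))\<^sup>2 + (norm (g x))\<^sup>2)"
    by simp
qed

lemma L2_comb:
  assumes "f \<in> L2 \<Omega>" "g \<in> L2 \<Omega>"
  shows "(\<lambda>x. f x + c *\<^sub>R g x) \<in> L2 \<Omega>"
proof -
  have "integrable (lebesgue_on \<Omega>) (\<lambda>x. f x \<bullet> f x + 2 * c * (f x \<bullet> g x) + (c * c) * (g x \<bullet> g x))"
    by (intro Bochner_Integration.integrable_add integrable_mult_right integrable_L2_inner assms)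
  also have "(\<lambda>x. f x \<bullet> f x + 2 * c * (f x \<bullet> g x) + (c * c) * (g x \<bullet> g x)) = (\<lambda>x. (norm (f x + c *\<^sub>R g x))\<^sup>2)"
    by (simp add: power2_norm_eq_inner inner_add_left inner_add_right inner_commute algebra_simps)
  finally show ?thesis
    using assms by (auto simp: L2_def)
qed

lemma L2_zero: "(\<lambda>x. 0) \<in> L2 \<Omega>"
  by (simp add: L2_def)

lemma L2_scaleR: "f \<in> L2 \<Omega> \<Longrightarrow> (\<lambda>x. c *\<^sub>R f x) \<in> L2 \<Omega>"
  using L2_comb[OF L2_zero, of f] by simp

lemma L2_add: "\<lbrakk>f \<in> L2 \<Omega>; g \<in> L2 \<Omega>\<rbrakk> \<Longrightarrow> (\<lambda>x. f x + g x) \<in> L2 \<Omega>"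
  using L2_comb[of f \<Omega> g 1] by simp

lemma L2_diff: "\<lbrakk>f \<in> L2 \<Omega>; g \<in> L2 \<Omega>\<rbrakk> \<Longrightarrow> (\<lambda>x. f x - g x) \<in> L2 \<Omega>"
  using L2_comb[of f \<Omega> g "-1"] by simp

lemma L2_inner_comb:
  "\<lbrakk>f \<in> L2 \<Omega>; g \<in> L2 \<Omega>; h \<in> L2 \<Omega>\<rbrakk>
    \<Longrightarrow> L2_inner \<Omega> (\<lambda>x. f x + c *\<^sub>R g x) h = L2_inner \<Omega> f h + c * L2_inner \<Omega> g h"
  by (simp add: L2_inner_def inner_add_left integrable_L2_inner)

lemma L2_inner_commute: "L2_inner \<Omega> f g = L2_inner \<Omega> g f"
  by (simp add: L2_inner_def inner_commute)

lemma semi_inner_L2: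
  fixes \<Omega> :: "(real ^ 'n) set"
  shows "semi_inner (L2 \<Omega> :: (real ^ 'n \<Rightarrow> 'b::euclidean_space) set) (\<lambda>f c g x. f x + c *\<^sub>R g x) (L2_inner \<Omega>)"
proof
  show "0 \<le> L2_inner \<Omega> f f" for f :: "real ^ 'n \<Rightarrow> 'b"
    by (simp flip: L2_norm_sq)
qed (auto intro: L2_comb L2_inner_comb L2_inner_commute)

lemma L2_inner_cong_AE:
  assumes "f \<in> L2 \<Omega>" "f' \<in> L2 \<Omega>" "g \<in> L2 \<Omega>" "g' \<in> L2 \<Omega>"
    and "AE x in lebesgue_on \<Omega>. f x = f' x" "AE x in lebesgue_on \<Omega>. g x = g' x"
  shows "L2_inner \<Omega> f g = L2_inner \<Omega> f' g'"
proof -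
  have "AE x in lebesgue_on \<Omega>. f x \<bullet> g x = f' x \<bullet> g' x"
    using assms(5,6) by eventually_elim simp
  then show ?thesis
    unfolding L2_inner_def using assms(1-4)[THEN L2_measurable] by (intro integral_cong_AE) auto
qed

lemma L2_Cauchy_Schwarz:
  "\<lbrakk>f \<in> L2 \<Omega>; g \<in> L2 \<Omega>\<rbrakk> \<Longrightarrow> \<bar>L2_inner \<Omega> f g\<bar> \<le> L2_norm \<Omega> f * L2_norm \<Omega> g"
  unfolding L2_norm_eq by (rule semi_inner.Cauchy_Schwarz[OF semi_inner_L2])

lemma L2_inner_self_eq_0:
  assumes "f \<in> L2 \<Omega>" "L2_inner \<Omega> f f \<le> 0"
  shows "AE x in lebesgue_on \<Omega>. f x = 0"
proof -
  have "L2_inner \<Omega> f f = 0"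
    using assms L2_norm_sq[of \<Omega> f] by (metis antisym zero_le_power2)
  then have "AE x in lebesgue_on \<Omega>. f x \<bullet> f x = 0"
    unfolding L2_inner_def
    by (subst (asm) integral_nonneg_eq_0_iff_AE) (auto intro: integrable_L2_inner assms)
  then show ?thesis by simp
qed

text \<open>Fatou's lemma: the limit inferior of the integrals is at most C, which yields
  integrability of the limit along with the bound.\<close>

lemma integral_bound_limit:
  fixes h :: "nat \<Rightarrow> 'a \<Rightarrow> real"
  assumes int: "\<And>k. integrable M (h k)" and nn: "\<And>k x. 0 \<le> h k x"
    and lim: "AE x in M. (\<lambda>k. h k x) \<longlonglongrightarrow> H x" and meas: "H \<in> borel_measurable M"
    and H: "\<And>x. 0 \<le> H x" and bound: "\<forall>\<^sub>F k in sequentially. integral\<^sup>L M (h k) \<le> C"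
  shows "integrable M H" "integral\<^sup>L M H \<le> C"
proof -
  have [measurable]: "h k \<in> borel_measurable M" for k using int by auto
  have "\<forall>\<^sub>F k in sequentially. 0 \<le> C"
    using bound by eventually_elim (rule order_trans[OF Bochner_Integration.integral_nonneg], rule nn)
  then have "0 \<le> C" by simp
  have "(\<integral>\<^sup>+x. ennreal (H x) \<partial>M) = (\<integral>\<^sup>+x. liminf (\<lambda>k. ennreal (h k x)) \<partial>M)"
  proof (rule nn_integral_cong_AE)
    show "AE x in M. ennreal (H x) = liminf (\<lambda>k. ennreal (h k x))"
      using lim by eventually_elim (rule lim_imp_Liminf[symmetric], simp, rule tendsto_ennrealI)
  qed
  also have "\<dots> \<le> liminf (\<lambda>k. \<integral>\<^sup>+x. ennreal (h k x) \<partial>M)"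
    by (rule nn_integral_liminf) auto
  also have "\<dots> \<le> ennreal C"
  proof (rule order_trans[OF Liminf_le_Limsup Limsup_bounded])
    show "\<forall>\<^sub>F k in sequentially. (\<integral>\<^sup>+x. ennreal (h k x) \<partial>M) \<le> ennreal C"
      using bound by eventually_elim (simp add: nn_integral_eq_integral int nn ennreal_leI)
  qed simp
  finally have le: "(\<integral>\<^sup>+x. ennreal (H x) \<partial>M) \<le> ennreal C" .
  then show I: "integrable M H"
    using meas H by (intro integrableI_nonneg) (auto simp: le_less_trans)
  show "integral\<^sup>L M H \<le> C"
    using le nn_integral_eq_integral[OF I] H \<open>0 \<le> C\<close> by (auto simp: ennreal_le_iff)
qed

text \<open>Riesz-Fischer. A subsequence with increments below (1/2)^k has an integrable sum of
  increments, hence converges almost everywhere; Fatou's lemma upgrades this to convergence in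
  norm.\<close>

lemma L2_complete:
  fixes f :: "nat \<Rightarrow> real ^ 'n \<Rightarrow> 'b::euclidean_space"
  assumes fin: "finite_measure (lebesgue_on \<Omega>)" and f: "\<And>n. f n \<in> L2 \<Omega>"
    and Cauchy: "\<And>e. e > 0 \<Longrightarrow> \<exists>N. \<forall>m\<ge>N. \<forall>n\<ge>N. L2_norm \<Omega> (\<lambda>x. f m x - f n x) < e"
  obtains g where "g \<in> L2 \<Omega>" "(\<lambda>n. L2_norm \<Omega> (\<lambda>x. f n x - g x)) \<longlonglongrightarrow> 0"
proof -
  let ?M = "lebesgue_on \<Omega>"
  interpret finite_measure ?M by fact
  note [measurable] = f[THEN L2_measurable]
  have "\<forall>k. \<exists>N. \<forall>m\<ge>N. \<forall>n\<ge>N. L2_norm \<Omega> (\<lambda>x. f m x - f n x) < (1/2) ^ k"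
    by (intro allI Cauchy) simp
  then obtain N where N: "\<And>k m n. \<lbrakk>m \<ge> N k; n \<ge> N k\<rbrakk> \<Longrightarrow> L2_norm \<Omega> (\<lambda>x. f m x - f n x) < (1/2) ^ k"
    by metis
  \<comment> \<open>Partial sums make r k at least N j for every j \<le> k, so all later indices
    inherit the earlier bounds.\<close>
  define r where "r k = (\<Sum>j\<le>k. N j)" for k
  have r: "N j \<le> r k" if "j \<le> k" for j k
    unfolding r_def using that by (intro member_le_sum) auto
  define d where "d k x = norm (f (r (Suc k)) x - f (r k) x)" for k x
  have [measurable]: "d k \<in> borel_measurable ?M" for k
    unfolding d_def by measurable
  \<comment> \<open>Finite measure enters here: pairing with the constant one bounds the integral of
    each increment by its L2 norm.\<close>
  have one: "(\<lambda>x. 1 :: real) \<in> L2 \<Omega>"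
    by (simp add: L2_def)
  have dL2: "d k \<in> L2 \<Omega>" for k
    using L2_diff[OF f f, of "r (Suc k)" "r k"] by (auto simp: L2_def d_def)
  have int_d: "integrable ?M (d k)" "integral\<^sup>L ?M (d k) \<le> (1/2) ^ k * L2_norm \<Omega> (\<lambda>x. 1 :: real)" for k
  proof -
    show "integrable ?M (d k)"
      using integrable_L2_inner[OF dL2 one] by simp
    have "integral\<^sup>L ?M (d k) \<le> L2_norm \<Omega> (d k) * L2_norm \<Omega> (\<lambda>x. 1 :: real)"
      using L2_Cauchy_Schwarz[OF dL2 one, of k] by (simp add: L2_inner_def)
    also have "\<dots> \<le> (1/2) ^ k * L2_norm \<Omega> (\<lambda>x. 1 :: real)"
    proof (rule mult_right_mono)
      have "L2_norm \<Omega> (d k) = L2_norm \<Omega> (\<lambda>x. f (r (Suc k)) x - f (r k) x)"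
        by (simp add: L2_norm_def d_def)
      also have "\<dots> \<le> (1/2) ^ k"
        using less_imp_le[OF N[OF r[of k "Suc k"] r[of k k]]] by simp
      finally show "L2_norm \<Omega> (d k) \<le> (1/2) ^ k" .
    qed (rule L2_norm_nonneg)
    finally show "integral\<^sup>L ?M (d k) \<le> (1/2) ^ k * L2_norm \<Omega> (\<lambda>x. 1 :: real)" .
  qed
  have conv: "AE x in ?M. convergent (\<lambda>k. f (r k) x)"
  proof -
    have "(\<integral>\<^sup>+x. (\<Sum>k. ennreal (d k x)) \<partial>?M) = (\<Sum>k. \<integral>\<^sup>+x. ennreal (d k x) \<partial>?M)"
      by (rule nn_integral_suminf) simp
    also have "\<dots> = (\<Sum>k. ennreal (integral\<^sup>L ?M (d k)))"
      by (intro suminf_cong nn_integral_eq_integral int_d) (simp add: d_def)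
    also have "\<dots> \<le> (\<Sum>k. ennreal ((1/2) ^ k * L2_norm \<Omega> (\<lambda>x. 1 :: real)))"
      by (intro suminf_le ennreal_leI int_d) auto
    also have "\<dots> < \<infinity>"
    proof -
      have "summable (\<lambda>k. (1/2) ^ k * L2_norm \<Omega> (\<lambda>x. 1 :: real))"
        by (intro summable_mult2 summable_geometric) simp
      then show ?thesis
        by (simp add: suminf_ennreal2 L2_norm_nonneg)
    qed
    finally have "(\<integral>\<^sup>+x. (\<Sum>k. ennreal (d k x)) \<partial>?M) \<noteq> \<infinity>" by simp
    then have "AE x in ?M. (\<Sum>k. ennreal (d k x)) \<noteq> \<infinity>"
      by (intro nn_integral_noteq_infinite) auto
    then show ?thesis
    proof eventually_elim
      case (elim x)
      then have "summable (\<lambda>k. d k x)"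
        by (intro summable_suminf_not_top) (auto simp: d_def)
      then have "summable (\<lambda>k. f (r (Suc k)) x - f (r k) x)"
        unfolding d_def by (rule summable_norm_cancel)
      then have "convergent (\<lambda>n. \<Sum>k<n. f (r (Suc k)) x - f (r k) x)"
        by (simp add: summable_iff_convergent)
      then have "convergent (\<lambda>n. f (r n) x - f (r 0) x)"
        by (simp add: sum_lessThan_telescope[of "\<lambda>k. f (r k) x"])
      then show ?case
        using convergent_add[OF _ convergent_const[of "f (r 0) x"]] by fastforce
    qed
  qed
  define g where "g x = lim (\<lambda>k. f (r k) x)" for x
  have [measurable]: "g \<in> borel_measurable ?M"
    unfolding g_def by measurable
  have lim: "AE x in ?M. (\<lambda>k. f (r k) x) \<longlonglongrightarrow> g x"
    using conv by eventually_elim (simp add: g_def convergent_LIMSEQ_iff)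
  \<comment> \<open>Here n is fixed and the limit is taken along the subsequence in the second
    index, so the estimate covers the whole sequence.\<close>
  have key: "(\<lambda>x. f n x - g x) \<in> L2 \<Omega>" "L2_norm \<Omega> (\<lambda>x. f n x - g x) \<le> (1/2) ^ k" if n: "n \<ge> N k" for n k
  proof -
    have I: "integrable ?M (\<lambda>x. (norm (f n x - f (r j) x))\<^sup>2)" for j
      using L2_diff[OF f f, of n "r j"] by (simp add: L2_def)
    have L: "AE x in ?M. (\<lambda>j. (norm (f n x - f (r j) x))\<^sup>2) \<longlonglongrightarrow> (norm (f n x - g x))\<^sup>2"
      using lim by eventually_elim (intro tendsto_intros)
    have E: "\<forall>\<^sub>F j in sequentially. (LINT x|?M. (norm (f n x - f (r j) x))\<^sup>2) \<le> ((1/2) ^ k)\<^sup>2"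
      unfolding eventually_sequentially
    proof (intro exI allI impI)
      fix j assume "k \<le> j"
      then have "L2_norm \<Omega> (\<lambda>x. f n x - f (r j) x) \<le> (1/2) ^ k"
        using less_imp_le[OF N[OF n r[OF \<open>k \<le> j\<close>]]] by simp
      then have "(L2_norm \<Omega> (\<lambda>x. f n x - f (r j) x))\<^sup>2 \<le> ((1/2) ^ k)\<^sup>2"
        by (intro power_mono L2_norm_nonneg)
      then show "(LINT x|?M. (norm (f n x - f (r j) x))\<^sup>2) \<le> ((1/2) ^ k)\<^sup>2"
        by (simp add: L2_norm_sq L2_inner_def power2_norm_eq_inner)
    qed
    note B = integral_bound_limit[OF I _ L _ _ E]
    show "(\<lambda>x. f n x - g x) \<in> L2 \<Omega>"
      using B by (simp add: L2_def)
    show "L2_norm \<Omega> (\<lambda>x. f n x - g x) \<le> (1/2) ^ k"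
      unfolding L2_norm_def using B by (intro real_le_lsqrt) auto
  qed
  show thesis
  proof
    show "g \<in> L2 \<Omega>"
      using L2_diff[OF f[of "N 0"] key(1)[of 0 "N 0"]] by simp
    show "(\<lambda>n. L2_norm \<Omega> (\<lambda>x. f n x - g x)) \<longlonglongrightarrow> 0"
    proof (rule LIMSEQ_I)
      fix e :: real assume "e > 0"
      then obtain k where "(1/2 :: real) ^ k < e"
        using real_arch_pow_inv[of e "1/2"] by auto
      then have "norm (L2_norm \<Omega> (\<lambda>x. f n x - g x) - 0) < e" if "n \<ge> N k" for n
        using key(2)[OF that] L2_norm_nonneg[of \<Omega> "\<lambda>x. f n x - g x"] by simp
      then show "\<exists>no. \<forall>n\<ge>no. norm (L2_norm \<Omega> (\<lambda>x. f n x - g x) - 0) < e"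
        by blast
    qed
  qed
qed

lemma L2_inner_tendsto:
  assumes f: "\<And>n. f n \<in> L2 \<Omega>" and g: "g \<in> L2 \<Omega>" and h: "h \<in> L2 \<Omega>"
    and lim: "(\<lambda>n. L2_norm \<Omega> (\<lambda>x. f n x - g x)) \<longlonglongrightarrow> 0"
  shows "(\<lambda>n. L2_inner \<Omega> (f n) h) \<longlonglongrightarrow> L2_inner \<Omega> g h"
proof (rule LIM_zero_cancel, rule Lim_null_comparison)
  have "norm (L2_inner \<Omega> (f n) h - L2_inner \<Omega> g h) \<le> L2_norm \<Omega> (\<lambda>x. f n x - g x) * L2_norm \<Omega> h" for n
    using L2_Cauchy_Schwarz[OF L2_diff[OF f g] h, of n] L2_inner_comb[OF f g h, of n "-1"] by simp
  then show "\<forall>\<^sub>F n in sequentially. norm (L2_inner \<Omega> (f n) h - L2_inner \<Omega> g h)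
      \<le> L2_norm \<Omega> (\<lambda>x. f n x - g x) * L2_norm \<Omega> h"
    by simp
  show "(\<lambda>n. L2_norm \<Omega> (\<lambda>x. f n x - g x) * L2_norm \<Omega> h) \<longlonglongrightarrow> 0"
    using tendsto_mult_left_zero[OF lim] by simp
qed

section \<open>Weak derivatives\<close>

locale bounded_open =
  fixes \<Omega> :: "(real ^ 'n) set"
  assumes open_dom: "open \<Omega>" and bounded_dom: "bounded \<Omega>" and nonempty: "\<Omega> \<noteq> {}"
begin

abbreviation "M \<equiv> lebesgue_on \<Omega>"

lemma dom_lmeasurable: "\<Omega> \<in> lmeasurable"
  using open_dom bounded_dom by (rule lmeasurable_open[rotated])

lemma dom_sets [simp]: "\<Omega> \<in> sets lebesgue"
  using dom_lmeasurable by (rule fmeasurableD)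

lemma finite_measure_dom: "finite_measure M"
  using dom_lmeasurable by (rule finite_measure_lebesgue_on)

lemma continuous_imp_measurable:
  fixes f :: "real ^ 'n \<Rightarrow> 'b::euclidean_space"
  shows "continuous_on UNIV f \<Longrightarrow> f \<in> borel_measurable M"
  by (intro measurable_restrict_space1 measurable_completion) (simp add: borel_measurable_continuous_onI)

lemma bounded_in_L2:
  assumes "f \<in> borel_measurable M" "\<And>x. x \<in> \<Omega> \<Longrightarrow> norm (f x) \<le> C"
  shows "f \<in> L2 \<Omega>"
proof -
  interpret finite_measure M by (rule finite_measure_dom)
  have "(\<lambda>x. 1 :: real) \<in> L2 \<Omega>"
    by (simp add: L2_def)
  then show ?thesis
    by (rule L2_dominated(1)[where C = C]) (use assms in auto)
qed

lemma L2_one: "(\<lambda>x. 1 :: real) \<in> L2 \<Omega>"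
  by (rule bounded_in_L2[where C = 1]) auto

text \<open>By completeness of Lebesgue measure a change on a null set preserves measurability. This
  serves \<open>matrix_sqrt (K x)\<close>, whose limit formula holds only almost everywhere.\<close>

lemma borel_measurable_AE_dom:
  fixes f g :: "real ^ 'n \<Rightarrow> 'b::euclidean_space"
  assumes f: "f \<in> borel_measurable M" and ae: "AE x in M. f x = g x"
  shows "g \<in> borel_measurable M"
proof -
  have "(\<lambda>x. indicator \<Omega> x *\<^sub>R f x) \<in> borel_measurable lebesgue"
    using f by (simp add: borel_measurable_restrict_space_iff)
  moreover have "AE x in lebesgue. x \<in> \<Omega> \<longrightarrow> f x = g x"
    using ae by (subst (asm) AE_restrict_space_iff) auto
  then have "AE x in lebesgue. indicator \<Omega> x *\<^sub>R f x = indicator \<Omega> x *\<^sub>R g x"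
    by eventually_elim (auto simp: indicator_def)
  ultimately have "(\<lambda>x. indicator \<Omega> x *\<^sub>R g x) \<in> borel_measurable lebesgue"
    by (rule borel_measurable_AE)
  then show ?thesis
    by (simp add: borel_measurable_restrict_space_iff)
qed

lemma integral_dom_eq_lborel:
  fixes f :: "real ^ 'n \<Rightarrow> real"
  assumes "continuous_on UNIV f" "\<And>x. x \<notin> \<Omega> \<Longrightarrow> f x = 0"
  shows "integral\<^sup>L M f = integral\<^sup>L lborel f"
proof -
  have "integral\<^sup>L M f = integral\<^sup>L lebesgue (\<lambda>x. indicator \<Omega> x *\<^sub>R f x)"
    by (rule integral_restrict_space) simp
  also have "(\<lambda>x. indicator \<Omega> x *\<^sub>R f x) = f"
    using assms(2) by (fastforce simp: indicator_def)
  also have "integral\<^sup>L lebesgue f = integral\<^sup>L lborel f"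
    using assms(1) by (intro integral_completion) (simp add: borel_measurable_continuous_onI)
  finally show ?thesis .
qed

lemma test_functions_smooth: "\<phi> \<in> test_functions \<Omega> \<Longrightarrow> C_k k \<phi>"
  by (simp add: test_functions_def)

lemma test_functions_zero: "\<phi> \<in> test_functions \<Omega> \<Longrightarrow> x \<notin> \<Omega> \<Longrightarrow> \<phi> x = 0"
  unfolding test_functions_def using closure_subset[of "{x. \<phi> x \<noteq> 0}"] by auto

lemma test_functions_grad_zero: "\<phi> \<in> test_functions \<Omega> \<Longrightarrow> x \<notin> \<Omega> \<Longrightarrow> grad \<phi> x = 0"
  unfolding test_functions_def by (intro grad_eq_0_outside) auto

lemma test_functions_bounded: "\<phi> \<in> test_functions \<Omega> \<Longrightarrow> bounded {x. \<phi> x \<noteq> 0}"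
  using test_functions_zero by (auto intro: bounded_subset[OF bounded_dom])

lemma test_functions_differentiable: "\<phi> \<in> test_functions \<Omega> \<Longrightarrow> \<phi> differentiable at x"
  using test_functions_smooth[of \<phi> "Suc 0"] by simp

lemma test_functions_continuous: "\<phi> \<in> test_functions \<Omega> \<Longrightarrow> continuous_on UNIV \<phi>"
  using test_functions_smooth[of \<phi> 0] by simp

lemma test_functions_grad_continuous: "\<phi> \<in> test_functions \<Omega> \<Longrightarrow> continuous_on UNIV (grad \<phi>)"
  by (intro continuous_on_grad test_functions_smooth)

lemma continuous_in_L2:
  fixes f :: "real ^ 'n \<Rightarrow> 'b::euclidean_space"
  assumes "continuous_on UNIV f"
  shows "f \<in> L2 \<Omega>"
proof -
  have "bounded (f ` closure \<Omega>)"
    using assms bounded_dom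
    by (intro compact_imp_bounded compact_continuous_image) (auto intro: continuous_on_subset)
  then obtain C where "\<And>x. x \<in> closure \<Omega> \<Longrightarrow> norm (f x) \<le> C"
    by (auto simp: bounded_iff)
  then show ?thesis
    using continuous_imp_measurable[OF assms] closure_subset by (intro bounded_in_L2) auto
qed

lemma test_functions_L2: "\<phi> \<in> test_functions \<Omega> \<Longrightarrow> \<phi> \<in> L2 \<Omega>"
  by (intro continuous_in_L2 test_functions_continuous)

lemma test_functions_grad_L2: "\<phi> \<in> test_functions \<Omega> \<Longrightarrow> grad \<phi> \<in> L2 \<Omega>"
  by (intro continuous_in_L2 test_functions_grad_continuous)

lemma test_functions_grad_nth_L2: "\<phi> \<in> test_functions \<Omega> \<Longrightarrow> (\<lambda>x. grad \<phi> x $ i) \<in> L2 \<Omega>"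
  by (intro continuous_in_L2 continuous_intros test_functions_grad_continuous)

lemma test_functions_comb:
  assumes "\<phi> \<in> test_functions \<Omega>" "\<psi> \<in> test_functions \<Omega>"
  shows "(\<lambda>x. \<phi> x + c * \<psi> x) \<in> test_functions \<Omega>"
proof -
  have sub: "closure {x. \<phi> x + c * \<psi> x \<noteq> 0} \<subseteq> closure {x. \<phi> x \<noteq> 0} \<union> closure {x. \<psi> x \<noteq> 0}"
    unfolding closure_Un[symmetric] by (rule closure_mono) auto
  moreover have "compact (closure {x. \<phi> x + c * \<psi> x \<noteq> 0})"
    using assms compact_Int_closed[of "closure {x. \<phi> x \<noteq> 0} \<union> closure {x. \<psi> x \<noteq> 0}" "closure {x. \<phi> x + c * \<psi> x \<noteq> 0}"] sub
    by (auto simp: test_functions_def compact_Un Int_absorb1)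
  moreover have "C_k k (\<lambda>x. \<phi> x + c * \<psi> x)" for k
    using assms by (intro C_k_add C_k_mult C_k_const test_functions_smooth)
  ultimately show ?thesis
    using assms by (auto simp: test_functions_def)
qed

lemma grad_comb:
  assumes "\<phi> \<in> test_functions \<Omega>" "\<psi> \<in> test_functions \<Omega>"
  shows "grad (\<lambda>x. \<phi> x + c * \<psi> x) = (\<lambda>x. grad \<phi> x + c *\<^sub>R grad \<psi> x)"
  using assms[THEN test_functions_differentiable]
  by (intro ext) (simp add: grad_add grad_mult grad_const)

text \<open>The product with \<phi> has compact support inside \<Omega>, so its partial derivative
  has integral zero over the whole space, whatever f does at the boundary.\<close>

lemma integral_by_parts:
  assumes \<phi>: "\<phi> \<in> test_functions \<Omega>" and f: "C_k (Suc 0) f"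
  shows "(LINT x|M. f x * grad \<phi> x $ i) = - (LINT x|M. grad f x $ i * \<phi> x)"
proof -
  have \<phi>1: "C_k (Suc 0) \<phi>" using \<phi> by (rule test_functions_smooth)
  have cont: "continuous_on UNIV \<phi>" "continuous_on UNIV f"
    using C_k_Suc_imp[OF \<phi>1] C_k_Suc_imp[OF f] by auto
  have contg: "continuous_on UNIV (\<lambda>x. grad \<phi> x $ i)" "continuous_on UNIV (\<lambda>x. grad f x $ i)"
    using \<phi>1 f by auto
  have int: "integrable M (\<lambda>x. u x * v x)" if "continuous_on UNIV u" "continuous_on UNIV v" for u v :: "real ^ 'n \<Rightarrow> real"
    using integrable_L2_inner[OF that[THEN continuous_in_L2]] by simp
  have "0 = (LINT x|lborel. grad (\<lambda>x. f x * \<phi> x) x $ i)"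
    using \<phi> f \<phi>1 by (intro integral_grad_eq_0[symmetric] C_k_mult bounded_subset[OF test_functions_bounded[OF \<phi>]]) auto
  also have "\<dots> = (LINT x|lborel. f x * grad \<phi> x $ i + grad f x $ i * \<phi> x)"
    using f test_functions_differentiable[OF \<phi>] by (intro Bochner_Integration.integral_cong) (auto simp: grad_mult)
  also have "\<dots> = (LINT x|M. f x * grad \<phi> x $ i + grad f x $ i * \<phi> x)"
    by (rule integral_dom_eq_lborel[symmetric])
      (auto intro!: continuous_intros cont contg simp: test_functions_zero[OF \<phi>] test_functions_grad_zero[OF \<phi>])
  also have "\<dots> = (LINT x|M. f x * grad \<phi> x $ i) + (LINT x|M. grad f x $ i * \<phi> x)"
    by (intro Bochner_Integration.integral_add int cont contg)
  finally show ?thesis by simp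
qed

text \<open>Integrate \<open>\<phi>\<^sup>2\<close> by parts against the coordinate function \<open>x\<^sub>i\<close>, whose derivative is one.\<close>

lemma Friedrichs_inequality:
  obtains C where "C > 0" "\<And>\<phi>. \<phi> \<in> test_functions \<Omega> \<Longrightarrow> L2_norm \<Omega> \<phi> \<le> C * L2_norm \<Omega> (grad \<phi>)"
proof -
  fix i :: 'n
  obtain R where R: "R > 0" "\<And>x. x \<in> \<Omega> \<Longrightarrow> norm x \<le> R"
    using bounded_dom by (auto simp: bounded_pos)
  have "L2_norm \<Omega> \<phi> \<le> (2 * R) * L2_norm \<Omega> (grad \<phi>)" if \<phi>: "\<phi> \<in> test_functions \<Omega>" for \<phi>
  proof -
    let ?g = "\<lambda>x. (2 * x $ i) *\<^sub>R (\<phi> x)" and ?d = "\<lambda>x. grad \<phi> x $ i"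
    have L2: "\<phi> \<in> L2 \<Omega>" "?g \<in> L2 \<Omega>" "?d \<in> L2 \<Omega>"
      by (intro continuous_in_L2 continuous_intros test_functions_continuous[OF \<phi>] test_functions_grad_continuous[OF \<phi>])+
    have d1: "C_k (Suc 0) (\<lambda>x. x $ i * \<phi> x)"
      by (intro C_k_mult C_k_coordinate test_functions_smooth \<phi>)
    have "grad (\<lambda>x. x $ i * \<phi> x) x $ i = x $ i * grad \<phi> x $ i + \<phi> x" for x
      using test_functions_differentiable[OF \<phi>, of x] C_k_coordinate[of "Suc 0" i]
      by (simp add: grad_mult grad_coordinate)
    \<comment> \<open>The mixed integral occurs on both sides; collecting it produces the factor 2
      in \<open>?g\<close> and, with |x $ i| \<le> R, the constant 2 R.\<close>
    then have "(LINT x|M. x $ i * \<phi> x * ?d x) = - (LINT x|M. (x $ i * ?d x + \<phi> x) * \<phi> x)"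
      using integral_by_parts[OF \<phi> d1, of i] by simp
    moreover have "L2_inner \<Omega> ?g ?d = 2 * (LINT x|M. x $ i * \<phi> x * ?d x)"
      by (simp add: L2_inner_def mult.assoc)
    moreover have "(LINT x|M. (x $ i * ?d x + \<phi> x) * \<phi> x) = (LINT x|M. x $ i * \<phi> x * ?d x) + L2_inner \<Omega> \<phi> \<phi>"
    proof -
      have "integrable M (\<lambda>x. x $ i * \<phi> x * ?d x)"
        using integrable_L2_inner[OF L2(2,3)] by (simp add: mult.assoc)
      with integrable_L2_inner[OF L2(1,1)] show ?thesis
        by (simp add: L2_inner_def algebra_simps)
    qed
    ultimately have "L2_inner \<Omega> \<phi> \<phi> = - L2_inner \<Omega> ?g ?d"
      by simp
    also have "\<dots> \<le> L2_norm \<Omega> ?g * L2_norm \<Omega> ?d"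
      using L2_Cauchy_Schwarz[OF L2(2,3)] by simp
    also have "\<dots> \<le> ((2 * R) * L2_norm \<Omega> \<phi>) * L2_norm \<Omega> (grad \<phi>)"
    proof (intro mult_mono)
      have "\<bar>x $ i\<bar> \<le> R" if "x \<in> \<Omega>" for x
        using R(2)[OF that] component_le_norm_cart[of x i] by linarith
      then have "AE x in M. norm (?g x) \<le> (2 * R) * norm (\<phi> x)"
        by (intro AE_I2) (auto simp: abs_mult intro!: mult_right_mono)
      from L2_dominated(2)[OF L2(1) L2_measurable[OF L2(2)] this]
      have "(L2_norm \<Omega> ?g)\<^sup>2 \<le> ((2 * R) * L2_norm \<Omega> \<phi>)\<^sup>2"
        by (simp add: L2_norm_sq power_mult_distrib)
      then show "L2_norm \<Omega> ?g \<le> (2 * R) * L2_norm \<Omega> \<phi>"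
        by (rule power2_le_imp_le) (use R(1) in \<open>simp add: L2_norm_nonneg\<close>)
      have "AE x in M. norm (?d x) \<le> 1 * norm (grad \<phi> x)"
        by (simp add: component_le_norm_cart)
      from L2_dominated(2)[OF test_functions_grad_L2[OF \<phi>] L2_measurable[OF L2(3)] this]
      have "(L2_norm \<Omega> ?d)\<^sup>2 \<le> (L2_norm \<Omega> (grad \<phi>))\<^sup>2"
        by (simp add: L2_norm_sq)
      then show "L2_norm \<Omega> ?d \<le> L2_norm \<Omega> (grad \<phi>)"
        by (rule power2_le_imp_le[OF _ L2_norm_nonneg])
    qed (use R(1) in \<open>simp_all add: L2_norm_nonneg\<close>)
    finally have "L2_norm \<Omega> \<phi> * L2_norm \<Omega> \<phi> \<le> L2_norm \<Omega> \<phi> * ((2 * R) * L2_norm \<Omega> (grad \<phi>))"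
      by (simp add: L2_norm_sq[symmetric] power2_eq_square mult_ac)
    then show ?thesis
      using L2_norm_nonneg[of \<Omega> \<phi>] L2_norm_nonneg[of \<Omega> "grad \<phi>"] R(1)
      by (cases "L2_norm \<Omega> \<phi> = 0") (auto simp: mult_le_cancel_left)
  qed
  then show thesis using R(1) by (intro that[of "2 * R"]) auto
qed

text \<open>Bump functions show that w has integral zero over every closed box in \<Omega>; by the
  Lebesgue differentiation theorem w is almost everywhere the limit of its averages over shrinking
  cubes.\<close>

lemma fundamental_lemma:
  fixes w :: "real ^ 'n \<Rightarrow> real"
  assumes w: "w \<in> L2 \<Omega>" and zero: "\<And>\<phi>. \<phi> \<in> test_functions \<Omega> \<Longrightarrow> (LINT x|M. w x * \<phi> x) = 0"
  shows "AE x in M. w x = 0"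
proof -
  have wint: "integrable M w"
    using integrable_L2_inner[OF w L2_one] by simp
  define f where "f x = indicator \<Omega> x *\<^sub>R w x" for x
  have fint: "integrable lebesgue f"
    using wint unfolding f_def by (subst (asm) integrable_restrict_space) auto
  have fint': "set_integrable lebesgue S f" if "S \<in> sets lebesgue" for S
    unfolding set_integrable_def using integrable_mult_indicator[OF that fint] .
  have "f integrable_on cbox a b" for a b
    by (intro set_lebesgue_integral_eq_integral(1) fint') simp
  then obtain N where N: "negligible N"
    "\<And>x e. \<lbrakk>x \<notin> N; 0 < e\<rbrakk> \<Longrightarrow> \<exists>d>0. \<forall>h. 0 < h \<and> h < d \<longrightarrow>
        norm (integral (cbox x (x + h *\<^sub>R One)) f /\<^sub>R h ^ DIM(real ^ 'n) - f x) < e"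
    using integrable_ccontinuous_explicit[of f] by blast
  have box0: "integral (cbox a b) f = 0" if "cbox a b \<subseteq> \<Omega>" for a b
  proof -
    have "(\<lambda>m. LINT x|M. w x * bump a b m x) \<longlonglongrightarrow> (LINT x|M. w x * indicator (box a b) x)"
    proof (rule integral_dominated_convergence[where w = "\<lambda>x. norm (w x)"])
      show "integrable M (\<lambda>x. norm (w x))" using wint by simp
      show "(\<lambda>x. w x * bump a b m x) \<in> borel_measurable M" for m
        using C_k_bump[of 0 a b m] by (intro borel_measurable_times L2_measurable w continuous_imp_measurable) simp
      have "(indicator (box a b) :: _ \<Rightarrow> real) \<in> borel_measurable M"
        by (intro measurable_restrict_space1 borel_measurable_indicator) auto
      then show "(\<lambda>x. w x * indicator (box a b) x) \<in> borel_measurable M"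
        by (intro borel_measurable_times L2_measurable[OF w])
      show "AE x in M. norm (w x * bump a b m x) \<le> norm (w x)" for m
        by (intro AE_I2) (simp add: abs_mult abs_of_nonneg[OF bump_bounds(1)] mult_left_le[OF bump_bounds(2)])
      show "AE x in M. (\<lambda>m. w x * bump a b m x) \<longlonglongrightarrow> w x * indicator (box a b) x"
        by (intro AE_I2 tendsto_mult tendsto_const bump_tendsto)
    qed
    moreover have "(LINT x|M. w x * bump a b m x) = 0" for m
      by (intro zero bump_test_function that)
    ultimately have "(LINT x|M. w x * indicator (box a b) x) = 0"
      by (simp only: LIMSEQ_const_iff)
    then have "(LINT x|lebesgue. indicator \<Omega> x *\<^sub>R (w x * indicator (box a b) x)) = 0"
      by (subst (asm) integral_restrict_space) auto
    also have "(\<lambda>x. indicator \<Omega> x *\<^sub>R (w x * indicator (box a b) x)) = (\<lambda>x. indicator (box a b) x *\<^sub>R f x)"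
      by (simp add: f_def fun_eq_iff mult_ac)
    finally have "integral (box a b) f = 0"
      using set_lebesgue_integral_eq_integral(2)[OF fint', of "box a b"]
      by (simp add: set_lebesgue_integral_def)
    then show ?thesis by (simp add: integral_open_interval)
  qed
  have "w x = 0" if "x \<in> \<Omega>" "x \<notin> N" for x
  proof (rule ccontr)
    assume "w x \<noteq> 0"
    obtain \<delta> where \<delta>: "\<delta> > 0" "cball x \<delta> \<subseteq> \<Omega>"
      using open_dom \<open>x \<in> \<Omega>\<close> open_contains_cball by blast
    obtain d where d: "d > 0" "\<And>h. \<lbrakk>0 < h; h < d\<rbrakk> \<Longrightarrow>
        norm (integral (cbox x (x + h *\<^sub>R One)) f /\<^sub>R h ^ DIM(real ^ 'n) - f x) < norm (w x)"
      using N(2)[OF \<open>x \<notin> N\<close>, of "norm (w x)"] \<open>w x \<noteq> 0\<close> by auto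
    define D where "D = real DIM(real ^ 'n)"
    have "D > 0" by (simp add: D_def)
    \<comment> \<open>Below d for the differentiation theorem, and with h D \<le> \<delta> so that
      the l1 bound on the norm keeps the cube inside the ball around x.\<close>
    define h where "h = min (d / 2) (\<delta> / D)"
    have h: "0 < h" "h < d" "h * D \<le> \<delta>"
      using d(1) \<delta>(1) \<open>D > 0\<close> by (auto simp: h_def min_def field_simps)
    have "cbox x (x + h *\<^sub>R One) \<subseteq> \<Omega>"
    proof
      fix y assume y: "y \<in> cbox x (x + h *\<^sub>R One)"
      have "norm (y - x) \<le> (\<Sum>b\<in>Basis. \<bar>(y - x) \<bullet> b\<bar>)"
        by (rule norm_le_l1)
      also have "\<dots> \<le> (\<Sum>b\<in>(Basis :: (real ^ 'n) set). h)"
        using y by (intro sum_mono) (auto simp: mem_box inner_diff_left inner_add_left)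
      also have "\<dots> \<le> \<delta>"
        using h(3) by (simp add: D_def mult.commute)
      finally show "y \<in> \<Omega>"
        using \<delta>(2) by (auto simp: dist_norm norm_minus_commute subset_eq)
    qed
    then have "integral (cbox x (x + h *\<^sub>R One)) f = 0" by (rule box0)
    then show False
      using d(2)[OF h(1,2)] \<open>x \<in> \<Omega>\<close> by (simp add: f_def)
  qed
  moreover have "AE x in lebesgue. x \<notin> N"
    using N(1) by (intro AE_not_in) (simp add: negligible_iff_null_sets)
  ultimately show ?thesis
    by (auto simp: AE_restrict_space_iff elim!: eventually_mono)
qed

section \<open>Weak divergence and weak gradient\<close>

lemma is_weak_div_iff:
  "is_weak_div \<Omega> v w \<longleftrightarrow> (\<forall>\<phi>\<in>test_functions \<Omega>. L2_inner \<Omega> v (grad \<phi>) = - L2_inner \<Omega> w \<phi>)"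
  by (simp add: is_weak_div_def L2_inner_def)

lemma HdivD:
  assumes "v \<in> Hdiv \<Omega>"
  shows "v \<in> L2 \<Omega>" "weak_div \<Omega> v \<in> L2 \<Omega>" "is_weak_div \<Omega> v (weak_div \<Omega> v)"
proof -
  have "\<exists>w. w \<in> L2 \<Omega> \<and> is_weak_div \<Omega> v w"
    using assms by (auto simp: Hdiv_def)
  from someI_ex[OF this] show "weak_div \<Omega> v \<in> L2 \<Omega>" "is_weak_div \<Omega> v (weak_div \<Omega> v)"
    by (simp_all add: weak_div_def)
  show "v \<in> L2 \<Omega>" using assms by (simp add: Hdiv_def)
qed

text \<open>The difference of two weak divergences is orthogonal to all test functions. This ties
  the \<open>SOME\<close> choice in \<open>weak_div\<close> to any concretely computed divergence,
  up to a null set.\<close>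

lemma weak_div_eq:
  assumes "v \<in> L2 \<Omega>" "w \<in> L2 \<Omega>" "is_weak_div \<Omega> v w"
  shows "v \<in> Hdiv \<Omega>" "AE x in M. weak_div \<Omega> v x = w x"
proof -
  show v: "v \<in> Hdiv \<Omega>" using assms by (auto simp: Hdiv_def)
  note D = HdivD[OF v]
  have "AE x in M. weak_div \<Omega> v x - w x = 0"
  proof (rule fundamental_lemma)
    show "(\<lambda>x. weak_div \<Omega> v x - w x) \<in> L2 \<Omega>"
      using D assms by (intro L2_diff)
    fix \<phi> assume \<phi>: "\<phi> \<in> test_functions \<Omega>"
    have "L2_inner \<Omega> (weak_div \<Omega> v) \<phi> = L2_inner \<Omega> w \<phi>"
      using D(3) assms(3) \<phi> by (simp add: is_weak_div_iff)
    then show "(LINT x|M. (weak_div \<Omega> v x - w x) * \<phi> x) = 0"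
      using L2_inner_comb[OF D(2) assms(2) test_functions_L2[OF \<phi>], of "-1"]
      by (simp add: L2_inner_def)
  qed
  then show "AE x in M. weak_div \<Omega> v x = w x" by simp
qed

lemma weak_div_comb:
  assumes u: "u \<in> Hdiv \<Omega>" and v: "v \<in> Hdiv \<Omega>"
  shows "(\<lambda>x. u x + c *\<^sub>R v x) \<in> Hdiv \<Omega>"
    "AE x in M. weak_div \<Omega> (\<lambda>x. u x + c *\<^sub>R v x) x = weak_div \<Omega> u x + c *\<^sub>R weak_div \<Omega> v x"
proof -
  note U = HdivD[OF u] and V = HdivD[OF v]
  have "is_weak_div \<Omega> (\<lambda>x. u x + c *\<^sub>R v x) (\<lambda>x. weak_div \<Omega> u x + c *\<^sub>R weak_div \<Omega> v x)"
    unfolding is_weak_div_iff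
  proof
    fix \<phi> assume \<phi>: "\<phi> \<in> test_functions \<Omega>"
    show "L2_inner \<Omega> (\<lambda>x. u x + c *\<^sub>R v x) (grad \<phi>)
        = - L2_inner \<Omega> (\<lambda>x. weak_div \<Omega> u x + c *\<^sub>R weak_div \<Omega> v x) \<phi>"
      unfolding L2_inner_comb[OF U(1) V(1) test_functions_grad_L2[OF \<phi>]]
        L2_inner_comb[OF U(2) V(2) test_functions_L2[OF \<phi>]]
      using U(3) V(3) \<phi> by (simp add: is_weak_div_iff)
  qed
  from weak_div_eq[OF L2_comb[OF U(1) V(1)] L2_comb[OF U(2) V(2)] this]
  show "(\<lambda>x. u x + c *\<^sub>R v x) \<in> Hdiv \<Omega>"
    "AE x in M. weak_div \<Omega> (\<lambda>x. u x + c *\<^sub>R v x) x = weak_div \<Omega> u x + c *\<^sub>R weak_div \<Omega> v x"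
    by auto
qed

text \<open>Inner products do not see null sets, so the almost everywhere linearity becomes an exact
  identity, the form that \<open>semi_inner\<close> demands.\<close>

lemma weak_div_comb_inner:
  assumes u: "u \<in> Hdiv \<Omega>" and v: "v \<in> Hdiv \<Omega>" and q: "q \<in> L2 \<Omega>"
  shows "L2_inner \<Omega> (weak_div \<Omega> (\<lambda>x. u x + c *\<^sub>R v x)) q
    = L2_inner \<Omega> (weak_div \<Omega> u) q + c * L2_inner \<Omega> (weak_div \<Omega> v) q"
proof -
  note C = weak_div_comb[OF u v, of c]
  have "L2_inner \<Omega> (weak_div \<Omega> (\<lambda>x. u x + c *\<^sub>R v x)) q
      = L2_inner \<Omega> (\<lambda>x. weak_div \<Omega> u x + c *\<^sub>R weak_div \<Omega> v x) q"
    using C by (intro L2_inner_cong_AE L2_comb HdivD q u v) auto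
  then show ?thesis
    by (simp only: L2_inner_comb HdivD u v q)
qed

text \<open>These fields single out one component at a time; they are the test fields that reveal
  the weak gradient in \<open>b_norm_le_rep\<close>.\<close>

lemma test_field_Hdiv:
  assumes \<phi>: "\<phi> \<in> test_functions \<Omega>"
  shows "(\<lambda>x. \<phi> x *\<^sub>R axis i 1) \<in> Hdiv \<Omega>" "AE x in M. weak_div \<Omega> (\<lambda>x. \<phi> x *\<^sub>R axis i 1) x = grad \<phi> x $ i"
proof -
  have "(\<lambda>x. \<phi> x *\<^sub>R axis i 1 :: real ^ 'n) \<in> L2 \<Omega>"
    by (intro continuous_in_L2 continuous_intros test_functions_continuous[OF \<phi>])
  moreover have "is_weak_div \<Omega> (\<lambda>x. \<phi> x *\<^sub>R axis i 1) (\<lambda>x. grad \<phi> x $ i)"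
    unfolding is_weak_div_def
    using integral_by_parts[OF _ test_functions_smooth[OF \<phi>]] by (simp add: inner_axis')
  ultimately show "(\<lambda>x. \<phi> x *\<^sub>R axis i 1) \<in> Hdiv \<Omega>"
      "AE x in M. weak_div \<Omega> (\<lambda>x. \<phi> x *\<^sub>R axis i 1) x = grad \<phi> x $ i"
    using weak_div_eq test_functions_grad_nth_L2[OF \<phi>] by blast+
qed

lemma L2_nth:
  fixes g :: "real ^ 'n \<Rightarrow> real ^ 'm"
  shows "g \<in> L2 \<Omega> \<Longrightarrow> (\<lambda>x. g x $ i) \<in> L2 \<Omega>"
proof (rule L2_dominated(1)[where C = 1 and f = g])
  assume "g \<in> L2 \<Omega>"
  moreover have "(\<lambda>y :: real ^ 'm. y $ i) \<in> borel_measurable borel"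
    by (intro borel_measurable_continuous_onI continuous_intros)
  ultimately show "(\<lambda>x. g x $ i) \<in> borel_measurable M"
    using measurable_compose[OF L2_measurable] by blast
qed (auto simp: component_le_norm_cart)

lemma integral_scaleR_nth:
  fixes g :: "real ^ 'n \<Rightarrow> real ^ 'n"
  assumes f: "f \<in> L2 \<Omega>" and g: "g \<in> L2 \<Omega>"
  shows "(LINT x|M. f x *\<^sub>R g x) $ i = L2_inner \<Omega> f (\<lambda>x. g x $ i)"
proof -
  have "integrable M (\<lambda>x. f x *\<^sub>R g x)"
  proof (rule Bochner_Integration.integrable_bound)
    have "(\<lambda>x. norm (f x)) \<in> L2 \<Omega>" "(\<lambda>x. norm (g x)) \<in> L2 \<Omega>"
      using f g by (auto simp: L2_def)
    from integrable_L2_inner[OF this] show "integrable M (\<lambda>x. norm (f x) * norm (g x))"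
      by simp
    show "(\<lambda>x. f x *\<^sub>R g x) \<in> borel_measurable M"
      by (intro borel_measurable_scaleR L2_measurable f g)
  qed simp
  from integral_bounded_linear[OF bounded_linear_vec_nth this] show ?thesis
    by (simp add: L2_inner_def)
qed

lemma is_weak_grad_iff:
  assumes r: "r \<in> L2 \<Omega>" and g: "g \<in> L2 \<Omega>"
  shows "is_weak_grad \<Omega> r g \<longleftrightarrow> (\<forall>\<phi>\<in>test_functions \<Omega>. \<forall>i.
    L2_inner \<Omega> r (\<lambda>x. grad \<phi> x $ i) = - L2_inner \<Omega> \<phi> (\<lambda>x. g x $ i))"
  unfolding is_weak_grad_def vec_eq_iff
  by (intro ball_cong refl all_cong)
    (simp add: integral_scaleR_nth r g test_functions_L2 test_functions_grad_L2)

lemma H1D: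
  assumes "r \<in> H1 \<Omega>"
  shows "r \<in> L2 \<Omega>" "weak_grad \<Omega> r \<in> L2 \<Omega>" "is_weak_grad \<Omega> r (weak_grad \<Omega> r)"
proof -
  have "\<exists>g. g \<in> L2 \<Omega> \<and> is_weak_grad \<Omega> r g"
    using assms by (auto simp: H1_def)
  from someI_ex[OF this] show "weak_grad \<Omega> r \<in> L2 \<Omega>" "is_weak_grad \<Omega> r (weak_grad \<Omega> r)"
    by (simp_all add: weak_grad_def)
  show "r \<in> L2 \<Omega>" using assms by (simp add: H1_def)
qed

lemma weak_grad_eq:
  assumes r: "r \<in> L2 \<Omega>" and g: "g \<in> L2 \<Omega>" and rg: "is_weak_grad \<Omega> r g"
  shows "r \<in> H1 \<Omega>" "AE x in M. weak_grad \<Omega> r x = g x"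
proof -
  show r1: "r \<in> H1 \<Omega>" using assms by (auto simp: H1_def)
  note D = H1D[OF r1]
  have "AE x in M. weak_grad \<Omega> r x $ i - g x $ i = 0" for i
  proof (rule fundamental_lemma)
    show "(\<lambda>x. weak_grad \<Omega> r x $ i - g x $ i) \<in> L2 \<Omega>"
      using D g by (intro L2_diff L2_nth)
    fix \<phi> assume \<phi>: "\<phi> \<in> test_functions \<Omega>"
    have "L2_inner \<Omega> (\<lambda>x. weak_grad \<Omega> r x $ i) \<phi> = L2_inner \<Omega> (\<lambda>x. g x $ i) \<phi>"
      using D(3) rg \<phi> r g D(2) by (simp add: is_weak_grad_iff L2_inner_commute)
    then show "(LINT x|M. (weak_grad \<Omega> r x $ i - g x $ i) * \<phi> x) = 0"
      using L2_inner_comb[OF L2_nth[OF D(2)] L2_nth[OF g] test_functions_L2[OF \<phi>], of i "-1" i]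
      by (simp add: L2_inner_def)
  qed
  then have "AE x in M. \<forall>i\<in>UNIV. weak_grad \<Omega> r x $ i - g x $ i = 0"
    by (intro AE_finite_allI) auto
  then show "AE x in M. weak_grad \<Omega> r x = g x"
    by (simp add: vec_eq_iff)
qed

lemma zero_H1: "(\<lambda>x. 0) \<in> H1 \<Omega>" "AE x in M. weak_grad \<Omega> (\<lambda>x. 0) x = 0"
proof -
  have "is_weak_grad \<Omega> (\<lambda>x. 0) (\<lambda>x. 0)"
    by (simp add: is_weak_grad_def)
  from weak_grad_eq[OF L2_zero L2_zero this]
  show "(\<lambda>x. 0) \<in> H1 \<Omega>" "AE x in M. weak_grad \<Omega> (\<lambda>x. 0) x = 0" by auto
qed

lemma zero_test_function: "(\<lambda>x. 0) \<in> test_functions \<Omega>"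
  by (simp add: test_functions_def C_k_const)

text \<open>The functional \<open>\<phi> \<mapsto> - (p, \<phi>)\<close> is bounded by \<open>grad \<phi>\<close>, and a field in the closure of the
  gradients that represents it has divergence \<open>p\<close>.\<close>

lemma div_surjective:
  obtains C where "C > 0" "\<And>p. p \<in> L2 \<Omega> \<Longrightarrow>
    \<exists>v\<in>Hdiv \<Omega>. (AE x in M. weak_div \<Omega> v x = p x) \<and> L2_norm \<Omega> v \<le> C * L2_norm \<Omega> p"
proof -
  obtain C where C: "C > 0" "\<And>\<phi>. \<phi> \<in> test_functions \<Omega> \<Longrightarrow> L2_norm \<Omega> \<phi> \<le> C * L2_norm \<Omega> (grad \<phi>)"
    using Friedrichs_inequality by blast
  have "\<exists>v\<in>Hdiv \<Omega>. (AE x in M. weak_div \<Omega> v x = p x) \<and> L2_norm \<Omega> v \<le> C * L2_norm \<Omega> p"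
    if p: "p \<in> L2 \<Omega>" for p
  proof -
    let ?B = "\<lambda>\<phi> \<psi>. L2_inner \<Omega> (grad \<phi>) (grad \<psi>)"
    let ?comb = "\<lambda>\<phi> c \<psi> x. \<phi> x + c * \<psi> x"
    interpret semi_inner "test_functions \<Omega>" ?comb ?B
    proof
      show "0 \<le> ?B \<phi> \<phi>" for \<phi> by (simp flip: L2_norm_sq)
      show "?B \<phi> \<psi> = ?B \<psi> \<phi>" for \<phi> \<psi> by (rule L2_inner_commute)
    qed (simp_all add: test_functions_comb grad_comb L2_inner_comb test_functions_grad_L2)
    let ?F = "\<lambda>\<phi>. - L2_inner \<Omega> p \<phi>"
    have lin: "?F (?comb \<phi> c \<psi>) = ?F \<phi> + c * ?F \<psi>"
      if "\<phi> \<in> test_functions \<Omega>" "\<psi> \<in> test_functions \<Omega>" for \<phi> \<psi> c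
      using L2_inner_comb[OF that[THEN test_functions_L2] p, of c] by (simp add: L2_inner_commute[of \<Omega> p])
    have bdd: "\<bar>?F \<phi>\<bar> \<le> (C * L2_norm \<Omega> p) * sqrt (?B \<phi> \<phi>)" if \<phi>: "\<phi> \<in> test_functions \<Omega>" for \<phi>
    proof -
      have "\<bar>?F \<phi>\<bar> \<le> L2_norm \<Omega> p * L2_norm \<Omega> \<phi>"
        using L2_Cauchy_Schwarz[OF p test_functions_L2[OF \<phi>]] by simp
      also have "\<dots> \<le> L2_norm \<Omega> p * (C * L2_norm \<Omega> (grad \<phi>))"
        by (intro mult_left_mono C \<phi> L2_norm_nonneg)
      finally show ?thesis by (simp add: L2_norm_eq mult_ac)
    qed
    have "test_functions \<Omega> \<noteq> {}" using zero_test_function by blast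
    then have "\<exists>z. Cauchy_seq z \<and> (\<forall>\<phi>\<in>test_functions \<Omega>. (\<lambda>n. ?B (z n) \<phi>) \<longlonglongrightarrow> ?F \<phi>)"
      by (rule Riesz_sequence[of ?F "C * L2_norm \<Omega> p"]) (fact lin bdd)+
    then obtain z where Cz: "Cauchy_seq z"
      and z: "\<And>\<phi>. \<phi> \<in> test_functions \<Omega> \<Longrightarrow> (\<lambda>n. ?B (z n) \<phi>) \<longlonglongrightarrow> ?F \<phi>"
      by blast
    have zt: "z n \<in> test_functions \<Omega>" for n
      using Cz by (simp add: Cauchy_seq_def)
    have "sqrt (?B (?comb (z m) (-1) (z n)) (?comb (z m) (-1) (z n)))
        = L2_norm \<Omega> (\<lambda>x. grad (z m) x - grad (z n) x)" for m n
      using grad_comb[OF zt zt, of m "-1" n] by (simp add: L2_norm_eq)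
    then have Cauchy: "\<exists>N. \<forall>m\<ge>N. \<forall>n\<ge>N. L2_norm \<Omega> (\<lambda>x. grad (z m) x - grad (z n) x) < e" if "e > 0" for e
      using Cz that by (simp add: Cauchy_seq_def)
    \<comment> \<open>The limit is formed among the gradients as vector fields; g plays the part of
      the gradient of the weak Dirichlet solution with Laplacian p.\<close>
    obtain g where g: "g \<in> L2 \<Omega>" "(\<lambda>n. L2_norm \<Omega> (\<lambda>x. grad (z n) x - g x)) \<longlonglongrightarrow> 0"
      using L2_complete[OF finite_measure_dom test_functions_grad_L2[OF zt] Cauchy] by blast
    note lim = L2_inner_tendsto[OF test_functions_grad_L2[OF zt] g(1) _ g(2)]
    have repr: "L2_inner \<Omega> g (grad \<phi>) = ?F \<phi>" if \<phi>: "\<phi> \<in> test_functions \<Omega>" for \<phi>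
      using LIMSEQ_unique[OF lim[OF test_functions_grad_L2[OF \<phi>]] z[OF \<phi>]] .
    then have div: "is_weak_div \<Omega> g p"
      by (simp add: is_weak_div_iff)
    \<comment> \<open>The representation tested with z n gives (grad (z n), g) \<le> C |p| |grad (z
      n)|; letting n tend to infinity yields |g|^2 \<le> C |p| |g|.\<close>
    have "L2_inner \<Omega> g g \<le> (C * L2_norm \<Omega> p) * (L2_norm \<Omega> g + 0)"
    proof (rule LIMSEQ_le[OF lim[OF g(1)]])
      show "(\<lambda>n. (C * L2_norm \<Omega> p) * (L2_norm \<Omega> g + L2_norm \<Omega> (\<lambda>x. grad (z n) x - g x)))
          \<longlonglongrightarrow> (C * L2_norm \<Omega> p) * (L2_norm \<Omega> g + 0)"
        by (intro tendsto_intros g)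
      have "L2_inner \<Omega> (grad (z n)) g \<le> (C * L2_norm \<Omega> p) * (L2_norm \<Omega> g + L2_norm \<Omega> (\<lambda>x. grad (z n) x - g x))" for n
      proof -
        have "L2_inner \<Omega> (grad (z n)) g \<le> (C * L2_norm \<Omega> p) * L2_norm \<Omega> (grad (z n))"
          using bdd[OF zt[of n]] repr[OF zt[of n]] by (simp add: L2_inner_commute[of \<Omega> "grad (z n)" g] L2_norm_eq)
        also have "\<dots> \<le> (C * L2_norm \<Omega> p) * (L2_norm \<Omega> g + L2_norm \<Omega> (\<lambda>x. grad (z n) x - g x))"
          using semi_inner.triangle[OF semi_inner_L2 g(1) L2_diff[OF test_functions_grad_L2[OF zt] g(1)], of 1 n] C(1)
          by (intro mult_left_mono mult_nonneg_nonneg L2_norm_nonneg) (simp_all add: L2_norm_eq)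
        finally show ?thesis .
      qed
      then show "\<exists>N. \<forall>n\<ge>N. L2_inner \<Omega> (grad (z n)) g
          \<le> (C * L2_norm \<Omega> p) * (L2_norm \<Omega> g + L2_norm \<Omega> (\<lambda>x. grad (z n) x - g x))"
        by blast
    qed
    then have "L2_norm \<Omega> g * L2_norm \<Omega> g \<le> L2_norm \<Omega> g * (C * L2_norm \<Omega> p)"
      by (simp add: L2_norm_sq[symmetric] power2_eq_square mult_ac)
    then have "L2_norm \<Omega> g \<le> C * L2_norm \<Omega> p"
      using L2_norm_nonneg[of \<Omega> g] L2_norm_nonneg[of \<Omega> p] C(1)
      by (cases "L2_norm \<Omega> g = 0") (auto simp: mult_le_cancel_left)
    then show ?thesis
      using weak_div_eq[OF g(1) p div] by blast
  qed
  with C(1) show thesis by (rule that)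
qed

end

section \<open>The mixed problem\<close>

lemma dual_spaceD:
  assumes "F \<in> dual_space X N"
  shows "\<And>u v c. \<lbrakk>u \<in> X; v \<in> X; (\<lambda>x. c *\<^sub>R v x) \<in> X\<rbrakk> \<Longrightarrow> F (\<lambda>x. u x + c *\<^sub>R v x) = F u + c * F v"
    "\<And>v c. v \<in> X \<Longrightarrow> F (\<lambda>x. c *\<^sub>R v x) = c * F v"
    "\<exists>B. \<forall>v\<in>X. \<bar>F v\<bar> \<le> B * N v"
proof -
  have add: "\<forall>v\<in>X. \<forall>w\<in>X. F (\<lambda>x. v x + w x) = F v + F w"
    and scale: "\<forall>c. \<forall>v\<in>X. F (\<lambda>x. c *\<^sub>R v x) = c * F v"
    and bound: "\<exists>B. \<forall>v\<in>X. \<bar>F v\<bar> \<le> B * N v"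
    using assms unfolding dual_space_def by blast+
  show S: "F (\<lambda>x. c *\<^sub>R v x) = c * F v" if "v \<in> X" for v c
    using scale that by blast
  show "F (\<lambda>x. u x + c *\<^sub>R v x) = F u + c * F v" if "u \<in> X" "v \<in> X" "(\<lambda>x. c *\<^sub>R v x) \<in> X" for u v c
    unfolding S[OF that(2), symmetric] using that(1,3) by (rule add[rule_format])
  show "\<exists>B. \<forall>v\<in>X. \<bar>F v\<bar> \<le> B * N v" by (rule bound)
qed

locale coefficient = bounded_open \<Omega> for \<Omega> :: "(real ^ 'n) set" +
  fixes K :: "real ^ 'n \<Rightarrow> real ^ 'n ^ 'n"
  assumes admissible: "admissible_coefficient \<Omega> K"
begin

section \<open>Measurability and bounds of the weights\<close>

lemma coefficient_bounds:
  obtains \<kappa> m where "0 < \<kappa>" "\<kappa> \<le> m"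
    "AE x in M. transpose (K x) = K x \<and> norm (K x) \<le> m \<and> (\<forall>\<xi>. \<kappa> * (norm \<xi>)\<^sup>2 \<le> \<xi> \<bullet> (K x *v \<xi>))"
proof -
  obtain m \<kappa> where 1: "AE x in M. transpose (K x) = K x" "AE x in M. norm (K x) \<le> m" "\<kappa> > 0"
    "AE x in M. \<forall>\<xi>. \<kappa> * (norm \<xi>)\<^sup>2 \<le> \<xi> \<bullet> (K x *v \<xi>)"
    using admissible unfolding admissible_coefficient_def by auto
  \<comment> \<open>The maximum guarantees \<kappa> \<le> m, a premise of the matrix lemmas.\<close>
  have "AE x in M. transpose (K x) = K x \<and> norm (K x) \<le> max m \<kappa> \<and> (\<forall>\<xi>. \<kappa> * (norm \<xi>)\<^sup>2 \<le> \<xi> \<bullet> (K x *v \<xi>))"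
    using 1(1,2,4) by eventually_elim auto
  with 1(3) show thesis by (intro that[of \<kappa> "max m \<kappa>"]) auto
qed

lemma K_measurable: "K \<in> borel_measurable M"
  using admissible by (simp add: admissible_coefficient_def)

lemma matrix_inv_measurable:
  "A \<in> borel_measurable M \<Longrightarrow> (\<lambda>x. matrix_inv (A x :: real ^ 'n ^ 'n)) \<in> borel_measurable M"
  using measurable_compose[OF _ borel_measurable_matrix_inv] by blast

lemma matrix_vector_measurable:
  fixes A :: "real ^ 'n \<Rightarrow> real ^ 'n ^ 'n"
  assumes "A \<in> borel_measurable M" "f \<in> borel_measurable M"
  shows "(\<lambda>x. A x *v f x) \<in> borel_measurable M"
  by (rule borel_measurable_continuous_Pair[OF assms])
    (intro bounded_bilinear.continuous_on[OF bounded_bilinear_matrix_vector_mult] continuous_intros)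

text \<open>A definite description gives no measurability; by \<open>matrix_sqrt_limit\<close> the
  square root is almost everywhere a limit of continuous functions of \<open>K x\<close>.\<close>

lemma sqrt_K_measurable: "(\<lambda>x. matrix_sqrt (K x)) \<in> borel_measurable M"
proof -
  obtain \<kappa> m where km: "0 < \<kappa>" "\<kappa> \<le> m"
    "AE x in M. transpose (K x) = K x \<and> norm (K x) \<le> m \<and> (\<forall>\<xi>. \<kappa> * (norm \<xi>)\<^sup>2 \<le> \<xi> \<bullet> (K x *v \<xi>))"
    by (rule coefficient_bounds)
  let ?f = "\<lambda>k A. (m / sqrt \<kappa>) *\<^sub>R (mat 1 - sqrt_iter (mat 1 - (\<kappa> / m\<^sup>2) *\<^sub>R A) k) :: real ^ 'n ^ 'n"
  have "continuous_on UNIV (?f k)" for k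
    by (intro continuous_intros continuous_on_compose2[OF continuous_on_sqrt_iter]) auto
  then have "(\<lambda>x. ?f k (K x)) \<in> borel_measurable M" for k
    by (intro measurable_compose[OF K_measurable] borel_measurable_continuous_onI)
  then have "(\<lambda>x. lim (\<lambda>k. ?f k (K x))) \<in> borel_measurable M"
    by (rule borel_measurable_lim_metric)
  then show ?thesis
  proof (rule borel_measurable_AE_dom)
    show "AE x in M. lim (\<lambda>k. ?f k (K x)) = matrix_sqrt (K x)"
      using km(3) by eventually_elim (intro limI matrix_sqrt_limit(1) km; blast)
  qed
qed

text \<open>The field K^(-1/2) v: its norm is the flux part of \<open>V_norm\<close>, and by
  \<open>a_form_eq\<close> the form a is the L2 inner product of such fields.\<close>

definition W :: "(real ^ 'n \<Rightarrow> real ^ 'n) \<Rightarrow> real ^ 'n \<Rightarrow> real ^ 'n" where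
  "W v x = matrix_inv (matrix_sqrt (K x)) *v v x"

lemma W_comb: "W (\<lambda>x. u x + c *\<^sub>R v x) = (\<lambda>x. W u x + c *\<^sub>R W v x)"
  by (simp add: W_def fun_eq_iff matrix_vector_simps)

lemma W_measurable: "f \<in> borel_measurable M \<Longrightarrow> W f \<in> borel_measurable M"
  unfolding W_def[abs_def] by (intro matrix_vector_measurable matrix_inv_measurable sqrt_K_measurable)

text \<open>Follows pointwise from the spectral bounds. The constant depends on \<open>K\<close>, so
  it may enter qualitative arguments only.\<close>

lemma W_bounds:
  obtains c where "c > 0" "\<And>v. v \<in> L2 \<Omega> \<Longrightarrow> W v \<in> L2 \<Omega>"
    "\<And>v. v \<in> L2 \<Omega> \<Longrightarrow> L2_norm \<Omega> (W v) \<le> c * L2_norm \<Omega> v"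
    "\<And>v. v \<in> L2 \<Omega> \<Longrightarrow> L2_norm \<Omega> v \<le> c * L2_norm \<Omega> (W v)"
proof -
  obtain \<kappa> m where km: "0 < \<kappa>" "\<kappa> \<le> m"
    "AE x in M. transpose (K x) = K x \<and> norm (K x) \<le> m \<and> (\<forall>\<xi>. \<kappa> * (norm \<xi>)\<^sup>2 \<le> \<xi> \<bullet> (K x *v \<xi>))"
    by (rule coefficient_bounds)
  have le: "L2_norm \<Omega> f \<le> c * L2_norm \<Omega> g"
    if "L2_inner \<Omega> f f \<le> c\<^sup>2 * L2_inner \<Omega> g g" "0 \<le> c" for f g :: "real ^ 'n \<Rightarrow> real ^ 'n" and c
    using that by - (rule power2_le_imp_le[of "L2_norm \<Omega> f" "c * L2_norm \<Omega> g"],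
      simp_all add: power_mult_distrib L2_norm_sq L2_norm_nonneg)
  have 1: "AE x in M. norm (W v x) \<le> (1 / sqrt \<kappa>) * norm (v x)" for v
    using km(3) unfolding W_def
    by eventually_elim (rule matrix_sqrt_properties(3)[OF _ _ km(1,2)]; blast)
  have 2: "AE x in M. norm (v x) \<le> sqrt m * norm (W v x)" for v
    using km(3) unfolding W_def
    by eventually_elim (rule matrix_sqrt_properties(4)[OF _ _ km(1,2)]; blast)
  define c where "c = max (1 / sqrt \<kappa>) (sqrt m)"
  show thesis
  proof
    show "c > 0" using km by (auto simp: c_def less_max_iff_disj)
    fix v :: "real ^ 'n \<Rightarrow> real ^ 'n" assume v: "v \<in> L2 \<Omega>"
    note D1 = L2_dominated[OF v W_measurable[OF L2_measurable[OF v]] 1]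
    show W: "W v \<in> L2 \<Omega>" by (rule D1)
    note D2 = L2_dominated(2)[OF W L2_measurable[OF v] 2]
    have "L2_norm \<Omega> (W v) \<le> (1 / sqrt \<kappa>) * L2_norm \<Omega> v"
      using D1(2) km(1) by (intro le) auto
    also have "\<dots> \<le> c * L2_norm \<Omega> v"
      by (intro mult_right_mono L2_norm_nonneg) (simp add: c_def)
    finally show "L2_norm \<Omega> (W v) \<le> c * L2_norm \<Omega> v" .
    have "L2_norm \<Omega> v \<le> sqrt m * L2_norm \<Omega> (W v)"
      using D2 km by (intro le) auto
    also have "\<dots> \<le> c * L2_norm \<Omega> (W v)"
      by (intro mult_right_mono L2_norm_nonneg) (simp add: c_def)
    finally show "L2_norm \<Omega> v \<le> c * L2_norm \<Omega> (W v)" .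
  qed
qed

lemma W_L2: "v \<in> L2 \<Omega> \<Longrightarrow> W v \<in> L2 \<Omega>"
  using W_bounds by blast

lemma inv_K_L2:
  assumes v: "v \<in> L2 \<Omega>"
  shows "(\<lambda>x. matrix_inv (K x) *v v x) \<in> L2 \<Omega>"
proof -
  obtain \<kappa> m where km: "0 < \<kappa>" "\<kappa> \<le> m"
    "AE x in M. transpose (K x) = K x \<and> norm (K x) \<le> m \<and> (\<forall>\<xi>. \<kappa> * (norm \<xi>)\<^sup>2 \<le> \<xi> \<bullet> (K x *v \<xi>))"
    by (rule coefficient_bounds)
  show ?thesis
  proof (rule L2_dominated(1)[OF v])
    show "(\<lambda>x. matrix_inv (K x) *v v x) \<in> borel_measurable M"
      by (intro matrix_vector_measurable matrix_inv_measurable K_measurable L2_measurable v)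
    show "AE x in M. norm (matrix_inv (K x) *v v x) \<le> (1 / \<kappa>) * norm (v x)"
      using km(3) by eventually_elim (rule matrix_sqrt_properties(6)[OF _ _ km(1,2)]; blast)
  qed
qed

lemma sqrt_K_L2:
  assumes v: "v \<in> L2 \<Omega>"
  shows "(\<lambda>x. matrix_sqrt (K x) *v v x) \<in> L2 \<Omega>"
proof -
  obtain \<kappa> m where km: "0 < \<kappa>" "\<kappa> \<le> m"
    "AE x in M. transpose (K x) = K x \<and> norm (K x) \<le> m \<and> (\<forall>\<xi>. \<kappa> * (norm \<xi>)\<^sup>2 \<le> \<xi> \<bullet> (K x *v \<xi>))"
    by (rule coefficient_bounds)
  show ?thesis
  proof (rule L2_dominated(1)[OF v])
    show "(\<lambda>x. matrix_sqrt (K x) *v v x) \<in> borel_measurable M"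
      by (intro matrix_vector_measurable sqrt_K_measurable L2_measurable v)
    show "AE x in M. norm (matrix_sqrt (K x) *v v x) \<le> sqrt m * norm (v x)"
      using km(3) by eventually_elim (rule matrix_sqrt_properties(1)[OF _ _ km(1,2)]; blast)
  qed
qed

lemma sqrt_K_inv_K: "AE x in M. matrix_sqrt (K x) *v (matrix_inv (K x) *v v x) = W v x"
proof -
  obtain \<kappa> m where km: "0 < \<kappa>" "\<kappa> \<le> m"
    "AE x in M. transpose (K x) = K x \<and> norm (K x) \<le> m \<and> (\<forall>\<xi>. \<kappa> * (norm \<xi>)\<^sup>2 \<le> \<xi> \<bullet> (K x *v \<xi>))"
    by (rule coefficient_bounds)
  show ?thesis
    using km(3) unfolding W_def by eventually_elim (rule matrix_sqrt_properties(5)[OF _ _ km(1,2)]; blast)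
qed

lemma a_form_eq:
  assumes u: "u \<in> L2 \<Omega>" and v: "v \<in> L2 \<Omega>"
  shows "a_form \<Omega> K u v = L2_inner \<Omega> (W u) (W v)"
proof -
  obtain \<kappa> m where km: "0 < \<kappa>" "\<kappa> \<le> m"
    "AE x in M. transpose (K x) = K x \<and> norm (K x) \<le> m \<and> (\<forall>\<xi>. \<kappa> * (norm \<xi>)\<^sup>2 \<le> \<xi> \<bullet> (K x *v \<xi>))"
    by (rule coefficient_bounds)
  show ?thesis
    unfolding a_form_def L2_inner_def
  proof (rule integral_cong_AE)
    show "AE x in M. (matrix_inv (K x) *v u x) \<bullet> v x = W u x \<bullet> W v x"
      using km(3) unfolding W_def by eventually_elim (rule matrix_sqrt_properties(2)[OF _ _ km(1,2)]; blast)
    show "(\<lambda>x. (matrix_inv (K x) *v u x) \<bullet> v x) \<in> borel_measurable M"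
      by (intro borel_measurable_inner L2_measurable inv_K_L2 u v)
    show "(\<lambda>x. W u x \<bullet> W v x) \<in> borel_measurable M"
      by (intro borel_measurable_inner L2_measurable W_L2 u v)
  qed
qed

section \<open>Spaces, norms and forms for a fixed coefficient\<close>

lemma V_eq: "V \<Omega> K = Hdiv \<Omega>"
  using W_L2 HdivD(1) by (auto simp: V_def W_def[abs_def])

lemma weighted_H1_eq: "weighted_H1 \<Omega> K = H1 \<Omega>"
  using sqrt_K_L2 H1D(2) by (auto simp: weighted_H1_def)

text \<open>The choice r = 0 already exhausts L2. For a fixed coefficient the spaces are thus the
  unweighted ones, and \<open>K\<close> is felt through the norms.\<close>

lemma Qb_eq: "Q\<^sub>b \<Omega> K = L2 \<Omega>"
proof
  show "Q\<^sub>b \<Omega> K \<subseteq> L2 \<Omega>"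
    using H1D(1) by (auto simp: Q\<^sub>b_def weighted_H1_eq intro: L2_add)
  show "L2 \<Omega> \<subseteq> Q\<^sub>b \<Omega> K"
    using zero_H1(1) by (force simp: Q\<^sub>b_def weighted_H1_eq)
qed

lemma Q_eq: "Q \<Omega> K = L2 \<Omega>"
  by (simp add: Q_def Qb_eq)

lemma b_form_eq: "b_form \<Omega> v q = L2_inner \<Omega> (weak_div \<Omega> v) q"
  by (simp add: b_form_def L2_inner_def)

lemma c_form_eq: "c_form \<Omega> p q = L2_inner \<Omega> p q"
  by (simp add: c_form_def L2_inner_def)

lemma c_norm_eq: "c_norm \<Omega> p = L2_norm \<Omega> p"
  by (simp add: c_norm_def c_form_eq L2_norm_eq)

definition V_inner :: "(real ^ 'n \<Rightarrow> real ^ 'n) \<Rightarrow> (real ^ 'n \<Rightarrow> real ^ 'n) \<Rightarrow> real" where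
  "V_inner u v = L2_inner \<Omega> (W u) (W v) + L2_inner \<Omega> (weak_div \<Omega> u) (weak_div \<Omega> v)"

lemma V_norm_eq: "V_norm \<Omega> K v = sqrt (V_inner v v)"
  by (simp add: V_norm_def V_inner_def L2_norm_sq W_def[abs_def])

lemma V_inner_nonneg: "0 \<le> V_inner v v"
  unfolding V_inner_def by (simp flip: L2_norm_sq)

lemma V_norm_sq: "(V_norm \<Omega> K v)\<^sup>2 = V_inner v v"
  by (simp add: V_norm_eq V_inner_nonneg)

lemma V_norm_nonneg: "0 \<le> V_norm \<Omega> K v"
  by (simp add: V_norm_eq V_inner_nonneg)

sublocale V: semi_inner "Hdiv \<Omega>" "\<lambda>u c v x. u x + c *\<^sub>R v x" V_inner
proof
  show "V_inner (\<lambda>x. u x + c *\<^sub>R v x) w = V_inner u w + c * V_inner v w"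
    if "u \<in> Hdiv \<Omega>" "v \<in> Hdiv \<Omega>" "w \<in> Hdiv \<Omega>" for u v w c
    using that by (simp add: V_inner_def W_comb L2_inner_comb W_L2 HdivD weak_div_comb_inner algebra_simps)
  show "V_inner u v = V_inner v u" for u v
    by (simp add: V_inner_def L2_inner_commute)
qed (auto simp: V_inner_nonneg weak_div_comb)

lemma W_le_V_norm: "L2_norm \<Omega> (W v) \<le> V_norm \<Omega> K v"
  unfolding V_norm_eq L2_norm_eq V_inner_def by (simp flip: L2_norm_sq)

lemma div_le_V_norm: "L2_norm \<Omega> (weak_div \<Omega> v) \<le> V_norm \<Omega> K v"
  unfolding V_norm_eq L2_norm_eq V_inner_def by (simp flip: L2_norm_sq)

text \<open>The weak divergence is a closed operator. L2 limits u of the fields and w of the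
  divergences exist by completeness, and the defining identity passes to the limit, so w is the
  divergence of u.\<close>

lemma Hdiv_complete:
  assumes Cz: "V.Cauchy_seq z"
  shows "\<exists>u\<in>Hdiv \<Omega>. \<forall>y\<in>Hdiv \<Omega>. (\<lambda>n. V_inner (z n) y) \<longlonglongrightarrow> V_inner u y"
proof -
  obtain c where c: "c > 0" "\<And>v. v \<in> L2 \<Omega> \<Longrightarrow> L2_norm \<Omega> (W v) \<le> c * L2_norm \<Omega> v"
    "\<And>v. v \<in> L2 \<Omega> \<Longrightarrow> L2_norm \<Omega> v \<le> c * L2_norm \<Omega> (W v)"
    using W_bounds by metis
  have z: "z n \<in> Hdiv \<Omega>" for n
    using Cz by (simp add: V.Cauchy_seq_def)
  note zD = HdivD[OF z]
  let ?d = "\<lambda>m n x. z m x + (-1) *\<^sub>R z n x"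
  have Cauchy: "\<exists>N. \<forall>m\<ge>N. \<forall>n\<ge>N. V_norm \<Omega> K (?d m n) < e" if "e > 0" for e
    using Cz that by (simp add: V.Cauchy_seq_def V_norm_eq)
  have C1: "\<exists>N. \<forall>m\<ge>N. \<forall>n\<ge>N. L2_norm \<Omega> (\<lambda>x. z m x - z n x) < e" if "e > 0" for e
  proof -
    obtain N where N: "\<And>m n. \<lbrakk>m \<ge> N; n \<ge> N\<rbrakk> \<Longrightarrow> V_norm \<Omega> K (?d m n) < e / c"
      using Cauchy[of "e / c"] \<open>e > 0\<close> c(1) by auto
    have "L2_norm \<Omega> (\<lambda>x. z m x - z n x) < e" if "m \<ge> N" "n \<ge> N" for m n
    proof -
      have "L2_norm \<Omega> (\<lambda>x. z m x - z n x) \<le> c * V_norm \<Omega> K (?d m n)"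
        using c(3)[OF L2_comb[OF zD(1) zD(1)], of m "-1" n]
          mult_left_mono[OF W_le_V_norm[of "?d m n"], of c] c(1) by (simp add: order_trans)
      also have "\<dots> < e"
        using N[OF that] c(1) by (simp add: field_simps)
      finally show ?thesis .
    qed
    then show ?thesis by blast
  qed
  have eq: "L2_norm \<Omega> (\<lambda>x. weak_div \<Omega> (z m) x - weak_div \<Omega> (z n) x) = L2_norm \<Omega> (weak_div \<Omega> (?d m n))" for m n
  proof -
    note D = weak_div_comb[OF z z, of m "-1" n]
    have "L2_inner \<Omega> (weak_div \<Omega> (?d m n)) (weak_div \<Omega> (?d m n))
        = L2_inner \<Omega> (\<lambda>x. weak_div \<Omega> (z m) x + (-1) *\<^sub>R weak_div \<Omega> (z n) x)
                     (\<lambda>x. weak_div \<Omega> (z m) x + (-1) *\<^sub>R weak_div \<Omega> (z n) x)"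
      by (intro L2_inner_cong_AE HdivD(2) D L2_comb z)
    then show ?thesis by (simp add: L2_norm_eq)
  qed
  have C2: "\<exists>N. \<forall>m\<ge>N. \<forall>n\<ge>N. L2_norm \<Omega> (\<lambda>x. weak_div \<Omega> (z m) x - weak_div \<Omega> (z n) x) < e" if "e > 0" for e
    using Cauchy[OF that] div_le_V_norm unfolding eq by (meson le_less_trans)
  obtain u where u: "u \<in> L2 \<Omega>" "(\<lambda>n. L2_norm \<Omega> (\<lambda>x. z n x - u x)) \<longlonglongrightarrow> 0"
    using L2_complete[OF finite_measure_dom zD(1) C1] by blast
  obtain w where w: "w \<in> L2 \<Omega>" "(\<lambda>n. L2_norm \<Omega> (\<lambda>x. weak_div \<Omega> (z n) x - w x)) \<longlonglongrightarrow> 0"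
    using L2_complete[OF finite_measure_dom zD(2) C2] by blast
  note lim_u = L2_inner_tendsto[OF zD(1) u(1) _ u(2)] and lim_w = L2_inner_tendsto[OF zD(2) w(1) _ w(2)]
  have "is_weak_div \<Omega> u w"
    unfolding is_weak_div_iff
  proof
    fix \<phi> assume \<phi>: "\<phi> \<in> test_functions \<Omega>"
    have "L2_inner \<Omega> (z n) (grad \<phi>) = - L2_inner \<Omega> (weak_div \<Omega> (z n)) \<phi>" for n
      using zD(3) \<phi> by (simp add: is_weak_div_iff)
    then have "(\<lambda>n. L2_inner \<Omega> (z n) (grad \<phi>)) \<longlonglongrightarrow> - L2_inner \<Omega> w \<phi>"
      using tendsto_minus[OF lim_w[OF test_functions_L2[OF \<phi>]]] by simp
    then show "L2_inner \<Omega> u (grad \<phi>) = - L2_inner \<Omega> w \<phi>"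
      using lim_u[OF test_functions_grad_L2[OF \<phi>]] LIMSEQ_unique by blast
  qed
  from weak_div_eq[OF u(1) w(1) this]
  have uH: "u \<in> Hdiv \<Omega>" and uw: "AE x in M. weak_div \<Omega> u x = w x" .
  have "(\<lambda>n. L2_norm \<Omega> (\<lambda>x. W (z n) x - W u x)) \<longlonglongrightarrow> 0"
  proof (rule Lim_null_comparison)
    have "L2_norm \<Omega> (\<lambda>x. W (z n) x - W u x) \<le> c * L2_norm \<Omega> (\<lambda>x. z n x - u x)" for n
      using c(2)[OF L2_diff[OF zD(1) u(1)], of n] W_comb[of "z n" "-1" u] by simp
    then show "\<forall>\<^sub>F n in sequentially. norm (L2_norm \<Omega> (\<lambda>x. W (z n) x - W u x)) \<le> c * L2_norm \<Omega> (\<lambda>x. z n x - u x)"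
      by (simp add: L2_norm_nonneg)
    show "(\<lambda>n. c * L2_norm \<Omega> (\<lambda>x. z n x - u x)) \<longlonglongrightarrow> 0"
      by (rule tendsto_mult_right_zero[OF u(2)])
  qed
  note lim_W = L2_inner_tendsto[OF W_L2[OF zD(1)] W_L2[OF u(1)] _ this]
  have "(\<lambda>n. V_inner (z n) y) \<longlonglongrightarrow> V_inner u y" if y: "y \<in> Hdiv \<Omega>" for y
  proof -
    note yD = HdivD[OF y]
    have "L2_inner \<Omega> (weak_div \<Omega> u) (weak_div \<Omega> y) = L2_inner \<Omega> w (weak_div \<Omega> y)"
      using uw by (intro L2_inner_cong_AE HdivD uH y w) auto
    then show ?thesis
      unfolding V_inner_def
      using tendsto_add[OF lim_W[OF W_L2[OF yD(1)]] lim_w[OF yD(2)]] by simp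
  qed
  with uH show ?thesis by blast
qed

lemma zero_Hdiv: "(\<lambda>x. 0) \<in> Hdiv \<Omega>"
  by (rule weak_div_eq(1)[OF L2_zero L2_zero]) (simp add: is_weak_div_def)

section \<open>Riesz representatives of pressures and the b-norm\<close>

lemma Riesz_Hdiv:
  assumes "\<And>u v c. \<lbrakk>u \<in> Hdiv \<Omega>; v \<in> Hdiv \<Omega>\<rbrakk> \<Longrightarrow> F (\<lambda>x. u x + c *\<^sub>R v x) = F u + c * F v"
    and "\<And>v. v \<in> Hdiv \<Omega> \<Longrightarrow> \<bar>F v\<bar> \<le> B * V_norm \<Omega> K v"
  shows "\<exists>u\<in>Hdiv \<Omega>. \<forall>v\<in>Hdiv \<Omega>. V_inner u v = F v"
proof (rule V.Riesz_representation)
  show "Hdiv \<Omega> \<noteq> {}" using zero_Hdiv by blast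
  show "\<bar>F v\<bar> \<le> B * sqrt (V_inner v v)" if "v \<in> Hdiv \<Omega>" for v
    using assms(2)[OF that] by (simp add: V_norm_eq)
qed (use assms(1) Hdiv_complete in auto)

text \<open>The field \<open>rep p\<close> attains the supremum in the inf-sup condition for \<open>p\<close>.\<close>

definition rep :: "(real ^ 'n \<Rightarrow> real) \<Rightarrow> real ^ 'n \<Rightarrow> real ^ 'n" where
  "rep p = (SOME u. u \<in> Hdiv \<Omega> \<and> (\<forall>v\<in>Hdiv \<Omega>. V_inner u v = L2_inner \<Omega> p (weak_div \<Omega> v)))"

lemma rep:
  assumes p: "p \<in> L2 \<Omega>"
  shows "rep p \<in> Hdiv \<Omega>" "\<And>v. v \<in> Hdiv \<Omega> \<Longrightarrow> V_inner (rep p) v = L2_inner \<Omega> p (weak_div \<Omega> v)"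
proof -
  have "\<exists>u\<in>Hdiv \<Omega>. \<forall>v\<in>Hdiv \<Omega>. V_inner u v = L2_inner \<Omega> p (weak_div \<Omega> v)"
  proof (rule Riesz_Hdiv)
    show "L2_inner \<Omega> p (weak_div \<Omega> (\<lambda>x. u x + c *\<^sub>R v x))
        = L2_inner \<Omega> p (weak_div \<Omega> u) + c * L2_inner \<Omega> p (weak_div \<Omega> v)"
      if "u \<in> Hdiv \<Omega>" "v \<in> Hdiv \<Omega>" for u v c
      using weak_div_comb_inner[OF that p] by (simp add: L2_inner_commute[of \<Omega> p])
    show "\<bar>L2_inner \<Omega> p (weak_div \<Omega> v)\<bar> \<le> L2_norm \<Omega> p * V_norm \<Omega> K v" if "v \<in> Hdiv \<Omega>" for v
      using L2_Cauchy_Schwarz[OF p HdivD(2)[OF that]]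
        mult_left_mono[OF div_le_V_norm[of v] L2_norm_nonneg[of \<Omega> p]] by linarith
  qed
  then have "\<exists>u. u \<in> Hdiv \<Omega> \<and> (\<forall>v\<in>Hdiv \<Omega>. V_inner u v = L2_inner \<Omega> p (weak_div \<Omega> v))"
    by blast
  from someI_ex[OF this]
  show "rep p \<in> Hdiv \<Omega>" "\<And>v. v \<in> Hdiv \<Omega> \<Longrightarrow> V_inner (rep p) v = L2_inner \<Omega> p (weak_div \<Omega> v)"
    unfolding rep_def by auto
qed

text \<open>A field v with divergence p gives |p|^2 = (rep p, v) \<le> |rep p| |v| in the V inner
  product, and |v| is bounded by a multiple of |p|. The bound depends on \<open>K\<close>; it
  supplies coercivity for existence, in particular when \<alpha> = 0.\<close>

lemma rep_bounded_below:
  obtains \<beta> where "\<beta> > 0" "\<And>p. p \<in> L2 \<Omega> \<Longrightarrow> \<beta> * L2_inner \<Omega> p p \<le> V_inner (rep p) (rep p)"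
proof -
  obtain c where c: "c > 0" "\<And>v. v \<in> L2 \<Omega> \<Longrightarrow> L2_norm \<Omega> (W v) \<le> c * L2_norm \<Omega> v"
    using W_bounds by metis
  obtain C where C: "C > 0" "\<And>p. p \<in> L2 \<Omega> \<Longrightarrow>
      \<exists>v\<in>Hdiv \<Omega>. (AE x in M. weak_div \<Omega> v x = p x) \<and> L2_norm \<Omega> v \<le> C * L2_norm \<Omega> p"
    using div_surjective by blast
  \<comment> \<open>(c C)^2 accounts for the weighted flux of the preimage and 1 for its divergence,
    which is p.\<close>
  define D where "D = (c * C)\<^sup>2 + 1"
  have D: "D > 0" unfolding D_def by (simp add: add_nonneg_pos)
  have main: "L2_inner \<Omega> p p \<le> D * V_inner (rep p) (rep p)" if p: "p \<in> L2 \<Omega>" for p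
  proof -
    obtain v where v: "v \<in> Hdiv \<Omega>" "AE x in M. weak_div \<Omega> v x = p x" "L2_norm \<Omega> v \<le> C * L2_norm \<Omega> p"
      using C(2)[OF p] by blast
    note vD = HdivD[OF v(1)]
    have "L2_norm \<Omega> (W v) \<le> c * (C * L2_norm \<Omega> p)"
      using c(2)[OF vD(1)] mult_left_mono[OF v(3), of c] c(1) by linarith
    then have "(L2_norm \<Omega> (W v))\<^sup>2 \<le> (c * (C * L2_norm \<Omega> p))\<^sup>2"
      by (intro power_mono L2_norm_nonneg)
    moreover have "L2_inner \<Omega> (weak_div \<Omega> v) (weak_div \<Omega> v) = L2_inner \<Omega> p p"
      by (intro L2_inner_cong_AE vD p v)
    ultimately have V: "V_inner v v \<le> D * L2_inner \<Omega> p p"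
      by (simp add: V_inner_def D_def power_mult_distrib L2_norm_sq algebra_simps)
    have "L2_inner \<Omega> p p = L2_inner \<Omega> p (weak_div \<Omega> v)"
      using v(2) by (intro L2_inner_cong_AE vD p) auto
    also have "\<dots> = V_inner (rep p) v" by (simp add: rep p v)
    also have "\<dots> \<le> sqrt (V_inner (rep p) (rep p)) * sqrt (V_inner v v)"
      using V.Cauchy_Schwarz[OF rep(1)[OF p] v(1)] by linarith
    also have "\<dots> \<le> sqrt (V_inner (rep p) (rep p)) * sqrt (D * L2_inner \<Omega> p p)"
      using V by (intro mult_left_mono real_sqrt_le_mono) (auto simp: V_inner_nonneg)
    also have "\<dots> = sqrt (D * V_inner (rep p) (rep p)) * L2_norm \<Omega> p"
      by (simp add: real_sqrt_mult L2_norm_eq)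
    finally have "L2_norm \<Omega> p * L2_norm \<Omega> p \<le> sqrt (D * V_inner (rep p) (rep p)) * L2_norm \<Omega> p"
      by (simp add: power2_eq_square flip: L2_norm_sq)
    then have "L2_norm \<Omega> p \<le> sqrt (D * V_inner (rep p) (rep p))"
      using L2_norm_nonneg[of \<Omega> p] D V_inner_nonneg
      by (cases "L2_norm \<Omega> p = 0") (auto simp: mult_le_cancel_right)
    then show ?thesis by (simp add: L2_norm_eq)
  qed
  show thesis
  proof
    show "1 / D > 0" using D by simp
    show "1 / D * L2_inner \<Omega> p p \<le> V_inner (rep p) (rep p)" if "p \<in> L2 \<Omega>" for p
      using main[OF that] D by (simp add: field_simps)
  qed
qed

lemma b_norm_bdd_below:
  "bdd_below ((\<lambda>r. (L2_norm \<Omega> (\<lambda>x. p x - r x))\<^sup>2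
      + (L2_norm \<Omega> (\<lambda>x. matrix_sqrt (K x) *v weak_grad \<Omega> r x))\<^sup>2) ` weighted_H1 \<Omega> K)"
  by (rule bdd_belowI2[of _ 0]) simp

lemma b_norm_le:
  assumes "r \<in> H1 \<Omega>"
    and "(L2_norm \<Omega> (\<lambda>x. p x - r x))\<^sup>2 + (L2_norm \<Omega> (\<lambda>x. matrix_sqrt (K x) *v weak_grad \<Omega> r x))\<^sup>2 \<le> B\<^sup>2" "0 \<le> B"
  shows "b_norm \<Omega> K p \<le> B"
proof -
  have "(INF r \<in> weighted_H1 \<Omega> K. (L2_norm \<Omega> (\<lambda>x. p x - r x))\<^sup>2
      + (L2_norm \<Omega> (\<lambda>x. matrix_sqrt (K x) *v weak_grad \<Omega> r x))\<^sup>2) \<le> B\<^sup>2"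
    using assms by (intro cINF_lower2[OF b_norm_bdd_below]) (auto simp: weighted_H1_eq)
  then show ?thesis
    unfolding b_norm_def using assms(3) by (intro real_le_lsqrt) auto
qed

lemma b_norm_nonneg: "0 \<le> b_norm \<Omega> K p"
  unfolding b_norm_def
  by (intro real_sqrt_ge_zero cINF_greatest) (use zero_H1(1) in \<open>auto simp: weighted_H1_eq\<close>)

text \<open>The competitor is r = 0; its chosen weak gradient vanishes only almost everywhere, hence
  the detour over \<open>L2_inner_cong_AE\<close>.\<close>

lemma b_norm_le_L2_norm:
  assumes "p \<in> L2 \<Omega>"
  shows "b_norm \<Omega> K p \<le> L2_norm \<Omega> p"
proof (rule b_norm_le[OF zero_H1(1)])
  have "L2_inner \<Omega> (\<lambda>x. matrix_sqrt (K x) *v weak_grad \<Omega> (\<lambda>x. 0) x)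
      (\<lambda>x. matrix_sqrt (K x) *v weak_grad \<Omega> (\<lambda>x. 0) x) = L2_inner \<Omega> (\<lambda>x. 0 :: real ^ 'n) (\<lambda>x. 0)"
  proof (intro L2_inner_cong_AE sqrt_K_L2 H1D zero_H1 L2_zero)
    show "AE x in M. matrix_sqrt (K x) *v weak_grad \<Omega> (\<lambda>x. 0) x = 0"
      using zero_H1(2) by eventually_elim simp
    then show "AE x in M. matrix_sqrt (K x) *v weak_grad \<Omega> (\<lambda>x. 0) x = 0" .
  qed
  then show "(L2_norm \<Omega> (\<lambda>x. p x - 0))\<^sup>2 + (L2_norm \<Omega> (\<lambda>x. matrix_sqrt (K x) *v weak_grad \<Omega> (\<lambda>x. 0) x))\<^sup>2 \<le> (L2_norm \<Omega> p)\<^sup>2"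
    by (simp add: L2_norm_sq) (simp add: L2_inner_def)
qed (rule L2_norm_nonneg)

text \<open>For r = p - div v with gradient - K^(-1) v, where v is \<open>rep p\<close>, the two
  terms of the infimum are exactly |div v|^2 and |K^(-1/2) v|^2. Their sum is the square of
  \<open>V_norm\<close>, so no constant is lost.\<close>

lemma b_norm_le_rep:
  assumes p: "p \<in> L2 \<Omega>"
  shows "b_norm \<Omega> K p \<le> V_norm \<Omega> K (rep p)"
proof -
  let ?v = "rep p"
  note v = rep(1)[OF p] and vD = HdivD[OF rep(1)[OF p]]
  define r where "r x = p x - weak_div \<Omega> ?v x" for x
  define g where "g x = - 1 *\<^sub>R (matrix_inv (K x) *v ?v x)" for x
  have r: "r \<in> L2 \<Omega>" unfolding r_def[abs_def] by (intro L2_diff p vD)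
  have g: "g \<in> L2 \<Omega>" unfolding g_def[abs_def] by (intro L2_scaleR inv_K_L2 vD)
  have "is_weak_grad \<Omega> r g"
    unfolding is_weak_grad_iff[OF r g]
  proof (intro ballI allI)
    fix \<phi> i assume \<phi>: "\<phi> \<in> test_functions \<Omega>"
    let ?w = "\<lambda>x. \<phi> x *\<^sub>R axis i 1 :: real ^ 'n" and ?d = "\<lambda>x. grad \<phi> x $ i"
    note w = test_field_Hdiv[OF \<phi>, of i]
    have wL2: "?w \<in> L2 \<Omega>" and d: "?d \<in> L2 \<Omega>"
      using HdivD(1)[OF w(1)] test_functions_grad_nth_L2[OF \<phi>] by auto
    have div: "L2_inner \<Omega> q (weak_div \<Omega> ?w) = L2_inner \<Omega> q ?d" if "q \<in> L2 \<Omega>" for q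
      by (intro L2_inner_cong_AE that HdivD w d) auto
    \<comment> \<open>The form a against \<phi> times the i-th unit vector extracts the i-th
      component of K^(-1) v, that is, of - g. The equation of \<open>rep p\<close> equates it with
      the inner product of p - div v and the i-th derivative of \<phi>.\<close>
    have "L2_inner \<Omega> (W ?v) (W ?w) = - L2_inner \<Omega> \<phi> (\<lambda>x. g x $ i)"
      using a_form_eq[OF vD(1) wL2]
      by (simp add: a_form_def L2_inner_def g_def inner_axis mult.commute)
    moreover have "V_inner ?v ?w = L2_inner \<Omega> p ?d"
      using rep(2)[OF p w(1)] div[OF p] by simp
    moreover have "L2_inner \<Omega> r ?d = L2_inner \<Omega> p ?d - L2_inner \<Omega> (weak_div \<Omega> ?v) ?d"
      using L2_inner_comb[OF p vD(2) d, of "-1"] by (simp add: r_def[abs_def])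
    ultimately show "L2_inner \<Omega> r ?d = - L2_inner \<Omega> \<phi> (\<lambda>x. g x $ i)"
      using div[OF vD(2)] unfolding V_inner_def by linarith
  qed
  note R = weak_grad_eq[OF r g this]
  have "L2_inner \<Omega> (\<lambda>x. matrix_sqrt (K x) *v weak_grad \<Omega> r x) (\<lambda>x. matrix_sqrt (K x) *v weak_grad \<Omega> r x)
      = L2_inner \<Omega> (\<lambda>x. - 1 *\<^sub>R W ?v x) (\<lambda>x. - 1 *\<^sub>R W ?v x)"
  proof -
    have "AE x in M. matrix_sqrt (K x) *v weak_grad \<Omega> r x = - 1 *\<^sub>R W ?v x"
      using R(2) sqrt_K_inv_K[of ?v]
      by eventually_elim (simp add: g_def bounded_bilinear.minus_right[OF bounded_bilinear_matrix_vector_mult])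
    then show ?thesis
      by (intro L2_inner_cong_AE sqrt_K_L2 H1D R L2_scaleR W_L2 vD)
  qed
  also have "\<dots> = L2_inner \<Omega> (W ?v) (W ?v)"
    by (simp add: L2_inner_def)
  finally show ?thesis
    by (intro b_norm_le[OF R(1)] V_norm_nonneg) (simp add: V_norm_sq L2_norm_sq r_def V_inner_def)
qed

section \<open>Energy norm and inf-sup conditions\<close>

lemma Hdiv_uminus:
  assumes v: "v \<in> Hdiv \<Omega>"
  shows "(\<lambda>x. (-1) *\<^sub>R v x) \<in> Hdiv \<Omega>"
    "\<And>w. w \<in> L2 \<Omega> \<Longrightarrow> a_form \<Omega> K w (\<lambda>x. (-1) *\<^sub>R v x) = - a_form \<Omega> K w v"
    "\<And>q. q \<in> L2 \<Omega> \<Longrightarrow> b_form \<Omega> (\<lambda>x. (-1) *\<^sub>R v x) q = - b_form \<Omega> v q"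
    "V_norm \<Omega> K (\<lambda>x. (-1) *\<^sub>R v x) = V_norm \<Omega> K v"
proof -
  \<comment> \<open>Negation is expressed as v - 2 v so that the laws for u + c v apply; the suprema
    below exploit this change of sign.\<close>
  have eq: "(\<lambda>x. (-1) *\<^sub>R v x) = (\<lambda>x. v x + (-2) *\<^sub>R v x)"
    by (auto simp: fun_eq_iff scaleR_2 algebra_simps)
  show "(\<lambda>x. (-1) *\<^sub>R v x) \<in> Hdiv \<Omega>"
    unfolding eq by (intro weak_div_comb v)
  show "a_form \<Omega> K w (\<lambda>x. (-1) *\<^sub>R v x) = - a_form \<Omega> K w v" if "w \<in> L2 \<Omega>" for w
    by (simp add: a_form_def)
  show "b_form \<Omega> (\<lambda>x. (-1) *\<^sub>R v x) q = - b_form \<Omega> v q" if "q \<in> L2 \<Omega>" for q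
    unfolding eq b_form_eq weak_div_comb_inner[OF v v that] by simp
  show "V_norm \<Omega> K (\<lambda>x. (-1) *\<^sub>R v x) = V_norm \<Omega> K v"
    unfolding eq V_norm_eq V.B_comb_comb[OF v v] by (simp add: power2_eq_square)
qed

lemma div_preimage:
  assumes p: "p \<in> L2 \<Omega>"
  obtains v where "v \<in> Hdiv \<Omega>" "AE x in M. weak_div \<Omega> v x = p x"
proof -
  obtain C where "\<And>p. p \<in> L2 \<Omega> \<Longrightarrow>
      \<exists>v\<in>Hdiv \<Omega>. (AE x in M. weak_div \<Omega> v x = p x) \<and> L2_norm \<Omega> v \<le> C * L2_norm \<Omega> p"
    using div_surjective by blast
  from this[OF p] show thesis using that by blast
qed

text \<open>A field of divergence one. The suprema range over nonzero norms and would be minus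
  infinity over an empty set.\<close>

lemma V_norm_nonzero:
  obtains v where "v \<in> Hdiv \<Omega>" "V_norm \<Omega> K v \<noteq> 0"
proof -
  obtain v where v: "v \<in> Hdiv \<Omega>" "AE x in M. weak_div \<Omega> v x = 1"
    using div_preimage[OF L2_one] by blast
  have "L2_inner \<Omega> (weak_div \<Omega> v) (weak_div \<Omega> v) = L2_inner \<Omega> (\<lambda>x. 1 :: real) (\<lambda>x. 1)"
    by (intro L2_inner_cong_AE HdivD L2_one v)
  also have "\<dots> = measure lebesgue \<Omega>"
    by (simp add: L2_inner_def measure_restrict_space)
  also have "\<dots> > 0"
  proof -
    have "\<not> negligible \<Omega>"
      using open_dom nonempty open_not_negligible by blast
    then show ?thesis
      using dom_lmeasurable negligible_iff_measure by (metis zero_less_measure_iff)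
  qed
  finally have "0 < (L2_norm \<Omega> (weak_div \<Omega> v))\<^sup>2"
    by (simp add: L2_norm_sq)
  then have "V_norm \<Omega> K v \<noteq> 0"
    using div_le_V_norm[of v] L2_norm_nonneg[of \<Omega> "weak_div \<Omega> v"] by auto
  with v(1) show thesis by (rule that)
qed

lemma energy_sq:
  assumes "0 \<le> \<alpha>"
  shows "(energy_norm \<Omega> K \<alpha> v q)\<^sup>2 = V_inner v v + (b_norm \<Omega> K q)\<^sup>2 + \<alpha> * L2_inner \<Omega> q q"
proof -
  have "0 \<le> V_inner v v + (b_norm \<Omega> K q)\<^sup>2 + \<alpha> * (L2_norm \<Omega> q)\<^sup>2"
    using assms by (intro add_nonneg_nonneg mult_nonneg_nonneg V_inner_nonneg) simp_all
  then show ?thesis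
    by (simp add: energy_norm_def V_norm_sq c_norm_eq flip: L2_norm_sq)
qed

lemma energy_nonneg: "0 \<le> \<alpha> \<Longrightarrow> 0 \<le> energy_norm \<Omega> K \<alpha> v q"
  unfolding energy_norm_def by (intro real_sqrt_ge_zero add_nonneg_nonneg mult_nonneg_nonneg) simp_all

lemma V_norm_le_energy:
  assumes "0 \<le> \<alpha>"
  shows "V_norm \<Omega> K v \<le> energy_norm \<Omega> K \<alpha> v q"
proof (rule power2_le_imp_le)
  have "0 \<le> \<alpha> * L2_inner \<Omega> q q"
    using assms by (simp flip: L2_norm_sq)
  then show "(V_norm \<Omega> K v)\<^sup>2 \<le> (energy_norm \<Omega> K \<alpha> v q)\<^sup>2"
    by (simp add: energy_sq[OF assms] V_norm_sq)
qed (rule energy_nonneg[OF assms])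

text \<open>The b-part and, by \<alpha> \<le> 1, the c-part each cost at most |q|^2, whatever
  \<open>K\<close> is; hence the factor 2.\<close>

lemma energy_le:
  assumes "0 \<le> \<alpha>" "\<alpha> \<le> 1" and q: "q \<in> L2 \<Omega>"
  shows "(energy_norm \<Omega> K \<alpha> v q)\<^sup>2 \<le> V_inner v v + 2 * L2_inner \<Omega> q q"
proof -
  have "(b_norm \<Omega> K q)\<^sup>2 \<le> L2_inner \<Omega> q q"
    using power_mono[OF b_norm_le_L2_norm[OF q] b_norm_nonneg, of 2] by (simp add: L2_norm_sq)
  moreover have "\<alpha> * L2_inner \<Omega> q q \<le> 1 * L2_inner \<Omega> q q"
    using assms by (intro mult_right_mono) (simp_all flip: L2_norm_sq)
  ultimately show ?thesis
    by (simp add: energy_sq assms)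
qed

lemma kernel_coercivity:
  assumes v: "v \<in> V \<Omega> K" and ker: "\<forall>q\<in>Q\<^sub>b \<Omega> K. b_form \<Omega> v q = 0"
  shows "a_form \<Omega> K v v = (V_norm \<Omega> K v)\<^sup>2"
proof -
  have v': "v \<in> Hdiv \<Omega>" using v by (simp add: V_eq)
  note vD = HdivD[OF v']
  have "L2_inner \<Omega> (weak_div \<Omega> v) (weak_div \<Omega> v) = 0"
    using ker vD(2) by (simp add: Qb_eq b_form_eq)
  then show ?thesis
    by (simp add: V_norm_sq V_inner_def a_form_eq vD)
qed

lemma b_form_inf_sup:
  assumes p: "p \<in> Q\<^sub>b \<Omega> K"
  shows "ereal (b_norm \<Omega> K p) \<le> (SUP v \<in> {v \<in> V \<Omega> K. V_norm \<Omega> K v \<noteq> 0}. ereal (b_form \<Omega> v p / V_norm \<Omega> K v))"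
    (is "_ \<le> ?S")
proof -
  have p': "p \<in> L2 \<Omega>" using p by (simp add: Qb_eq)
  have upper: "ereal (b_form \<Omega> v p / V_norm \<Omega> K v) \<le> ?S" if "v \<in> Hdiv \<Omega>" "V_norm \<Omega> K v \<noteq> 0" for v
    using that by (intro SUP_upper) (simp add: V_eq)
  show ?thesis
  proof (cases "V_norm \<Omega> K (rep p) = 0")
    \<comment> \<open>Here \<open>rep p\<close> is excluded from the supremum, but then
      \<open>b_norm\<close> is zero too. Nonnegativity of the supremum remains, and one of v and -v
      provides it.\<close>
    case True
    then have "b_norm \<Omega> K p = 0"
      using b_norm_le_rep[OF p'] b_norm_nonneg[of p] by simp
    obtain v where v: "v \<in> Hdiv \<Omega>" "V_norm \<Omega> K v \<noteq> 0"
      using V_norm_nonzero by blast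
    note n = Hdiv_uminus[OF v(1)]
    have "0 \<le> ?S"
    proof (cases "0 \<le> b_form \<Omega> v p")
      case True
      then have "0 \<le> ereal (b_form \<Omega> v p / V_norm \<Omega> K v)" by (simp add: V_norm_nonneg)
      then show ?thesis using upper[OF v] by (rule order_trans)
    next
      case False
      then have "0 \<le> ereal (b_form \<Omega> (\<lambda>x. (-1) *\<^sub>R v x) p / V_norm \<Omega> K (\<lambda>x. (-1) *\<^sub>R v x))"
        unfolding n(3)[OF p'] n(4) by (simp add: V_norm_nonneg divide_nonpos_nonneg)
      moreover have "V_norm \<Omega> K (\<lambda>x. (-1) *\<^sub>R v x) \<noteq> 0"
        unfolding n(4) by (rule v(2))
      ultimately show ?thesis using upper[OF n(1)] order_trans by blast
    qed
    then show ?thesis using \<open>b_norm \<Omega> K p = 0\<close> by (simp add: zero_ereal_def)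
  next
    case False
    have "b_form \<Omega> (rep p) p = (V_norm \<Omega> K (rep p))\<^sup>2"
      unfolding V_norm_sq rep(2)[OF p' rep(1)[OF p']] b_form_eq by (rule L2_inner_commute)
    then have "b_norm \<Omega> K p \<le> b_form \<Omega> (rep p) p / V_norm \<Omega> K (rep p)"
      using False b_norm_le_rep[OF p'] by (simp add: power2_eq_square)
    then show ?thesis
      using upper[OF rep(1)[OF p'] False] by (meson ereal_less_eq(3) order_trans)
  qed
qed

text \<open>Paired with q = 0, one of v and -v has a nonnegative numerator. Covers u of norm zero in
  \<open>u_inf_sup\<close> and rules out a negative \<open>data_norm\<close> in
  \<open>stability\<close>.\<close>

lemma sup_over_pairs_nonneg:
  assumes "0 \<le> \<alpha>" and v: "v \<in> Hdiv \<Omega>" "V_norm \<Omega> K v \<noteq> 0"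
    and neg: "f (\<lambda>x. (-1) *\<^sub>R v x) = - f v" and g: "g (\<lambda>x. 0 :: real) = 0"
  shows "0 \<le> (SUP (v, q) \<in> {(v, q). v \<in> V \<Omega> K \<and> q \<in> Q \<Omega> K \<and> energy_norm \<Omega> K \<alpha> v q \<noteq> 0}.
              ereal ((f v + g q) / energy_norm \<Omega> K \<alpha> v q))" (is "_ \<le> ?S")
proof -
  have ex: "0 \<le> ?S" if w: "w \<in> Hdiv \<Omega>" "V_norm \<Omega> K w \<noteq> 0" "0 \<le> f w" for w
  proof -
    have "energy_norm \<Omega> K \<alpha> w (\<lambda>x. 0) \<noteq> 0"
      using V_norm_le_energy[OF \<open>0 \<le> \<alpha>\<close>, of w "\<lambda>x. 0"] V_norm_nonneg[of w] w(2) by linarith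
    then have "ereal ((f w + g (\<lambda>x. 0)) / energy_norm \<Omega> K \<alpha> w (\<lambda>x. 0)) \<le> ?S"
      using w by (intro SUP_upper2[of "(w, \<lambda>x. 0)"]) (auto simp: V_eq Q_eq L2_zero)
    moreover have "0 \<le> ereal ((f w + g (\<lambda>x. 0)) / energy_norm \<Omega> K \<alpha> w (\<lambda>x. 0))"
      using w(3) energy_nonneg[OF \<open>0 \<le> \<alpha>\<close>] by (simp add: g)
    ultimately show ?thesis by (rule order_trans[rotated])
  qed
  note n = Hdiv_uminus[OF v(1)]
  show ?thesis
  proof (cases "0 \<le> f v")
    case True
    with v show ?thesis by (rule ex)
  next
    case False
    show ?thesis
    proof (rule ex[OF n(1)])
      show "V_norm \<Omega> K (\<lambda>x. (-1) *\<^sub>R v x) \<noteq> 0" unfolding n(4) by (rule v(2))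
      show "0 \<le> f (\<lambda>x. (-1) *\<^sub>R v x)" unfolding neg using False by simp
    qed
  qed
qed

lemma u_inf_sup:
  assumes \<alpha>: "0 \<le> \<alpha>" "\<alpha> \<le> 1" and u: "u \<in> V \<Omega> K"
  shows "ereal (1/2 * V_norm \<Omega> K u) \<le>
    (SUP (v, q) \<in> {(v, q). v \<in> V \<Omega> K \<and> q \<in> Q \<Omega> K \<and> energy_norm \<Omega> K \<alpha> v q \<noteq> 0}.
       ereal ((a_form \<Omega> K u v + b_form \<Omega> u q) / energy_norm \<Omega> K \<alpha> v q))" (is "_ \<le> ?S")
proof -
  have u': "u \<in> Hdiv \<Omega>" using u by (simp add: V_eq)
  note uD = HdivD[OF u']
  show ?thesis
  proof (cases "V_norm \<Omega> K u = 0")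
    case True
    obtain v where v: "v \<in> Hdiv \<Omega>" "V_norm \<Omega> K v \<noteq> 0"
      using V_norm_nonzero by blast
    have "0 \<le> ?S"
      by (rule sup_over_pairs_nonneg[OF \<alpha>(1) v]) (simp_all only: Hdiv_uminus(2)[OF v(1) uD(1)], simp add: b_form_def)
    then show ?thesis by (simp add: True zero_ereal_def)
  next
    case False
    let ?d = "weak_div \<Omega> u" and ?e = "energy_norm \<Omega> K \<alpha> u (weak_div \<Omega> u)"
    have pos: "?e > 0"
      using V_norm_le_energy[OF \<alpha>(1), of u ?d] V_norm_nonneg[of u] False by linarith
    have "?e\<^sup>2 \<le> (2 * V_norm \<Omega> K u)\<^sup>2"
    proof -
      have "?e\<^sup>2 \<le> V_inner u u + 2 * L2_inner \<Omega> ?d ?d"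
        by (rule energy_le[OF \<alpha> uD(2)])
      \<comment> \<open>Three would do; the square number 4 gives the energy bound 2 |u| and with it
        the constant 1/2.\<close>
      also have "\<dots> \<le> 4 * V_inner u u"
        unfolding V_inner_def by (simp flip: L2_norm_sq)
      finally show ?thesis by (simp add: power_mult_distrib V_norm_sq)
    qed
    then have le: "?e \<le> 2 * V_norm \<Omega> K u"
      by (rule power2_le_imp_le) (simp add: V_norm_nonneg)
    have "V_norm \<Omega> K u * ?e \<le> V_norm \<Omega> K u * (2 * V_norm \<Omega> K u)"
      by (rule mult_left_mono[OF le V_norm_nonneg])
    then have "1/2 * V_norm \<Omega> K u \<le> (V_norm \<Omega> K u)\<^sup>2 / ?e"
      using pos by (simp add: pos_le_divide_eq power2_eq_square)
    also have "(V_norm \<Omega> K u)\<^sup>2 = a_form \<Omega> K u u + b_form \<Omega> u ?d"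
      by (simp add: V_norm_sq V_inner_def a_form_eq uD b_form_eq)
    finally have "ereal (1/2 * V_norm \<Omega> K u) \<le> ereal ((a_form \<Omega> K u u + b_form \<Omega> u ?d) / ?e)"
      by (simp only: ereal_less_eq)
    also have "\<dots> \<le> ?S"
      using u uD pos by (intro SUP_upper2[of "(u, ?d)"]) (auto simp: Q_eq)
    finally show ?thesis .
  qed
qed

section \<open>Existence, uniqueness and stability for the mixed problem\<close>

lemma Riesz_L2:
  fixes s :: "(real ^ 'n \<Rightarrow> real) \<Rightarrow> (real ^ 'n \<Rightarrow> real) \<Rightarrow> real"
  assumes "semi_inner (L2 \<Omega>) (\<lambda>f c g x. f x + c *\<^sub>R g x) s" and "c > 0"
    and coercive: "\<And>p. p \<in> L2 \<Omega> \<Longrightarrow> c * L2_inner \<Omega> p p \<le> s p p"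
    and weak: "\<And>z p q. \<lbrakk>\<And>n. z n \<in> L2 \<Omega>; p \<in> L2 \<Omega>; (\<lambda>n. L2_norm \<Omega> (\<lambda>x. z n x - p x)) \<longlonglongrightarrow> 0; q \<in> L2 \<Omega>\<rbrakk>
      \<Longrightarrow> (\<lambda>n. s (z n) q) \<longlonglongrightarrow> s p q"
    and lin: "\<And>p q c. \<lbrakk>p \<in> L2 \<Omega>; q \<in> L2 \<Omega>\<rbrakk> \<Longrightarrow> F (\<lambda>x. p x + c *\<^sub>R q x) = F p + c * F q"
    and bdd: "\<And>p. p \<in> L2 \<Omega> \<Longrightarrow> \<bar>F p\<bar> \<le> B * L2_norm \<Omega> p"
  shows "\<exists>p\<in>L2 \<Omega>. \<forall>q\<in>L2 \<Omega>. s p q = F q"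
proof -
  interpret semi_inner "L2 \<Omega>" "\<lambda>f c g x. f x + c *\<^sub>R g x" s by fact
  \<comment> \<open>Coercivity makes s-Cauchy sequences Cauchy in L2, and \<open>weak\<close>
    carries the L2 limit back to s; this is Lax-Milgram for a symmetric form.\<close>
  have low: "sqrt c * L2_norm \<Omega> p \<le> sqrt (s p p)" if "p \<in> L2 \<Omega>" for p
    using real_sqrt_le_mono[OF coercive[OF that]] by (simp add: real_sqrt_mult L2_norm_eq)
  show ?thesis
  proof (rule Riesz_representation[where F = F and M = "\<bar>B\<bar> / sqrt c"])
    show "L2 \<Omega> \<noteq> ({} :: (real ^ 'n \<Rightarrow> real) set)" using L2_zero by blast
    show "\<bar>F p\<bar> \<le> \<bar>B\<bar> / sqrt c * sqrt (s p p)" if p: "p \<in> L2 \<Omega>" for p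
    proof -
      have "\<bar>F p\<bar> \<le> \<bar>B\<bar> * L2_norm \<Omega> p"
        using bdd[OF p] mult_right_mono[OF abs_ge_self L2_norm_nonneg, of B \<Omega> p] by linarith
      also have "\<dots> \<le> \<bar>B\<bar> * (sqrt (s p p) / sqrt c)"
        using low[OF p] \<open>c > 0\<close> by (intro mult_left_mono) (simp_all add: field_simps)
      finally show ?thesis by simp
    qed
    fix z assume Cz: "Cauchy_seq z"
    have z: "z n \<in> L2 \<Omega>" for n using Cz unfolding Cauchy_seq_def by blast
    have "\<exists>N. \<forall>m\<ge>N. \<forall>n\<ge>N. L2_norm \<Omega> (\<lambda>x. z m x - z n x) < e" if "e > 0" for e
    proof -
      have "sqrt c * e > 0" using \<open>c > 0\<close> that by simp
      then obtain N where N: "\<And>m n. \<lbrakk>m \<ge> N; n \<ge> N\<rbrakk> \<Longrightarrow>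
          sqrt (s (\<lambda>x. z m x + (-1) *\<^sub>R z n x) (\<lambda>x. z m x + (-1) *\<^sub>R z n x)) < sqrt c * e"
        using Cz unfolding Cauchy_seq_def by blast
      have "L2_norm \<Omega> (\<lambda>x. z m x - z n x) < e" if "m \<ge> N" "n \<ge> N" for m n
      proof -
        have "sqrt c * L2_norm \<Omega> (\<lambda>x. z m x - z n x) < sqrt c * e"
          using low[OF L2_comb[OF z z], of m "-1" n] N[OF that] by simp
        then show ?thesis using \<open>c > 0\<close> by simp
      qed
      then show ?thesis by blast
    qed
    from L2_complete[OF finite_measure_dom z this]
    obtain p where p: "p \<in> L2 \<Omega>" "(\<lambda>n. L2_norm \<Omega> (\<lambda>x. z n x - p x)) \<longlonglongrightarrow> 0"
      by blast
    then show "\<exists>u\<in>L2 \<Omega>. \<forall>y\<in>L2 \<Omega>. (\<lambda>n. s (z n) y) \<longlonglongrightarrow> s u y"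
      using weak[OF z p] by blast
  qed (use lin in auto)
qed

text \<open>Adding the second equation with \<open>q = div v\<close> to the first gives
  \<open>u = w + (1 - \<alpha>) rep p\<close> with \<open>w\<close> depending on the data only. Substitution into the second equation
  leaves a symmetric coercive problem for \<open>p\<close>, for all \<open>\<alpha>\<close> at once.\<close>

lemma mixed_solution_exists:
  assumes \<alpha>: "0 \<le> \<alpha>" "\<alpha> \<le> 1"
    and F: "F \<in> dual_space (V \<Omega> K) (V_norm \<Omega> K)" and G: "G \<in> dual_space (Q \<Omega> K) (L2_norm \<Omega>)"
  obtains u p where "mixed_solution \<Omega> K \<alpha> F G u p"
proof -
  note FD = dual_spaceD[OF F, unfolded V_eq] and GD = dual_spaceD[OF G, unfolded Q_eq]
  obtain B1 where B1: "\<And>v. v \<in> Hdiv \<Omega> \<Longrightarrow> \<bar>F v\<bar> \<le> B1 * V_norm \<Omega> K v" using FD(3) by blast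
  obtain B2 where B2: "\<And>q. q \<in> L2 \<Omega> \<Longrightarrow> \<bar>G q\<bar> \<le> B2 * L2_norm \<Omega> q" using GD(3) by blast
  have scale: "(\<lambda>x. c *\<^sub>R v x) \<in> Hdiv \<Omega>" if "v \<in> Hdiv \<Omega>" for c v
    using weak_div_comb(1)[OF that that, of "c - 1"] by (simp add: algebra_simps)
  have Flin: "F (\<lambda>x. u x + c *\<^sub>R v x) = F u + c * F v" if "u \<in> Hdiv \<Omega>" "v \<in> Hdiv \<Omega>" for u v c
    using FD(1)[OF that scale[OF that(2)]] .
  have Glin: "G (\<lambda>x. p x + c *\<^sub>R q x) = G p + c * G q" if "p \<in> L2 \<Omega>" "q \<in> L2 \<Omega>" for p q c
    using GD(1)[OF that L2_scaleR[OF that(2)]] .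
  \<comment> \<open>A functional bounded by \<open>L2_norm\<close> ignores null sets. This matters
    because \<open>weak_div\<close> is linear only almost everywhere.\<close>
  have Gcong: "G p = G q" if "p \<in> L2 \<Omega>" "q \<in> L2 \<Omega>" "AE x in M. p x = q x" for p q
  proof -
    have "L2_inner \<Omega> (\<lambda>x. p x + (-1) *\<^sub>R q x) (\<lambda>x. p x + (-1) *\<^sub>R q x) = L2_inner \<Omega> (\<lambda>x. 0 :: real) (\<lambda>x. 0)"
      using that(3) by (intro L2_inner_cong_AE L2_comb L2_zero that) auto
    then have "L2_norm \<Omega> (\<lambda>x. p x + (-1) *\<^sub>R q x) = 0"
      unfolding L2_norm_eq by (simp add: L2_inner_def)
    then show ?thesis
      using B2[OF L2_comb[OF that(1,2)], of "-1"] Glin[OF that(1,2), of "-1"] by simp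
  qed
  have "\<exists>w\<in>Hdiv \<Omega>. \<forall>v\<in>Hdiv \<Omega>. V_inner w v = F v + G (weak_div \<Omega> v)"
  proof (rule Riesz_Hdiv)
    fix u v c assume uv: "u \<in> Hdiv \<Omega>" "v \<in> Hdiv \<Omega>"
    have "G (weak_div \<Omega> (\<lambda>x. u x + c *\<^sub>R v x)) = G (\<lambda>x. weak_div \<Omega> u x + c *\<^sub>R weak_div \<Omega> v x)"
      by (intro Gcong weak_div_comb L2_comb HdivD(2) uv)
    then show "F (\<lambda>x. u x + c *\<^sub>R v x) + G (weak_div \<Omega> (\<lambda>x. u x + c *\<^sub>R v x))
        = F u + G (weak_div \<Omega> u) + c * (F v + G (weak_div \<Omega> v))"
      by (simp only: Flin Glin HdivD(2) uv) (simp add: algebra_simps)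
  next
    fix v assume v: "v \<in> Hdiv \<Omega>"
    have "\<bar>G (weak_div \<Omega> v)\<bar> \<le> \<bar>B2\<bar> * L2_norm \<Omega> (weak_div \<Omega> v)"
      using B2[OF HdivD(2)[OF v]] mult_right_mono[OF abs_ge_self L2_norm_nonneg, of B2 \<Omega> "weak_div \<Omega> v"]
      by linarith
    also have "\<dots> \<le> \<bar>B2\<bar> * V_norm \<Omega> K v"
      by (intro mult_left_mono div_le_V_norm) simp
    finally show "\<bar>F v + G (weak_div \<Omega> v)\<bar> \<le> (B1 + \<bar>B2\<bar>) * V_norm \<Omega> K v"
      using B1[OF v] by (simp add: algebra_simps)
  qed
  then obtain w where w: "w \<in> Hdiv \<Omega>" "\<And>v. v \<in> Hdiv \<Omega> \<Longrightarrow> V_inner w v = F v + G (weak_div \<Omega> v)"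
    by blast
  note wD = HdivD[OF w(1)]
  obtain \<beta> where \<beta>: "\<beta> > 0" "\<And>p. p \<in> L2 \<Omega> \<Longrightarrow> \<beta> * L2_inner \<Omega> p p \<le> V_inner (rep p) (rep p)"
    using rep_bounded_below by blast
  define s where "s p q = (1 - \<alpha>) * V_inner (rep p) (rep q) + \<alpha> * L2_inner \<Omega> p q" for p q
  \<comment> \<open>\<open>rep\<close> is a choice and not manifestly linear. In this form p occurs
    only in L2 inner products, from which linearity and continuity in p are read off.\<close>
  have s_eq: "s p q = (1 - \<alpha>) * L2_inner \<Omega> p (weak_div \<Omega> (rep q)) + \<alpha> * L2_inner \<Omega> p q"
    if "p \<in> L2 \<Omega>" "q \<in> L2 \<Omega>" for p q
    by (simp add: s_def rep that)
  have nn: "0 \<le> L2_inner \<Omega> p p" for p :: "real ^ 'n \<Rightarrow> real"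
    by (simp flip: L2_norm_sq)
  have semi: "semi_inner (L2 \<Omega>) (\<lambda>f c g x. f x + c *\<^sub>R g x) s"
  proof
    show "s (\<lambda>x. f x + c *\<^sub>R g x) h = s f h + c * s g h"
      if "f \<in> L2 \<Omega>" "g \<in> L2 \<Omega>" "h \<in> L2 \<Omega>" for f g h c
      using that HdivD(2)[OF rep(1)] by (simp only: s_eq L2_comb L2_inner_comb) (simp add: algebra_simps)
    show "s f g = s g f" if "f \<in> L2 \<Omega>" "g \<in> L2 \<Omega>" for f g
      using V.sym[OF rep(1)[OF that(1)] rep(1)[OF that(2)]] by (simp add: s_def L2_inner_commute[of \<Omega> f g])
    show "0 \<le> s f f" for f
      unfolding s_def using \<alpha> by (intro add_nonneg_nonneg mult_nonneg_nonneg V_inner_nonneg nn) auto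
  qed (rule L2_comb)
  have "\<exists>p\<in>L2 \<Omega>. \<forall>q\<in>L2 \<Omega>. s p q = G q - L2_inner \<Omega> (weak_div \<Omega> w) q"
  proof (rule Riesz_L2[OF semi])
    show "0 < min \<beta> 1" using \<beta>(1) by simp
    show "min \<beta> 1 * L2_inner \<Omega> p p \<le> s p p" if p: "p \<in> L2 \<Omega>" for p
    proof -
      \<comment> \<open>\<open>s\<close> is a convex combination of two forms that both dominate min
        \<beta> 1 times |p|^2, so one constant serves every \<alpha> in [0, 1].\<close>
      have "min \<beta> 1 * L2_inner \<Omega> p p \<le> V_inner (rep p) (rep p)"
        using \<beta>(2)[OF p] mult_right_mono[OF min.cobounded1 nn, of \<beta> 1 p] by linarith
      moreover have "min \<beta> 1 * L2_inner \<Omega> p p \<le> L2_inner \<Omega> p p"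
        using mult_right_mono[OF min.cobounded2 nn, of \<beta> 1 p] by simp
      ultimately have "(1 - \<alpha>) * (min \<beta> 1 * L2_inner \<Omega> p p) + \<alpha> * (min \<beta> 1 * L2_inner \<Omega> p p) \<le> s p p"
        unfolding s_def using \<alpha> by (intro add_mono mult_left_mono) auto
      then show ?thesis by (simp add: algebra_simps)
    qed
    show "(\<lambda>n. s (z n) q) \<longlonglongrightarrow> s p q"
      if z: "\<And>n. z n \<in> L2 \<Omega>" and p: "p \<in> L2 \<Omega>" and lim: "(\<lambda>n. L2_norm \<Omega> (\<lambda>x. z n x - p x)) \<longlonglongrightarrow> 0" and q: "q \<in> L2 \<Omega>"
      for z p q
      unfolding s_eq[OF z q] s_eq[OF p q]
      by (intro tendsto_add tendsto_mult tendsto_const L2_inner_tendsto[OF z p _ lim] q HdivD(2) rep)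
    show "G (\<lambda>x. p x + c *\<^sub>R q x) - L2_inner \<Omega> (weak_div \<Omega> w) (\<lambda>x. p x + c *\<^sub>R q x)
        = G p - L2_inner \<Omega> (weak_div \<Omega> w) p + c * (G q - L2_inner \<Omega> (weak_div \<Omega> w) q)"
      if "p \<in> L2 \<Omega>" "q \<in> L2 \<Omega>" for p q c
      using that unfolding L2_inner_commute[of \<Omega> "weak_div \<Omega> w"]
      by (simp only: Glin L2_inner_comb wD) (simp add: algebra_simps)
    show "\<bar>G p - L2_inner \<Omega> (weak_div \<Omega> w) p\<bar> \<le> (B2 + L2_norm \<Omega> (weak_div \<Omega> w)) * L2_norm \<Omega> p"
      if "p \<in> L2 \<Omega>" for p
      using B2[OF that] L2_Cauchy_Schwarz[OF wD(2) that] by (simp add: algebra_simps)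
  qed
  then obtain p where p: "p \<in> L2 \<Omega>" "\<And>q. q \<in> L2 \<Omega> \<Longrightarrow> s p q = G q - L2_inner \<Omega> (weak_div \<Omega> w) q"
    by blast
  define u where "u x = w x + (1 - \<alpha>) *\<^sub>R rep p x" for x
  have u: "u \<in> Hdiv \<Omega>"
    unfolding u_def[abs_def] by (intro weak_div_comb w rep p)
  note uD = HdivD[OF u]
  have eq2: "b_form \<Omega> u q + \<alpha> * c_form \<Omega> p q = G q" if q: "q \<in> L2 \<Omega>" for q
  proof -
    \<comment> \<open>The map p \<mapsto> div (rep p) is symmetric: its pairing with q is the V
      inner product of the two representatives. This turns the equation for \<open>s\<close> into
      the second mixed equation.\<close>
    have "L2_inner \<Omega> (weak_div \<Omega> (rep p)) q = V_inner (rep p) (rep q)"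
      using rep(2)[OF q rep(1)[OF p(1)]] V.sym[OF rep(1)[OF q] rep(1)[OF p(1)]]
      by (simp add: L2_inner_commute[of \<Omega> q])
    then have "b_form \<Omega> u q = L2_inner \<Omega> (weak_div \<Omega> w) q + (1 - \<alpha>) * V_inner (rep p) (rep q)"
      unfolding b_form_eq u_def[abs_def] weak_div_comb_inner[OF w(1) rep(1)[OF p(1)] q] by simp
    then show ?thesis
      using p(2)[OF q] by (simp add: s_def c_form_eq)
  qed
  have eq1: "a_form \<Omega> K u v - b_form \<Omega> v p = F v" if v: "v \<in> Hdiv \<Omega>" for v
  proof -
    note vD = HdivD[OF v]
    have "V_inner u v = F v + G (weak_div \<Omega> v) + (1 - \<alpha>) * L2_inner \<Omega> p (weak_div \<Omega> v)"
      unfolding u_def[abs_def] V.B_comb[OF w(1) rep(1)[OF p(1)] v] w(2)[OF v] rep(2)[OF p(1) v] ..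
    moreover have "V_inner u v = a_form \<Omega> K u v + L2_inner \<Omega> (weak_div \<Omega> u) (weak_div \<Omega> v)"
      by (simp add: V_inner_def a_form_eq uD vD)
    \<comment> \<open>Subtracting the second equation with q = div v recovers the first.\<close>
    ultimately show ?thesis
      using eq2[OF vD(2)]
      by (simp add: b_form_eq c_form_eq L2_inner_commute[of \<Omega> "weak_div \<Omega> v" p] algebra_simps)
  qed
  have "mixed_solution \<Omega> K \<alpha> F G u p"
    unfolding mixed_solution_def V_eq Q_eq using u p(1) eq1 eq2 by blast
  then show thesis by (rule that)
qed

text \<open>Testing the difference with itself makes its weighted flux vanish, hence the flux. For
  \<alpha> = 0 this says nothing about the pressure, which is recovered from the first equation with
  a field whose divergence is the pressure difference.\<close>

lemma mixed_solution_unique: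
  assumes \<alpha>: "0 \<le> \<alpha>" and s: "mixed_solution \<Omega> K \<alpha> F G u p" and s': "mixed_solution \<Omega> K \<alpha> F G u' p'"
  shows "AE x in M. u' x = u x" "AE x in M. p' x = p x"
proof -
  note S = s[unfolded mixed_solution_def V_eq Q_eq] and S' = s'[unfolded mixed_solution_def V_eq Q_eq]
  have u: "u \<in> Hdiv \<Omega>" "u' \<in> Hdiv \<Omega>" and p: "p \<in> L2 \<Omega>" "p' \<in> L2 \<Omega>"
    using S S' by auto
  define w where "w x = u' x + (-1) *\<^sub>R u x" for x
  define \<pi> where "\<pi> x = p' x + (-1) *\<^sub>R p x" for x
  have w: "w \<in> Hdiv \<Omega>" unfolding w_def[abs_def] by (intro weak_div_comb u)
  have \<pi>: "\<pi> \<in> L2 \<Omega>" unfolding \<pi>_def[abs_def] by (intro L2_comb p)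
  note wD = HdivD[OF w]
  have eq1: "L2_inner \<Omega> (W w) (W v) = L2_inner \<Omega> (weak_div \<Omega> v) \<pi>" if v: "v \<in> Hdiv \<Omega>" for v
  proof -
    note vD = HdivD[OF v]
    have "L2_inner \<Omega> (W w) (W v) = L2_inner \<Omega> (W u') (W v) - L2_inner \<Omega> (W u) (W v)"
      unfolding w_def[abs_def] W_comb
        L2_inner_comb[OF W_L2[OF HdivD(1)[OF u(2)]] W_L2[OF HdivD(1)[OF u(1)]] W_L2[OF vD(1)]] by simp
    moreover have "L2_inner \<Omega> (weak_div \<Omega> v) \<pi> = L2_inner \<Omega> (weak_div \<Omega> v) p' - L2_inner \<Omega> (weak_div \<Omega> v) p"
      unfolding L2_inner_commute[of \<Omega> "weak_div \<Omega> v"] \<pi>_def[abs_def] L2_inner_comb[OF p(2,1) vD(2)] by simp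
    moreover have "a_form \<Omega> K u v - b_form \<Omega> v p = F v" "a_form \<Omega> K u' v - b_form \<Omega> v p' = F v"
      using S S' v by auto
    ultimately show ?thesis
      by (simp add: a_form_eq[OF HdivD(1) HdivD(1)] u v b_form_eq)
  qed
  have eq2: "L2_inner \<Omega> (weak_div \<Omega> w) q + \<alpha> * L2_inner \<Omega> \<pi> q = 0" if q: "q \<in> L2 \<Omega>" for q
  proof -
    have 1: "L2_inner \<Omega> (weak_div \<Omega> w) q = L2_inner \<Omega> (weak_div \<Omega> u') q - L2_inner \<Omega> (weak_div \<Omega> u) q"
      unfolding w_def[abs_def] weak_div_comb_inner[OF u(2,1) q] by simp
    have 2: "L2_inner \<Omega> \<pi> q = L2_inner \<Omega> p' q - L2_inner \<Omega> p q"
      unfolding \<pi>_def[abs_def] L2_inner_comb[OF p(2,1) q] by simp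
    have "b_form \<Omega> u q + \<alpha> * c_form \<Omega> p q = G q" "b_form \<Omega> u' q + \<alpha> * c_form \<Omega> p' q = G q"
      using S S' q by auto
    then show ?thesis unfolding 1 2
      by (simp add: b_form_eq c_form_eq algebra_simps)
  qed
  have "L2_inner \<Omega> (W w) (W w) + \<alpha> * L2_inner \<Omega> \<pi> \<pi> = 0"
    using eq1[OF w] eq2[OF \<pi>] by simp
  moreover have "0 \<le> \<alpha> * L2_inner \<Omega> \<pi> \<pi>"
    using \<alpha> by (simp flip: L2_norm_sq)
  ultimately have W0: "L2_inner \<Omega> (W w) (W w) \<le> 0" by linarith
  have W00: "L2_norm \<Omega> (W w) = 0"
    using W0 L2_norm_sq[of \<Omega> "W w"] by (metis antisym zero_le_power2 power_eq_0_iff pos2)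
  obtain c where c: "L2_norm \<Omega> w \<le> c * L2_norm \<Omega> (W w)"
    using W_bounds wD(1) by metis
  then have "L2_inner \<Omega> w w \<le> 0"
    using W00 L2_norm_nonneg[of \<Omega> w] L2_norm_sq[of \<Omega> w] by simp
  from L2_inner_self_eq_0[OF wD(1) this] show "AE x in M. u' x = u x"
    by (simp add: w_def)
  obtain v where v: "v \<in> Hdiv \<Omega>" "AE x in M. weak_div \<Omega> v x = \<pi> x"
    using div_preimage[OF \<pi>] by blast
  have "L2_inner \<Omega> \<pi> \<pi> = L2_inner \<Omega> (weak_div \<Omega> v) \<pi>"
    using v(2) by (intro L2_inner_cong_AE \<pi> HdivD v(1)) auto
  also have "\<dots> = L2_inner \<Omega> (W w) (W v)" by (simp add: eq1 v)
  also have "\<dots> \<le> 0"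
    using L2_Cauchy_Schwarz[OF W_L2[OF wD(1)] W_L2[OF HdivD(1)[OF v(1)]]] W00 by simp
  finally show "AE x in M. p' x = p x"
    using L2_inner_self_eq_0[OF \<pi>] by (simp add: \<pi>_def)
qed

text \<open>With \<open>D\<close> the norm of the data and \<open>N\<close> the energy norm of the solution, testing with
  \<open>(u, p)\<close>, \<open>(\<plusminus>u, div u)\<close> and \<open>(- rep p, 0)\<close> yields \<open>N\<^sup>2 \<le> 6 D N + 2 D\<^sup>2\<close>.\<close>

lemma stability:
  assumes \<alpha>: "0 \<le> \<alpha>" "\<alpha> \<le> 1"
    and F: "F \<in> dual_space (V \<Omega> K) (V_norm \<Omega> K)" and G: "G \<in> dual_space (Q \<Omega> K) (L2_norm \<Omega>)"
    and s: "mixed_solution \<Omega> K \<alpha> F G u p"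
  shows "ereal (energy_norm \<Omega> K \<alpha> u p) \<le> ereal 8 * data_norm \<Omega> K \<alpha> F G"
proof -
  note FD = dual_spaceD[OF F, unfolded V_eq] and GD = dual_spaceD[OF G, unfolded Q_eq]
  note S = s[unfolded mixed_solution_def V_eq Q_eq]
  have u: "u \<in> Hdiv \<Omega>" and p: "p \<in> L2 \<Omega>"
    and eq1: "\<And>v. v \<in> Hdiv \<Omega> \<Longrightarrow> a_form \<Omega> K u v - b_form \<Omega> v p = F v"
    and eq2: "\<And>q. q \<in> L2 \<Omega> \<Longrightarrow> b_form \<Omega> u q + \<alpha> * c_form \<Omega> p q = G q"
    using S by auto
  note uD = HdivD[OF u]
  have G0: "G (\<lambda>x. 0) = 0"
    using GD(2)[OF L2_zero, of 0] by simp
  obtain v0 where v0: "v0 \<in> Hdiv \<Omega>" "V_norm \<Omega> K v0 \<noteq> 0"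
    using V_norm_nonzero by blast
  have nonneg: "0 \<le> data_norm \<Omega> K \<alpha> F G"
    unfolding data_norm_def
  proof (rule sup_over_pairs_nonneg[OF \<alpha>(1) v0])
    show "F (\<lambda>x. (-1) *\<^sub>R v0 x) = - F v0"
      using FD(2)[OF v0(1), of "-1"] by simp
  qed (rule G0)
  show ?thesis
  proof (cases "data_norm \<Omega> K \<alpha> F G")
    case PInf
    then show ?thesis by simp
  next
    case MInf
    then show ?thesis using nonneg by simp
  next
    case (real D)
    then have "0 \<le> D" using nonneg by simp
    have test: "F v + G q \<le> D * energy_norm \<Omega> K \<alpha> v q"
      if "v \<in> Hdiv \<Omega>" "q \<in> L2 \<Omega>" "energy_norm \<Omega> K \<alpha> v q \<noteq> 0" for v q
    proof -
      have "ereal ((F v + G q) / energy_norm \<Omega> K \<alpha> v q) \<le> data_norm \<Omega> K \<alpha> F G"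
        unfolding data_norm_def using that by (intro SUP_upper2[of "(v, q)"]) (auto simp: V_eq Q_eq)
      then have "(F v + G q) / energy_norm \<Omega> K \<alpha> v q \<le> D"
        by (simp add: real)
      then show ?thesis
        using energy_nonneg[OF \<alpha>(1), of v q] that(3) by (simp add: pos_divide_le_eq)
    qed
    let ?d = "weak_div \<Omega> u"
    define N where "N = energy_norm \<Omega> K \<alpha> u p"
    define A where "A = L2_inner \<Omega> (W u) (W u)"
    define z where "z = \<alpha> * L2_inner \<Omega> p p"
    define d where "d = L2_norm \<Omega> ?d"
    define y where "y = b_norm \<Omega> K p"
    have N0: "0 \<le> N" and A0: "0 \<le> A" and z0: "0 \<le> z" and d0: "0 \<le> d" and y0: "0 \<le> y"
      using \<alpha> by (simp_all add: N_def energy_nonneg A_def z_def d_def y_def L2_norm_nonneg b_norm_nonneg flip: L2_norm_sq)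
    have Nsq: "N\<^sup>2 = A + d\<^sup>2 + y\<^sup>2 + z"
      by (simp add: N_def energy_sq \<alpha> V_inner_def A_def z_def d_def y_def L2_norm_sq)
    have a_uu: "a_form \<Omega> K u u = A" by (simp add: a_form_eq uD A_def)
    have t1: "A + z \<le> D * N"
    \<comment> \<open>Pairs of zero energy lie outside the supremum and need separate
      treatment.\<close>
    proof (cases "N = 0")
      case True
      then have "A + z = 0"
        using Nsq A0 z0 by (smt (verit) zero_le_power2 zero_eq_power2)
      then show ?thesis using True by simp
    next
      case False
      have "A + z = F u + G p"
        using eq1[OF u] eq2[OF p] by (simp add: a_uu c_form_eq z_def)
      then show ?thesis
        using test[OF u p] False by (simp add: N_def)
    qed
    have t2: "d\<^sup>2 \<le> 2 * D * N + z + d\<^sup>2 / 4"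
    proof (cases "V_norm \<Omega> K u = 0")
      case True
      then have "d = 0" using div_le_V_norm[of u] d0 by (simp add: d_def)
      then show ?thesis using \<open>0 \<le> D\<close> N0 z0 by simp
    next
      case False
      let ?n = "\<lambda>x. (-1) *\<^sub>R u x"
      note n = Hdiv_uminus[OF u]
      have en: "energy_norm \<Omega> K \<alpha> v ?d \<le> 2 * N \<and> energy_norm \<Omega> K \<alpha> v ?d \<noteq> 0"
        if "V_norm \<Omega> K v = V_norm \<Omega> K u" for v
      proof
        have "(energy_norm \<Omega> K \<alpha> v ?d)\<^sup>2 \<le> V_inner v v + 2 * d\<^sup>2"
          using energy_le[OF \<alpha> uD(2), of v] by (simp add: d_def L2_norm_sq)
        also have "V_inner v v = A + d\<^sup>2"
          using that V_norm_sq[of v] V_norm_sq[of u] by (simp add: V_inner_def[of u] A_def d_def L2_norm_sq)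
        also have "A + d\<^sup>2 + 2 * d\<^sup>2 \<le> 4 * N\<^sup>2"
          unfolding Nsq using A0 z0 by (simp add: add_nonneg_nonneg)
        finally show "energy_norm \<Omega> K \<alpha> v ?d \<le> 2 * N"
          by - (rule power2_le_imp_le, use N0 in \<open>simp_all add: power_mult_distrib\<close>)
        show "energy_norm \<Omega> K \<alpha> v ?d \<noteq> 0"
          using V_norm_le_energy[OF \<alpha>(1), of v ?d] V_norm_nonneg[of u] False that by linarith
      qed
      have bound: "F v + G ?d \<le> D * (2 * N)" if "v \<in> Hdiv \<Omega>" "V_norm \<Omega> K v = V_norm \<Omega> K u" for v
        using test[OF that(1) uD(2)] en[OF that(2)] mult_left_mono[OF _ \<open>0 \<le> D\<close>] order_trans by blast
      \<comment> \<open>The unknown sign of F u is removed by adding the bounds for u and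
        -u.\<close>
      have "F u + G ?d \<le> D * (2 * N)" "F ?n + G ?d \<le> D * (2 * N)"
        by (rule bound[OF u refl], rule bound[OF n(1,4)])
      moreover have "F ?n = - F u" using FD(2)[OF u, of "-1"] by simp
      ultimately have "G ?d \<le> 2 * D * N" by simp
      moreover have "d\<^sup>2 = G ?d - \<alpha> * L2_inner \<Omega> p ?d"
        using eq2[OF uD(2)] by (simp add: b_form_eq c_form_eq d_def L2_norm_sq)
      moreover have "- (\<alpha> * L2_inner \<Omega> p ?d) \<le> z + d\<^sup>2 / 4"
      proof -
        have "- (\<alpha> * L2_inner \<Omega> p ?d) \<le> \<alpha> * (L2_norm \<Omega> p * d)"
        proof -
          have "- L2_inner \<Omega> p ?d \<le> L2_norm \<Omega> p * d"
            using L2_Cauchy_Schwarz[OF p uD(2)] unfolding d_def by linarith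
          from mult_left_mono[OF this \<alpha>(1)] show ?thesis by simp
        qed
        also have "\<dots> \<le> \<alpha> * ((L2_norm \<Omega> p)\<^sup>2 + d\<^sup>2 / 4)"
        proof (rule mult_left_mono[OF _ \<alpha>(1)])
          \<comment> \<open>Young's inequality, weighted so that d^2 / 4 can be absorbed on the left
            while \<alpha> |p|^2 is exactly z.\<close>
          have "0 \<le> (L2_norm \<Omega> p - d / 2)\<^sup>2" by simp
          then show "L2_norm \<Omega> p * d \<le> (L2_norm \<Omega> p)\<^sup>2 + d\<^sup>2 / 4"
            by (simp add: power2_diff power_divide)
        qed
        also have "\<dots> \<le> z + d\<^sup>2 / 4"
          using mult_right_mono[OF \<alpha>(2), of "d\<^sup>2 / 4"] by (simp add: z_def L2_norm_sq algebra_simps)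
        finally show ?thesis .
      qed
      ultimately show ?thesis by linarith
    qed
    \<comment> \<open>The first equation tested with \<open>rep p\<close> gives r^2 = a(u, rep p) -
      F(rep p). Cauchy-Schwarz in the weighted inner product and the test pair (- rep p, 0) bound
      this by (sqrt A + D) r, without any constant from \<open>K\<close>.\<close>
    have t3: "y \<le> sqrt A + D"
    proof -
      let ?v = "rep p"
      note v = rep(1)[OF p]
      note vD = HdivD[OF v] and n = Hdiv_uminus[OF v]
      define r where "r = V_norm \<Omega> K ?v"
      have "r \<le> sqrt A + D"
      proof (cases "r = 0")
        case True
        then show ?thesis using A0 \<open>0 \<le> D\<close> by simp
      next
        case False
        have "energy_norm \<Omega> K \<alpha> (\<lambda>x. (-1) *\<^sub>R ?v x) (\<lambda>x. 0) \<le> r"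
        proof (rule power2_le_imp_le)
          have "(energy_norm \<Omega> K \<alpha> (\<lambda>x. (-1) *\<^sub>R ?v x) (\<lambda>x. 0))\<^sup>2
              \<le> V_inner (\<lambda>x. (-1) *\<^sub>R ?v x) (\<lambda>x. (-1) *\<^sub>R ?v x) + 2 * L2_inner \<Omega> (\<lambda>x. 0 :: real) (\<lambda>x. 0)"
            by (rule energy_le[OF \<alpha> L2_zero])
          also have "\<dots> = r\<^sup>2"
            unfolding V_norm_sq[symmetric] n(4) by (simp add: r_def L2_inner_def)
          finally show "(energy_norm \<Omega> K \<alpha> (\<lambda>x. (-1) *\<^sub>R ?v x) (\<lambda>x. 0))\<^sup>2 \<le> r\<^sup>2" .
        qed (simp add: r_def V_norm_nonneg)
        moreover have "energy_norm \<Omega> K \<alpha> (\<lambda>x. (-1) *\<^sub>R ?v x) (\<lambda>x. 0) \<noteq> 0"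
          using V_norm_le_energy[OF \<alpha>(1), of "\<lambda>x. (-1) *\<^sub>R ?v x" "\<lambda>x. 0"] V_norm_nonneg[of ?v] False
          unfolding n(4) r_def by linarith
        ultimately have "F (\<lambda>x. (-1) *\<^sub>R ?v x) + G (\<lambda>x. 0) \<le> D * r"
          using test[OF n(1) L2_zero] mult_left_mono[OF _ \<open>0 \<le> D\<close>] by (meson order_trans)
        then have "- F ?v \<le> D * r"
          using FD(2)[OF v, of "-1"] G0 by simp
        moreover have "r\<^sup>2 = a_form \<Omega> K u ?v - F ?v"
          using eq1[OF v] rep(2)[OF p v]
          by (simp add: r_def V_norm_sq b_form_eq L2_inner_commute[of \<Omega> "weak_div \<Omega> ?v" p])
        moreover have "a_form \<Omega> K u ?v \<le> sqrt A * r"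
        proof -
          have "a_form \<Omega> K u ?v \<le> L2_norm \<Omega> (W u) * L2_norm \<Omega> (W ?v)"
            using L2_Cauchy_Schwarz[OF W_L2[OF uD(1)] W_L2[OF vD(1)]] by (simp add: a_form_eq uD vD)
          also have "\<dots> \<le> L2_norm \<Omega> (W u) * r"
            unfolding r_def by (rule mult_left_mono[OF W_le_V_norm L2_norm_nonneg])
          finally show ?thesis by (simp add: A_def L2_norm_eq)
        qed
        ultimately have "r * r \<le> (sqrt A + D) * r"
          by (simp add: power2_eq_square algebra_simps)
        moreover have "0 < r" using False V_norm_nonneg[of ?v] by (simp add: r_def)
        ultimately show ?thesis by simp
      qed
      then show ?thesis
        using b_norm_le_rep[OF p] by (simp add: y_def r_def)
    qed
    have y2: "y\<^sup>2 \<le> 2 * A + 2 * D\<^sup>2"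
    proof -
      have "y\<^sup>2 \<le> (sqrt A + D)\<^sup>2" using t3 y0 by (rule power_mono)
      also have "\<dots> \<le> 2 * (sqrt A)\<^sup>2 + 2 * D\<^sup>2"
        using sum_squares_bound[of "sqrt A" D] by (simp add: power2_sum)
      finally show ?thesis using A0 by simp
    qed
    have "N\<^sup>2 \<le> 6 * (D * N) + 2 * D\<^sup>2"
      \<comment> \<open>From \<open>t2\<close>, d^2 \<le> 8/3 D N + 4/3 z. Hence N^2 \<le> 3 A + 7/3
        z + 8/3 D N + 2 D^2, and A + z \<le> D N bounds this by 17/3 D N + 2 D^2.\<close>
      using Nsq y2 t1 t2 A0 z0 by (simp add: algebra_simps)
    \<comment> \<open>8 exceeds the positive root 3 + sqrt 11 of x^2 = 6 x + 2, so N > 8 D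
      contradicts the quadratic inequality.\<close>
    have "N \<le> 8 * D"
    proof (rule ccontr)
      assume "\<not> N \<le> 8 * D"
      then have *: "8 * D < N" by simp
      then have "N * (8 * D) \<le> N * N" using N0 by (intro mult_left_mono) auto
      moreover have "D * (8 * D) \<le> D * N" using * \<open>0 \<le> D\<close> by (intro mult_left_mono) auto
      ultimately have "N * N \<le> 0 \<or> D * N \<le> 0"
        using \<open>N\<^sup>2 \<le> 6 * (D * N) + 2 * D\<^sup>2\<close> by (simp add: power2_eq_square algebra_simps)
      then show False
        using * \<open>0 \<le> D\<close> \<open>N\<^sup>2 \<le> 6 * (D * N) + 2 * D\<^sup>2\<close> by (auto simp: mult_le_0_iff power2_eq_square)
    qed
    then show ?thesis
      by (simp add: real N_def)
  qed
qed

end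

theorem lemma3p1:
  fixes \<Omega> :: "(real ^ 'n) set"
  assumes dim: "CARD('n) = 2 \<or> CARD('n) = 3"
    and dom: "Lipschitz_domain \<Omega>"
  shows
    "(\<exists>C>0. \<forall>K. admissible_coefficient \<Omega> K \<longrightarrow>
        (\<forall>v \<in> V \<Omega> K. (\<forall>q \<in> Q\<^sub>b \<Omega> K. b_form \<Omega> v q = 0) \<longrightarrow>
           a_form \<Omega> K v v \<ge> C * (V_norm \<Omega> K v)\<^sup>2))
     \<and>
     (\<exists>C>0. \<forall>K. admissible_coefficient \<Omega> K \<longrightarrow>
        (\<forall>p \<in> Q\<^sub>b \<Omega> K.
           (SUP v \<in> {v \<in> V \<Omega> K. V_norm \<Omega> K v \<noteq> 0}. ereal (b_form \<Omega> v p / V_norm \<Omega> K v))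
             \<ge> ereal (C * b_norm \<Omega> K p)))
     \<and>
     (\<exists>C>0. \<forall>K \<alpha>. admissible_coefficient \<Omega> K \<longrightarrow> 0 \<le> \<alpha> \<longrightarrow> \<alpha> \<le> 1 \<longrightarrow>
        (\<forall>u \<in> V \<Omega> K.
           (SUP (v, q) \<in> {(v, q). v \<in> V \<Omega> K \<and> q \<in> Q \<Omega> K \<and> energy_norm \<Omega> K \<alpha> v q \<noteq> 0}.
              ereal ((a_form \<Omega> K u v + b_form \<Omega> u q) / energy_norm \<Omega> K \<alpha> v q))
             \<ge> ereal (C * V_norm \<Omega> K u)))
     \<and>
     (\<exists>C>0. \<forall>K \<alpha>. admissible_coefficient \<Omega> K \<longrightarrow> 0 \<le> \<alpha> \<longrightarrow> \<alpha> \<le> 1 \<longrightarrow>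
        (\<forall>F \<in> dual_space (V \<Omega> K) (V_norm \<Omega> K). \<forall>G \<in> dual_space (Q \<Omega> K) (L2_norm \<Omega>).
           \<exists>u p. mixed_solution \<Omega> K \<alpha> F G u p \<and>
             (\<forall>u' p'. mixed_solution \<Omega> K \<alpha> F G u' p' \<longrightarrow>
                (AE x in lebesgue_on \<Omega>. u' x = u x) \<and> (AE x in lebesgue_on \<Omega>. p' x = p x)) \<and>
             ereal (energy_norm \<Omega> K \<alpha> u p) \<le> ereal C * data_norm \<Omega> K \<alpha> F G))"
proof -
  have coefficient: "coefficient \<Omega> K" if "admissible_coefficient \<Omega> K" for K
    using dom that by unfold_locales (auto simp: Lipschitz_domain_def)
  show ?thesis
  proof (intro conjI)
    show "\<exists>C>0. \<forall>K. admissible_coefficient \<Omega> K \<longrightarrow>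
        (\<forall>v \<in> V \<Omega> K. (\<forall>q \<in> Q\<^sub>b \<Omega> K. b_form \<Omega> v q = 0) \<longrightarrow> a_form \<Omega> K v v \<ge> C * (V_norm \<Omega> K v)\<^sup>2)"
      using coefficient.kernel_coercivity[OF coefficient] by (intro exI[of _ 1]) simp
    show "\<exists>C>0. \<forall>K. admissible_coefficient \<Omega> K \<longrightarrow>
        (\<forall>p \<in> Q\<^sub>b \<Omega> K.
           (SUP v \<in> {v \<in> V \<Omega> K. V_norm \<Omega> K v \<noteq> 0}. ereal (b_form \<Omega> v p / V_norm \<Omega> K v))
             \<ge> ereal (C * b_norm \<Omega> K p))"
      using coefficient.b_form_inf_sup[OF coefficient] by (intro exI[of _ 1]) simp
    show "\<exists>C>0. \<forall>K \<alpha>. admissible_coefficient \<Omega> K \<longrightarrow> 0 \<le> \<alpha> \<longrightarrow> \<alpha> \<le> 1 \<longrightarrow>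
        (\<forall>u \<in> V \<Omega> K.
           (SUP (v, q) \<in> {(v, q). v \<in> V \<Omega> K \<and> q \<in> Q \<Omega> K \<and> energy_norm \<Omega> K \<alpha> v q \<noteq> 0}.
              ereal ((a_form \<Omega> K u v + b_form \<Omega> u q) / energy_norm \<Omega> K \<alpha> v q))
             \<ge> ereal (C * V_norm \<Omega> K u))"
      by (rule exI[of _ "1/2"], intro conjI allI impI ballI, simp)
        (rule coefficient.u_inf_sup[OF coefficient])
    show "\<exists>C>0. \<forall>K \<alpha>. admissible_coefficient \<Omega> K \<longrightarrow> 0 \<le> \<alpha> \<longrightarrow> \<alpha> \<le> 1 \<longrightarrow>
        (\<forall>F \<in> dual_space (V \<Omega> K) (V_norm \<Omega> K). \<forall>G \<in> dual_space (Q \<Omega> K) (L2_norm \<Omega>).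
           \<exists>u p. mixed_solution \<Omega> K \<alpha> F G u p \<and>
             (\<forall>u' p'. mixed_solution \<Omega> K \<alpha> F G u' p' \<longrightarrow>
                (AE x in lebesgue_on \<Omega>. u' x = u x) \<and> (AE x in lebesgue_on \<Omega>. p' x = p x)) \<and>
             ereal (energy_norm \<Omega> K \<alpha> u p) \<le> ereal C * data_norm \<Omega> K \<alpha> F G)"
    proof (rule exI[of _ 8], intro conjI allI impI ballI)
      fix K :: "real ^ 'n \<Rightarrow> real ^ 'n ^ 'n" and \<alpha> :: real and F G
      assume "admissible_coefficient \<Omega> K" and \<alpha>: "0 \<le> \<alpha>" "\<alpha> \<le> 1"
        and FG: "F \<in> dual_space (V \<Omega> K) (V_norm \<Omega> K)" "G \<in> dual_space (Q \<Omega> K) (L2_norm \<Omega>)"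
      then interpret coefficient \<Omega> K by (intro coefficient)
      obtain u p where s: "mixed_solution \<Omega> K \<alpha> F G u p"
        using mixed_solution_exists[OF \<alpha> FG] by blast
      then show "\<exists>u p. mixed_solution \<Omega> K \<alpha> F G u p \<and>
             (\<forall>u' p'. mixed_solution \<Omega> K \<alpha> F G u' p' \<longrightarrow>
                (AE x in lebesgue_on \<Omega>. u' x = u x) \<and> (AE x in lebesgue_on \<Omega>. p' x = p x)) \<and>
             ereal (energy_norm \<Omega> K \<alpha> u p) \<le> ereal 8 * data_norm \<Omega> K \<alpha> F G"
        using mixed_solution_unique[OF \<alpha>(1) s] stability[OF \<alpha> FG s] by blast
    qed simp
  qed
qed

end
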